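(* Let $K=\mathbb{C}\{\{t\}\}$, let $I\unlhd K[x]=K[x_1,\dots,x_n]$ be a homogeneous ideal generated by polynomials with coefficients in $\mathbb{R}$, and suppose $I$ is invariant under a group $S$ acting on $K[x]$ by signed permutations of the variables. Let $C_w(I)\subseteq\mathrm{Trop}(I)$ be a maximal Gröbner cone with $\mathrm{in}_w(I)$ binomial, and let $G\subseteq\mathrm{in}_w(I)$ be a reduced Gröbner basis of $\mathrm{in}_w(I)$ with respect to any monomial ordering. Then for any $\sigma\in S$, $$\sigma\cdot C_w(I)\subseteq\mathrm{Trop}^+(I)\quad\Longleftrightarrow\quad (\sigma\cdot G)\cap\mathbb{R}_{\ge0}[x]=\emptyset\ \text{ and }\ (\sigma\cdot G)\cap\mathbb{R}_{\le0}[x]=\emptyset .$$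
   Context: $K=\mathbb{C}\{\{t\}\}$ carries its natural valuation $\nu$. For $f=\sum_\alpha c_\alpha x^\alpha\in K[x]$ and $w\in\mathbb{R}^n$, the initial form (max-convention) is $\mathrm{in}_w(f)=\sum \overline{t^{-\nu(c_\alpha)}c_\alpha}\,x^\alpha\in\mathbb{C}[x]$, the sum being over the $\alpha$ with $w\cdot\alpha-\nu(c_\alpha)$ maximal; $\mathrm{in}_w(I)=\langle\mathrm{in}_w(g)\mid g\in I\rangle\unlhd\mathbb{C}[x]$. Under the assumptions on $I$, every initial ideal is generated by real polynomials and its reduced Gröbner bases lie in $\mathbb{R}[x]$. An ideal is binomial if it is generated by polynomials with at most two terms. $\mathrm{Trop}(I)=\{w\in\mathbb{R}^n\mid\mathrm{in}_w(I)\text{ contains no monomial}\}$. The Gröbner cone of $w$ is the Euclidean closure $C_w(I)=\mathrm{cl}\{v\mid\mathrm{in}_v(I)=\mathrm{in}_w(I)\}$; "maximal" means inclusion-maximal among the Gröbner cones contained in $\mathrm{Trop}(I)$. Let $R_{>0}\subset K$ be the set of nonzero Puiseux series whose lowest-order coefficient is real and positive. The positive tropicalization is $\mathrm{Trop}^+(I)=\mathrm{cl}\{(-\nu(z_1),\dots,-\nu(z_n))\mid z\in V(I)\cap(R_{>0})^n\}$. Equivalently (Speyer–Williams), it is the set of $w$ such that $\mathrm{in}_w(I)$ contains no monomial and $\mathrm{in}_w(I)\cap\mathbb{R}_{\ge0}[x]=\{0\}$. $S$ acting by signed permutations means: for each $\sigma\in S$ there are a permutation $|\sigma|\in S_n$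 and signs $u_i\in\{\pm1\}$ with $\sigma\cdot x_i=u_i x_{|\sigma|(i)}$ for all $i$. Invariance of $I$ means $\sigma\cdot I=I$ for all $\sigma\in S$. $S$ acts on $\mathbb{R}^n$ by the corresponding unsigned permutations, $(\sigma\cdot w)_{|\sigma|(i)}=w_i$. $\mathbb{R}_{\ge0}[x]$ (resp. $\mathbb{R}_{\le0}[x]$) denotes polynomials with all coefficients $\ge0$ (resp. $\le0$). *)

theory Defs
  imports
    "HOL-Analysis.Analysis"
    "HOL-Library.Poly_Mapping"
    "HOL-Library.Nonpos_Ints"
    "HOL-Computational_Algebra.Formal_Laurent_Series"
    "HOL-Algebra.Group_Action"
begin

unbundle no fps_syntax

section \<open>The field of Puiseux series\<close>

text \<open>
  A (formal) Puiseux series over the complex numbers is given by its coefficient function: the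
  coefficient of \<open>t\<close> to the power \<open>q\<close>, for rational \<open>q\<close>. The exponents that occur
  have a common denominator and are bounded below.
\<close>

definition puiseux_coeffs :: "(rat \<Rightarrow> complex) set" where
  "puiseux_coeffs = {f. \<exists>N>0::nat. \<exists>m::int. \<forall>q. f q \<noteq> 0 \<longrightarrow> (\<exists>k\<ge>m. q = of_int k / of_nat N)}"

typedef puiseux = puiseux_coeffs
  morphisms puiseux_nth Abs_puiseux
  by (rule exI[of _ "\<lambda>_. 0"]) (auto simp: puiseux_coeffs_def intro: exI[of _ "1::nat"])

setup_lifting type_definition_puiseux

text \<open>The Laurent series \<open>F\<close> read as a series in the \<open>N\<close>-th root of \<open>t\<close>.\<close>

definition ramify :: "nat \<Rightarrow> complex fls \<Rightarrow> rat \<Rightarrow> complex" where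
  "ramify N F q = (if of_nat N * q \<in> \<int> then fls_nth F \<lfloor>of_nat N * q\<rfloor> else 0)"

lemma ramify_of_int: "N > 0 \<Longrightarrow> ramify N F (of_int k / of_nat N) = fls_nth F k"
  by (simp add: ramify_def)

lemma ramify_nonzeroE:
  assumes "N > 0" "ramify N F q \<noteq> 0"
  obtains k where "q = of_int k / of_nat N" "fls_nth F k \<noteq> 0"
proof -
  from assms(2) have "of_nat N * q \<in> \<int>" by (auto simp: ramify_def split: if_splits)
  then obtain k where k: "of_nat N * q = of_int k" by (auto elim: Ints_cases)
  then have "q = of_int k / of_nat N" using assms(1) by (simp add: field_simps)
  moreover have "fls_nth F k \<noteq> 0" using assms ramify_of_int[OF assms(1), of F k] calculation by simp
  ultimately show thesis by (rule that)
qed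

lemma ramify_in_puiseux_coeffs:
  assumes "N > 0"
  shows "ramify N F \<in> puiseux_coeffs"
proof -
  have "\<exists>k\<ge>fls_subdegree F. q = of_int k / of_nat N" if "ramify N F q \<noteq> 0" for q
    using ramify_nonzeroE[OF assms that] fls_subdegree_leI by metis
  then show ?thesis unfolding puiseux_coeffs_def using assms by blast
qed

lemma puiseux_coeffs_cases:
  assumes "f \<in> puiseux_coeffs"
  obtains N where "N > 0" "\<And>M. M > 0 \<Longrightarrow> N dvd M \<Longrightarrow> \<exists>F. f = ramify M F"
proof -
  from assms obtain N m where N: "N > 0"
    and m: "\<And>q. f q \<noteq> 0 \<Longrightarrow> \<exists>k\<ge>m. q = of_int k / of_nat N"
    unfolding puiseux_coeffs_def by blast
  have "\<exists>F. f = ramify M F" if M: "M > 0" "N dvd M" for M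
  proof -
    obtain d where d: "M = N * d" using M by blast
    have d0: "d > 0" using M d by (cases d) auto
    define c where "c = (\<lambda>k::int. f (of_int k / of_nat M))"
    have lb: "c k = 0" if "k < min 0 (m * int d)" for k
    proof (rule ccontr)
      assume "c k \<noteq> 0"
      then obtain j where j: "j \<ge> m" "of_int k / of_nat M = (of_int j / of_nat N :: rat)"
        using m unfolding c_def by blast
      have "(of_int k :: rat) = of_int (j * int d)"
        using j(2) N d0 by (simp add: d field_simps)
      then have "k = j * int d" by linarith
      moreover have "j * int d \<ge> m * int d" using j(1) by (simp add: mult_right_mono)
      ultimately show False using that by simp
    qed
    have nth: "fls_nth (Abs_fls c) k = c k" for k
      by (rule nth_Abs_fls_lower_bound[of "min 0 (m * int d)"]) (use lb in blast)
    have "f q = ramify M (Abs_fls c) q" for q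
    proof (cases "of_nat M * q \<in> \<int>")
      case True
      then obtain k where k: "of_nat M * q = of_int k" by (auto elim: Ints_cases)
      then have q: "q = of_int k / of_nat M" using M by (simp add: field_simps)
      show ?thesis unfolding q using M by (simp only: ramify_of_int nth) (simp add: c_def)
    next
      case False
      have "f q = 0"
      proof (rule ccontr)
        assume "f q \<noteq> 0"
        then obtain j where "q = of_int j / of_nat N" using m by blast
        then have "of_nat M * q = of_int (int d * j)" using N by (simp add: d)
        then show False using False by (metis Ints_of_int)
      qed
      then show ?thesis using False by (simp add: ramify_def)
    qed
    then show ?thesis by blast
  qed
  then show thesis using N that by blast
qed

lemma puiseux_coeffs_common2:
  assumes "f \<in> puiseux_coeffs" "g \<in> puiseux_coeffs"
  obtains N F G where "N > 0" "f = ramify N F" "g = ramify N G"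
proof -
  obtain A where A: "A > 0" "\<And>M. M > 0 \<Longrightarrow> A dvd M \<Longrightarrow> \<exists>F. f = ramify M F"
    using puiseux_coeffs_cases[OF assms(1)] by blast
  obtain B where B: "B > 0" "\<And>M. M > 0 \<Longrightarrow> B dvd M \<Longrightarrow> \<exists>F. g = ramify M F"
    using puiseux_coeffs_cases[OF assms(2)] by blast
  have pos: "A * B > 0" using A(1) B(1) by simp
  obtain F where F: "f = ramify (A * B) F" using A(2)[OF pos] by auto
  obtain G where G: "g = ramify (A * B) G" using B(2)[OF pos] by auto
  show thesis by (rule that[OF pos F G])
qed

lemma puiseux_coeffs_common3:
  assumes "f \<in> puiseux_coeffs" "g \<in> puiseux_coeffs" "h \<in> puiseux_coeffs"
  obtains N F G H where "N > 0" "f = ramify N F" "g = ramify N G" "h = ramify N H"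
proof -
  obtain A where A: "A > 0" "\<And>M. M > 0 \<Longrightarrow> A dvd M \<Longrightarrow> \<exists>F. f = ramify M F"
    using puiseux_coeffs_cases[OF assms(1)] by blast
  obtain B where B: "B > 0" "\<And>M. M > 0 \<Longrightarrow> B dvd M \<Longrightarrow> \<exists>F. g = ramify M F"
    using puiseux_coeffs_cases[OF assms(2)] by blast
  obtain C where C: "C > 0" "\<And>M. M > 0 \<Longrightarrow> C dvd M \<Longrightarrow> \<exists>F. h = ramify M F"
    using puiseux_coeffs_cases[OF assms(3)] by blast
  have pos: "A * B * C > 0" using A(1) B(1) C(1) by simp
  obtain F where F: "f = ramify (A * B * C) F" using A(2)[OF pos] by auto
  obtain G where G: "g = ramify (A * B * C) G" using B(2)[OF pos] by auto
  obtain H where H: "h = ramify (A * B * C) H" using C(2)[OF pos] by auto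
  show thesis by (rule that[OF pos F G H])
qed

definition puiseux_conv :: "(rat \<Rightarrow> complex) \<Rightarrow> (rat \<Rightarrow> complex) \<Rightarrow> rat \<Rightarrow> complex" where
  "puiseux_conv f g q = (\<Sum>a\<in>{a. f a \<noteq> 0 \<and> g (q - a) \<noteq> 0}. f a * g (q - a))"

lemma ramify_add: "(\<lambda>q. ramify N F q + ramify N G q) = ramify N (F + G)"
  by (auto simp: ramify_def)

lemma ramify_diff: "(\<lambda>q. ramify N F q - ramify N G q) = ramify N (F - G)"
  by (auto simp: ramify_def)

lemma ramify_uminus: "(\<lambda>q. - ramify N F q) = ramify N (- F)"
  by (auto simp: ramify_def)

lemma ramify_0: "ramify N 0 = (\<lambda>_. 0)"
  by (auto simp: ramify_def)

lemma ramify_1: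
  assumes "N > 0"
  shows "ramify N 1 = (\<lambda>q. if q = 0 then 1 else 0)"
proof
  fix q :: rat
  show "ramify N 1 q = (if q = 0 then 1 else 0)"
    using assms by (auto simp: ramify_def elim!: Ints_cases)
qed

lemma ramify_inj:
  assumes "N > 0" "ramify N F = ramify N G"
  shows "F = G"
  by (rule fls_eqI) (simp flip: ramify_of_int[OF assms(1)] add: assms(2))

lemma ramify_mult:
  assumes N: "N > 0"
  shows "puiseux_conv (ramify N F) (ramify N G) = ramify N (F * G)"
proof
  fix q :: rat
  let ?r = "\<lambda>k::int. of_int k / of_nat N :: rat"
  show "puiseux_conv (ramify N F) (ramify N G) q = ramify N (F * G) q"
  proof (cases "of_nat N * q \<in> \<int>")
    case False
    have "{a. ramify N F a \<noteq> 0 \<and> ramify N G (q - a) \<noteq> 0} = {}"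
    proof (rule ccontr)
      assume "\<not> ?thesis"
      then obtain a where a: "ramify N F a \<noteq> 0" "ramify N G (q - a) \<noteq> 0" by blast
      obtain k where k: "a = ?r k" using a(1) N by (metis ramify_nonzeroE)
      obtain l where l: "q - a = ?r l" using a(2) N by (metis ramify_nonzeroE)
      have "q = ?r l + ?r k" using k l by (simp add: algebra_simps)
      then have "of_nat N * q = of_int (l + k)" using N by (simp add: field_simps)
      then show False using False by (metis Ints_of_int)
    qed
    then have "puiseux_conv (ramify N F) (ramify N G) q = 0"
      unfolding puiseux_conv_def by (metis sum.empty)
    then show ?thesis using False by (simp add: ramify_def)
  next
    case True
    then obtain n where n: "of_nat N * q = of_int n" by (auto elim: Ints_cases)
    then have q: "q = ?r n" using N by (simp add: field_simps)
    define r where "r = (\<lambda>k::int. of_int k / of_nat N :: rat)"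
    have diff: "r n - r k = r (n - k)" for k by (simp add: r_def diff_divide_distrib)
    have nth: "ramify N H (r k) = fls_nth H k" for H k by (simp add: r_def ramify_of_int[OF N])
    have q': "q = r n" by (simp add: r_def q)
    have set: "{a. ramify N F a \<noteq> 0 \<and> ramify N G (r n - a) \<noteq> 0}
        = r ` {k. fls_nth F k \<noteq> 0 \<and> fls_nth G (n - k) \<noteq> 0}" (is "?A = ?B")
    proof
      show "?A \<subseteq> ?B"
      proof
        fix a assume a: "a \<in> ?A"
        then have "ramify N F a \<noteq> 0" by blast
        then obtain k where k: "a = r k" unfolding r_def by (rule ramify_nonzeroE[OF N])
        with a have "fls_nth F k \<noteq> 0 \<and> fls_nth G (n - k) \<noteq> 0"
          by (simp only: k diff nth mem_Collect_eq) blast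
        then show "a \<in> ?B" using k by blast
      qed
    next
      show "?B \<subseteq> ?A" by (rule image_subsetI) (simp only: diff nth mem_Collect_eq, simp)
    qed
    have inj: "inj_on r A" for A using N by (auto simp: r_def inj_on_def field_simps)
    have "puiseux_conv (ramify N F) (ramify N G) q
        = (\<Sum>k\<in>{k. fls_nth F k \<noteq> 0 \<and> fls_nth G (n - k) \<noteq> 0}. fls_nth F k * fls_nth G (n - k))"
      unfolding q' puiseux_conv_def set sum.reindex[OF inj]
      by (simp only: o_def diff nth)
    also have "\<dots> = (\<Sum>k=fls_subdegree F..n - fls_subdegree G. fls_nth F k * fls_nth G (n - k))"
    proof (rule sum.mono_neutral_left)
      show "{k. fls_nth F k \<noteq> 0 \<and> fls_nth G (n - k) \<noteq> 0} \<subseteq> {fls_subdegree F..n - fls_subdegree G}"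
      proof
        fix k assume "k \<in> {k. fls_nth F k \<noteq> 0 \<and> fls_nth G (n - k) \<noteq> 0}"
        then show "k \<in> {fls_subdegree F..n - fls_subdegree G}"
          using fls_subdegree_leI[of F k] fls_subdegree_leI[of G "n - k"] by auto
      qed
    qed auto
    also have "\<dots> = fls_nth (F * G) n" by (simp only: fls_times_nth(2))
    also have "\<dots> = ramify N (F * G) q" by (simp only: q' nth)
    finally show ?thesis .
  qed
qed

instantiation puiseux :: comm_ring_1
begin

lift_definition zero_puiseux :: puiseux is "\<lambda>_. 0"
  using ramify_in_puiseux_coeffs[of 1 0] by (simp add: ramify_0)

lift_definition one_puiseux :: puiseux is "\<lambda>q. if q = 0 then 1 else 0"
  using ramify_in_puiseux_coeffs[of 1 1] by (simp add: ramify_1)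

lift_definition plus_puiseux :: "puiseux \<Rightarrow> puiseux \<Rightarrow> puiseux" is "\<lambda>f g q. f q + g q"
  by (erule (1) puiseux_coeffs_common2) (simp add: ramify_add ramify_in_puiseux_coeffs)

lift_definition minus_puiseux :: "puiseux \<Rightarrow> puiseux \<Rightarrow> puiseux" is "\<lambda>f g q. f q - g q"
  by (erule (1) puiseux_coeffs_common2) (simp add: ramify_diff ramify_in_puiseux_coeffs)

lift_definition uminus_puiseux :: "puiseux \<Rightarrow> puiseux" is "\<lambda>f q. - f q"
proof -
  fix f assume f: "f \<in> puiseux_coeffs"
  obtain N F where "N > 0" "f = ramify N F" using puiseux_coeffs_common2[OF f f] .
  then show "(\<lambda>q. - f q) \<in> puiseux_coeffs"
    by (simp add: ramify_uminus ramify_in_puiseux_coeffs)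
qed

lift_definition times_puiseux :: "puiseux \<Rightarrow> puiseux \<Rightarrow> puiseux" is puiseux_conv
  by (erule (1) puiseux_coeffs_common2) (simp add: ramify_mult ramify_in_puiseux_coeffs)

instance
proof
  fix a b c :: puiseux
  show "a * b * c = a * (b * c)"
  proof (transfer)
    fix f g h assume "f \<in> puiseux_coeffs" "g \<in> puiseux_coeffs" "h \<in> puiseux_coeffs"
    then obtain N F G H where *: "N > 0" "f = ramify N F" "g = ramify N G" "h = ramify N H"
      by (rule puiseux_coeffs_common3)
    show "puiseux_conv (puiseux_conv f g) h = puiseux_conv f (puiseux_conv g h)"
      using *(1) unfolding *(2-4) by (simp add: ramify_mult mult.assoc)
  qed
  show "a * b = b * a"
  proof (transfer)
    fix f g assume "f \<in> puiseux_coeffs" "g \<in> puiseux_coeffs"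
    then obtain N F G where *: "N > 0" "f = ramify N F" "g = ramify N G"
      by (rule puiseux_coeffs_common2)
    show "puiseux_conv f g = puiseux_conv g f"
      using *(1) unfolding *(2-3) by (simp add: ramify_mult mult.commute)
  qed
  show "1 * a = a"
  proof (transfer)
    fix f assume f: "f \<in> puiseux_coeffs"
    obtain N F where *: "N > 0" "f = ramify N F"
      using puiseux_coeffs_common2[OF f f] .
    show "puiseux_conv (\<lambda>q. if q = 0 then 1 else 0) f = f"
      using *(1) unfolding *(2) by (simp add: ramify_mult flip: ramify_1[OF *(1)])
  qed
  show "(a + b) * c = a * c + b * c"
  proof (transfer)
    fix f g h assume "f \<in> puiseux_coeffs" "g \<in> puiseux_coeffs" "h \<in> puiseux_coeffs"
    then obtain N F G H where *: "N > 0" "f = ramify N F" "g = ramify N G" "h = ramify N H"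
      by (rule puiseux_coeffs_common3)
    show "puiseux_conv (\<lambda>q. f q + g q) h = (\<lambda>q. puiseux_conv f h q + puiseux_conv g h q)"
      using *(1) unfolding *(2-4) by (simp add: ramify_add ramify_mult distrib_right)
  qed
  show "(0::puiseux) \<noteq> 1" by transfer (auto simp: fun_eq_iff)
qed (transfer; simp add: fun_eq_iff algebra_simps)+

end

instantiation puiseux :: field
begin

definition inverse_puiseux :: "puiseux \<Rightarrow> puiseux" where
  "inverse_puiseux f = (if f = 0 then 0 else (THE g. g * f = 1))"

definition divide_puiseux :: "puiseux \<Rightarrow> puiseux \<Rightarrow> puiseux" where
  "divide_puiseux f g = f * inverse g"

instance
proof
  fix a :: puiseux assume a: "a \<noteq> 0"
  have "\<exists>b. b * a = 1"
  proof -
    obtain N F where *: "N > 0" "puiseux_nth a = ramify N F"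
      using puiseux_coeffs_common2[OF puiseux_nth puiseux_nth] by blast
    have "F \<noteq> 0"
      using a * by (auto simp: ramify_0 puiseux_nth_inject simp flip: zero_puiseux.rep_eq)
    then have "puiseux_nth (Abs_puiseux (ramify N (inverse F)) * a) = puiseux_nth 1"
      by (simp add: times_puiseux.rep_eq one_puiseux.rep_eq *(2) ramify_mult[OF *(1)]
          ramify_1[OF *(1)] Abs_puiseux_inverse ramify_in_puiseux_coeffs[OF *(1)])
    then show ?thesis by (metis puiseux_nth_inject)
  qed
  then obtain b where b: "b * a = 1" by blast
  have "(THE g. g * a = 1) = b"
  proof (rule the_equality)
    show "b * a = 1" by (rule b)
    fix g assume g: "g * a = 1"
    have "g = g * (a * b)" using b by (simp add: mult.commute)
    also have "\<dots> = b" using g by (simp flip: mult.assoc)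
    finally show "g = b" .
  qed
  then show "inverse a * a = 1" using a b by (simp add: inverse_puiseux_def)
qed (simp_all add: divide_puiseux_def inverse_puiseux_def)

end

lift_definition puiseux_const :: "complex \<Rightarrow> puiseux" is "\<lambda>c q. if q = 0 then c else 0"
proof -
  fix c :: complex
  have "(1::nat) > 0 \<and> (\<forall>q::rat. (if q = 0 then c else 0) \<noteq> 0 \<longrightarrow>
      (\<exists>k\<ge>(0::int). q = of_int k / of_nat 1))" by auto
  then show "(\<lambda>q. if q = 0 then c else 0) \<in> puiseux_coeffs"
    unfolding puiseux_coeffs_def by blast
qed

lift_definition t_power :: "rat \<Rightarrow> puiseux" is "\<lambda>r q. if q = r then 1 else 0"
proof -
  fix r :: rat
  obtain a b where ab: "quotient_of r = (a, b)" by fastforce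
  then have "b > 0" "r = of_int a / of_nat (nat b)"
    using quotient_of_denom_pos quotient_of_div by (force, fastforce)
  then have "nat b > 0 \<and> (\<forall>q. (if q = r then 1 else 0) \<noteq> (0::complex) \<longrightarrow>
      (\<exists>k\<ge>a. q = of_int k / of_nat (nat b)))" by auto
  then show "(\<lambda>q. if q = r then 1 else 0) \<in> puiseux_coeffs"
    unfolding puiseux_coeffs_def by blast
qed

text \<open>The valuation; the value at \<open>0\<close> (mathematically infinity) is junk and never used.\<close>

definition puiseux_val :: "puiseux \<Rightarrow> rat" where
  "puiseux_val f = (LEAST q. puiseux_nth f q \<noteq> 0)"

definition puiseux_lc :: "puiseux \<Rightarrow> complex" where
  "puiseux_lc f = puiseux_nth f (puiseux_val f)"

lemma puiseux_val_least:
  assumes "f \<noteq> 0"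
  shows "puiseux_lc f \<noteq> 0" and "\<And>q. puiseux_nth f q \<noteq> 0 \<Longrightarrow> puiseux_val f \<le> q"
proof -
  obtain N F where *: "N > 0" "puiseux_nth f = ramify N F"
    using puiseux_coeffs_common2[OF puiseux_nth puiseux_nth] by blast
  have F: "F \<noteq> 0"
    using assms * by (auto simp: ramify_0 puiseux_nth_inject simp flip: zero_puiseux.rep_eq)
  define r :: rat where "r = of_int (fls_subdegree F) / of_nat N"
  have r: "puiseux_nth f r \<noteq> 0"
    unfolding r_def *(2) ramify_of_int[OF *(1)] using F by simp
  have le: "r \<le> q" if "puiseux_nth f q \<noteq> 0" for q
  proof -
    from that have "ramify N F q \<noteq> 0" by (simp add: *(2))
    then obtain k where k: "q = of_int k / of_nat N" "fls_nth F k \<noteq> 0"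
      by (rule ramify_nonzeroE[OF *(1)])
    then have "fls_subdegree F \<le> k" by (intro fls_subdegree_leI)
    then show ?thesis by (simp add: r_def k(1) divide_right_mono)
  qed
  have "puiseux_val f = r" unfolding puiseux_val_def by (rule Least_equality) (use r le in auto)
  then show "puiseux_lc f \<noteq> 0" "\<And>q. puiseux_nth f q \<noteq> 0 \<Longrightarrow> puiseux_val f \<le> q"
    using r le by (auto simp: puiseux_lc_def simp del: not_less)
qed

text \<open>
  The residue class of an element of nonnegative valuation, under the identification of the residue
  field with the complex numbers.
\<close>

definition puiseux_residue :: "puiseux \<Rightarrow> complex" where
  "puiseux_residue f = puiseux_nth f 0"

lemma puiseux_residue_normalized: "puiseux_residue (t_power (- puiseux_val f) * f) = puiseux_lc f"
proof -
  have set: "{a. (if a = - r then 1 else (0::complex)) \<noteq> 0 \<and> g (0 - a) \<noteq> 0}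
      = (if g r \<noteq> 0 then {- r} else {})" for g :: "rat \<Rightarrow> complex" and r
    by auto
  show ?thesis
    by (simp add: puiseux_residue_def puiseux_lc_def times_puiseux.rep_eq t_power.rep_eq
        puiseux_conv_def set del: diff_0)
qed

definition R_pos :: "puiseux set" where
  "R_pos = {z. z \<noteq> 0 \<and> puiseux_lc z \<in> \<real> \<and> Re (puiseux_lc z) > 0}"


section \<open>Polynomials and ideals\<close>

text \<open>Polynomials in the variables \<open>x\<^sub>i\<close>, \<open>i :: 'n\<close>, with coefficients in \<open>'c\<close>.\<close>

type_synonym ('n, 'c) mpoly = "('n \<Rightarrow>\<^sub>0 nat) \<Rightarrow>\<^sub>0 'c"

abbreviation coeff :: "('n, 'c::zero) mpoly \<Rightarrow> ('n \<Rightarrow>\<^sub>0 nat) \<Rightarrow> 'c" where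
  "coeff \<equiv> Poly_Mapping.lookup"

abbreviation mon :: "('n \<Rightarrow>\<^sub>0 nat) \<Rightarrow> 'c \<Rightarrow> ('n, 'c::zero) mpoly" where
  "mon \<equiv> Poly_Mapping.single"

definition Var :: "'n \<Rightarrow> ('n, 'c::zero_neq_one) mpoly" where
  "Var i = mon (Poly_Mapping.single i 1) 1"

text \<open>
  Apply \<open>h\<close> to the coefficients of \<open>f\<close> and substitute \<open>x i\<close> for the variable \<open>i\<close>.
\<close>

definition subst ::
    "('c::zero \<Rightarrow> 'a::comm_semiring_1) \<Rightarrow> ('n::finite \<Rightarrow> 'a) \<Rightarrow> ('n, 'c) mpoly \<Rightarrow> 'a" where
  "subst h x f =
     (\<Sum>\<alpha>\<in>Poly_Mapping.keys f. h (coeff f \<alpha>) * (\<Prod>i\<in>UNIV. x i ^ Poly_Mapping.lookup \<alpha> i))"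

text \<open>
  With multiplication as scalar multiplication, \<open>ideal.span B\<close> is the ideal generated by \<open>B\<close>
  and \<open>ideal.subspace I\<close> says that \<open>I\<close> is an ideal.
\<close>

interpretation ideal: module "times :: 'a::comm_ring_1 \<Rightarrow> 'a \<Rightarrow> 'a"
  by unfold_locales (simp_all add: algebra_simps)

definition homogeneous :: "('n::finite, 'c::zero) mpoly \<Rightarrow> bool" where
  "homogeneous f \<longleftrightarrow>
     (\<exists>d. \<forall>\<alpha>\<in>Poly_Mapping.keys f. (\<Sum>i\<in>UNIV. Poly_Mapping.lookup \<alpha> i) = d)"

definition homogeneous_ideal :: "('n::finite, 'c::comm_ring_1) mpoly set \<Rightarrow> bool" where
  "homogeneous_ideal I \<longleftrightarrow> (\<exists>B. (\<forall>f\<in>B. homogeneous f) \<and> I = ideal.span B)"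

definition generated_by_real_polys :: "('n, puiseux) mpoly set \<Rightarrow> bool" where
  "generated_by_real_polys I \<longleftrightarrow>
     (\<exists>B. (\<forall>f\<in>B. \<forall>\<alpha>. \<exists>r::real. coeff f \<alpha> = puiseux_const (complex_of_real r)) \<and> I = ideal.span B)"

definition binomial_ideal :: "('n, 'c::comm_ring_1) mpoly set \<Rightarrow> bool" where
  "binomial_ideal J \<longleftrightarrow> (\<exists>B. (\<forall>f\<in>B. card (Poly_Mapping.keys f) \<le> 2) \<and> J = ideal.span B)"

definition variety :: "('n::finite, 'c::comm_semiring_1) mpoly set \<Rightarrow> ('c ^ 'n) set" where
  "variety I = {z. \<forall>f\<in>I. subst (\<lambda>c. c) (($) z) f = 0}"

definition nonneg_polys :: "('n, complex) mpoly set" where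
  "nonneg_polys = {f. \<forall>\<alpha>. coeff f \<alpha> \<in> \<real>\<^sub>\<ge>\<^sub>0}"

definition nonpos_polys :: "('n, complex) mpoly set" where
  "nonpos_polys = {f. \<forall>\<alpha>. coeff f \<alpha> \<in> \<real>\<^sub>\<le>\<^sub>0}"


section \<open>Reduced Groebner bases\<close>

definition monomial_order :: "(('n \<Rightarrow>\<^sub>0 nat) \<Rightarrow> ('n \<Rightarrow>\<^sub>0 nat) \<Rightarrow> bool) \<Rightarrow> bool" where
  "monomial_order leq \<longleftrightarrow>
     class.wellorder leq (\<lambda>\<alpha> \<beta>. leq \<alpha> \<beta> \<and> \<alpha> \<noteq> \<beta>) \<and>
     (\<forall>\<alpha> \<beta> \<gamma>. leq \<alpha> \<beta> \<longrightarrow> leq (\<alpha> + \<gamma>) (\<beta> + \<gamma>))"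

definition lead_mon :: "(('n \<Rightarrow>\<^sub>0 nat) \<Rightarrow> ('n \<Rightarrow>\<^sub>0 nat) \<Rightarrow> bool) \<Rightarrow> ('n, 'c::zero) mpoly \<Rightarrow> 'n \<Rightarrow>\<^sub>0 nat"
  where
  "lead_mon leq f =
     (THE \<alpha>. \<alpha> \<in> Poly_Mapping.keys f \<and> (\<forall>\<beta>\<in>Poly_Mapping.keys f. leq \<beta> \<alpha>))"

definition lead_ideal ::
    "(('n \<Rightarrow>\<^sub>0 nat) \<Rightarrow> ('n \<Rightarrow>\<^sub>0 nat) \<Rightarrow> bool) \<Rightarrow> ('n, 'c::comm_ring_1) mpoly set \<Rightarrow> ('n, 'c) mpoly set"
  where
  "lead_ideal leq F = ideal.span ((\<lambda>f. mon (lead_mon leq f) 1) ` (F - {0}))"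

definition groebner_basis ::
    "(('n \<Rightarrow>\<^sub>0 nat) \<Rightarrow> ('n \<Rightarrow>\<^sub>0 nat) \<Rightarrow> bool) \<Rightarrow> ('n, 'c::field) mpoly set \<Rightarrow> ('n, 'c) mpoly set \<Rightarrow> bool"
  where
  "groebner_basis leq G J \<longleftrightarrow> finite G \<and> G \<subseteq> J \<and> lead_ideal leq G = lead_ideal leq J"

definition reduced_groebner_basis ::
    "(('n \<Rightarrow>\<^sub>0 nat) \<Rightarrow> ('n \<Rightarrow>\<^sub>0 nat) \<Rightarrow> bool) \<Rightarrow> ('n, 'c::field) mpoly set \<Rightarrow> ('n, 'c) mpoly set \<Rightarrow> bool"
  where
  "reduced_groebner_basis leq G J \<longleftrightarrow>
     groebner_basis leq G J \<and>
     (\<forall>g\<in>G. g \<noteq> 0 \<and> coeff g (lead_mon leq g) = 1 \<and>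
        (\<forall>\<alpha>\<in>Poly_Mapping.keys g. mon \<alpha> 1 \<notin> lead_ideal leq (G - {g})))"


section \<open>Initial ideals and tropicalization\<close>

definition weight :: "real ^ 'n \<Rightarrow> ('n::finite \<Rightarrow>\<^sub>0 nat) \<Rightarrow> real" where
  "weight w \<alpha> = (\<Sum>i\<in>UNIV. w $ i * real (Poly_Mapping.lookup \<alpha> i))"

definition trop_weight :: "real ^ 'n \<Rightarrow> ('n::finite, puiseux) mpoly \<Rightarrow> ('n \<Rightarrow>\<^sub>0 nat) \<Rightarrow> real" where
  "trop_weight w f \<alpha> = weight w \<alpha> - real_of_rat (puiseux_val (coeff f \<alpha>))"

definition initial_form :: "real ^ 'n \<Rightarrow> ('n::finite, puiseux) mpoly \<Rightarrow> ('n, complex) mpoly" where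
  "initial_form w f =
     (\<Sum>\<alpha>\<in>{\<alpha>\<in>Poly_Mapping.keys f. \<forall>\<beta>\<in>Poly_Mapping.keys f. trop_weight w f \<beta> \<le> trop_weight w f \<alpha>}.
        mon \<alpha> (puiseux_residue (t_power (- puiseux_val (coeff f \<alpha>)) * coeff f \<alpha>)))"

definition initial_ideal ::
    "real ^ 'n \<Rightarrow> ('n::finite, puiseux) mpoly set \<Rightarrow> ('n, complex) mpoly set" where
  "initial_ideal w I = ideal.span (initial_form w ` I)"

definition Trop :: "('n::finite, puiseux) mpoly set \<Rightarrow> (real ^ 'n) set" where
  "Trop I = {w. \<forall>\<alpha>. mon \<alpha> 1 \<notin> initial_ideal w I}"

definition groebner_cone :: "real ^ 'n \<Rightarrow> ('n::finite, puiseux) mpoly set \<Rightarrow> (real ^ 'n) set" where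
  "groebner_cone w I = closure {v. initial_ideal v I = initial_ideal w I}"

definition maximal_groebner_cone :: "real ^ 'n \<Rightarrow> ('n::finite, puiseux) mpoly set \<Rightarrow> bool" where
  "maximal_groebner_cone w I \<longleftrightarrow>
     groebner_cone w I \<subseteq> Trop I \<and>
     (\<forall>v. groebner_cone v I \<subseteq> Trop I \<longrightarrow> groebner_cone w I \<subseteq> groebner_cone v I \<longrightarrow>
        groebner_cone v I = groebner_cone w I)"

definition Trop_pos :: "('n::finite, puiseux) mpoly set \<Rightarrow> (real ^ 'n) set" where
  "Trop_pos I = closure
     ((\<lambda>z. \<chi> i. - real_of_rat (puiseux_val (z $ i))) ` (variety I \<inter> {z. \<forall>i. z $ i \<in> R_pos}))"


section \<open>Signed permutations\<close>

text \<open>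
  The algebra endomorphism \<open>x\<^sub>i \<mapsto> u\<^sub>i x\<^bsub>p(i)\<^esub>\<close>; it is used both over the Puiseux
  series and over the complex numbers.
\<close>

definition signed_perm :: "('n \<Rightarrow> 'n) \<Rightarrow> ('n \<Rightarrow> int) \<Rightarrow>
    ('n::finite, 'c::comm_ring_1) mpoly \<Rightarrow> ('n, 'c) mpoly" where
  "signed_perm p u = subst (mon 0) (\<lambda>i. of_int (u i) * Var (p i))"

lemma signed_perm_Var:
  fixes p :: "'n::finite \<Rightarrow> 'n"
  shows "signed_perm p u (Var i) = (of_int (u i) * Var (p i) :: ('n, 'c::comm_ring_1) mpoly)"
proof -
  have "(\<Prod>j\<in>UNIV. x j ^ Poly_Mapping.lookup (Poly_Mapping.single i 1) j) = x i"
    for x :: "'n \<Rightarrow> ('n, 'c) mpoly" and i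
    by (subst prod.remove[of _ i]) (auto simp: lookup_single when_def intro!: prod.neutral)
  then show ?thesis by (simp add: signed_perm_def subst_def Var_def[of i])
qed

text \<open>The action on weight vectors, characterised by \<open>perm_vec_nth\<close> below.\<close>

definition perm_vec :: "('n \<Rightarrow> 'n) \<Rightarrow> real ^ 'n \<Rightarrow> real ^ 'n" where
  "perm_vec p w = (\<chi> j. w $ inv_into UNIV p j)"

lemma perm_vec_nth: "bij p \<Longrightarrow> perm_vec p w $ p i = w $ i"
  by (simp add: perm_vec_def bij_is_inj)

text \<open>
  \<open>p \<sigma>\<close> and \<open>u \<sigma>\<close> are the permutation and the signs by which \<open>\<sigma>\<close> acts on the variables.
\<close>

definition acts_by_signed_perms ::
    "('s, 'm) monoid_scheme \<Rightarrow> ('s \<Rightarrow> 'n::finite \<Rightarrow> 'n) \<Rightarrow> ('s \<Rightarrow> 'n \<Rightarrow> int) \<Rightarrow> bool" where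
  "acts_by_signed_perms S p u \<longleftrightarrow>
     (\<forall>\<sigma>\<in>carrier S. bij (p \<sigma>) \<and> (\<forall>i. u \<sigma> i \<in> {1, -1})) \<and>
     group_action S UNIV (\<lambda>\<sigma>. signed_perm (p \<sigma>) (u \<sigma>) :: ('n, puiseux) mpoly \<Rightarrow> _)"

end

theory Submission
  imports Defs
begin

text \<open>
  Since \<open>I\<close> is \<open>\<sigma>\<close>-invariant, a positive point of \<open>V(I)\<close> whose tropicalization is near
  \<open>\<sigma> \<cdot> w\<close> is the same as a point of \<open>V(I)\<close> with sign pattern \<open>u\<close> whose tropicalization is
  near \<open>w\<close>, and \<open>\<sigma> \<cdot> g\<close> has coefficients of one sign iff the terms of \<open>g\<close> have
  one sign at points with sign pattern \<open>u\<close>. As \<open>I\<close> has constant generators, every component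
  of an element of \<open>in\<^sub>w(I)\<close> in the grading by weight and degree is the leading part of a constant
  polynomial in \<open>I\<close>.

  If \<open>\<sigma> \<cdot> g\<close> has coefficients of one sign, then so does the leading part of some \<open>f \<in> I\<close>, and
  the lowest order terms of \<open>f\<close> cannot cancel at a point with sign pattern \<open>u\<close> and tropicalization
  close to \<open>w\<close>.

  Conversely, \<open>in\<^sub>w(I)\<close> contains no monomial, so every element of \<open>G\<close> is a binomial
  \<open>x\<^sup>\<alpha> - c x\<^sup>\<beta>\<close> with \<open>c\<close> real, and the sign condition gives a common zero \<open>y\<close> of \<open>G\<close>
  with sign pattern \<open>u\<close>. Dirichlet approximation moves \<open>w\<close> to a nearby rational point without
  changing the leading parts of finitely many given polynomials. Choose a maximal subset \<open>R\<close> of \<open>G\<close>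
  with linearly independent exponent differences, and lifts \<open>F\<^sub>g \<in> I\<close> of \<open>g \<in> G\<close>. The
  Jacobian of \<open>R\<close> at \<open>y\<close> has full rank, so by Hensel's lemma \<open>y\<close> lifts to a zero \<open>z\<close> of
  \<open>F\<^sub>g\<close> for \<open>g \<in> R\<close>. For the other \<open>g\<close> some multiple \<open>q g\<close> with \<open>q(y) \<noteq> 0\<close> lies in
  the ideal of \<open>R\<close>, because \<open>X\<^sup>k - 1\<close> is \<open>X - 1\<close> times a unit at \<open>X = 1\<close>. Hence
  \<open>q F\<^sub>g\<close> is, modulo \<open>F\<^sub>h\<close> for \<open>h \<in> R\<close>, a combination of the \<open>F\<^sub>h\<close> with
  strictly smaller weights. Comparing valuations at \<open>z\<close>, all \<open>F\<^sub>g\<close> vanish there, and so does \<open>I\<close>.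
\<close>

section \<open>Polynomials\<close>

text \<open>
  As an instance of \<open>scale_scale\<close>, the module of a ring over itself has the simp rule
  \<open>a * (b * x) = (a * b) * x\<close>, which loops together with \<open>mult.assoc\<close>.
\<close>

declare ideal.scale_scale [simp del]

lemma mpoly_expand:
  fixes p :: "('n, 'c::comm_monoid_add) mpoly"
  shows "p = (\<Sum>\<alpha>\<in>Poly_Mapping.keys p. mon \<alpha> (coeff p \<alpha>))"
  by (rule poly_mapping_eqI)
    (simp add: lookup_sum lookup_single when_def in_keys_iff if_distrib cong: if_cong)

lemma mpoly_induct [case_names zero add mon]:
  fixes p :: "('n, 'c::comm_monoid_add) mpoly"
  assumes "P 0" "\<And>p q. P p \<Longrightarrow> P q \<Longrightarrow> P (p + q)" "\<And>\<alpha> c. P (mon \<alpha> c)"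
  shows "P p"
proof -
  have "P (\<Sum>\<alpha>\<in>A. mon \<alpha> (coeff p \<alpha>))" if "finite A" for A
    using that by (induction A rule: finite_induct) (auto intro: assms)
  then show ?thesis by (subst mpoly_expand) simp
qed

lemma coeff_mon_times:
  fixes p :: "('n, 'c::comm_ring_1) mpoly"
  shows "coeff (mon \<gamma> d * p) (\<gamma> + \<beta>) = d * coeff p \<beta>"
  by (induction p rule: mpoly_induct)
    (simp_all add: lookup_add algebra_simps mult_single lookup_single when_def)

lemma keys_mon_times: "Poly_Mapping.keys (mon \<gamma> d * p) \<subseteq> (+) \<gamma> ` Poly_Mapping.keys p"
  using keys_mult[of "mon \<gamma> d" p] by (auto split: if_splits)

section \<open>Parts of polynomials supported on a set of exponents\<close>

definition restrict_mpoly :: "('n \<Rightarrow>\<^sub>0 nat) set \<Rightarrow> ('n, 'c::comm_monoid_add) mpoly \<Rightarrow> ('n, 'c) mpoly" where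
  "restrict_mpoly X p = (\<Sum>\<alpha>\<in>Poly_Mapping.keys p \<inter> X. mon \<alpha> (coeff p \<alpha>))"

lemma coeff_restrict_mpoly: "coeff (restrict_mpoly X p) \<alpha> = (if \<alpha> \<in> X then coeff p \<alpha> else 0)"
  by (auto simp: restrict_mpoly_def lookup_sum lookup_single when_def in_keys_iff if_distrib
      cong: if_cong)

lemma keys_restrict_mpoly: "Poly_Mapping.keys (restrict_mpoly X p) = Poly_Mapping.keys p \<inter> X"
  by (auto simp: in_keys_iff coeff_restrict_mpoly split: if_splits)

lemma restrict_mpoly_add: "restrict_mpoly X (p + q) = restrict_mpoly X p + restrict_mpoly X q"
  by (rule poly_mapping_eqI) (simp add: coeff_restrict_mpoly lookup_add)

lemma restrict_mpoly_0 [simp]: "restrict_mpoly X 0 = 0"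
  by (simp add: restrict_mpoly_def)

lemma restrict_mpoly_sum: "restrict_mpoly X (\<Sum>i\<in>A. f i) = (\<Sum>i\<in>A. restrict_mpoly X (f i))"
  by (induction A rule: infinite_finite_induct) (simp_all add: restrict_mpoly_add)

lemma restrict_mpoly_ident: "Poly_Mapping.keys p \<subseteq> X \<Longrightarrow> restrict_mpoly X p = p"
  by (rule poly_mapping_eqI) (auto simp: coeff_restrict_mpoly in_keys_iff subset_iff)

lemma restrict_mpoly_disjoint: "Poly_Mapping.keys p \<inter> X = {} \<Longrightarrow> restrict_mpoly X p = 0"
  by (simp add: restrict_mpoly_def)

text \<open>The exponents of a monomial multiple of a generator are \<open>E\<close>-related to each
  other, so such a multiple lies wholly inside or wholly outside \<open>X\<close>. With equality of
  degrees as \<open>E\<close> this yields homogeneous components; \<open>gb_binomial\<close> uses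
  proportionality of monomials modulo an ideal.\<close>

lemma restrict_mpoly_in_span:
  fixes B :: "('n, 'c::comm_ring_1) mpoly set"
  assumes cong: "\<And>\<alpha> \<beta> \<gamma>. E \<alpha> \<beta> \<Longrightarrow> E (\<gamma> + \<alpha>) (\<gamma> + \<beta>)"
    and sat: "\<And>\<alpha> \<beta>. E \<alpha> \<beta> \<Longrightarrow> \<alpha> \<in> X \<longleftrightarrow> \<beta> \<in> X"
    and B: "\<And>b \<alpha> \<beta>. b \<in> B \<Longrightarrow> \<alpha> \<in> Poly_Mapping.keys b \<Longrightarrow> \<beta> \<in> Poly_Mapping.keys b \<Longrightarrow> E \<alpha> \<beta>"
    and p: "p \<in> ideal.span B"
  shows "restrict_mpoly X p \<in> ideal.span B"
  using p
proof (induction rule: ideal.span_induct_alt)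
  case base
  then show ?case by (simp add: ideal.span_zero)
next
  case (step h b p)
  have "restrict_mpoly X (h * b) \<in> ideal.span B"
  proof (induction h rule: mpoly_induct)
    case (mon \<gamma> d)
    have k: "Poly_Mapping.keys (mon \<gamma> d * b) \<subseteq> (+) \<gamma> ` Poly_Mapping.keys b"
      by (rule keys_mon_times)
    have "Poly_Mapping.keys (mon \<gamma> d * b) \<subseteq> X \<or> Poly_Mapping.keys (mon \<gamma> d * b) \<inter> X = {}"
    proof (rule ccontr)
      assume "\<not> ?thesis"
      then obtain \<alpha> \<beta> where "\<alpha> \<in> Poly_Mapping.keys b" "\<beta> \<in> Poly_Mapping.keys b"
        "\<gamma> + \<alpha> \<notin> X" "\<gamma> + \<beta> \<in> X" using k by blast
      then show False using sat[OF cong[OF B[OF step(1)]]] by blast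
    qed
    then show ?case
      using ideal.span_base[OF step(1)]
      by (auto simp: restrict_mpoly_ident restrict_mpoly_disjoint ideal.span_zero
          intro: ideal.span_scale)
  qed (simp_all add: restrict_mpoly_add distrib_right ideal.span_zero ideal.span_add)
  then show ?case by (simp add: restrict_mpoly_add ideal.span_add step(2))
qed

section \<open>Evaluation of monomials and polynomials\<close>

definition mon_value :: "('n::finite \<Rightarrow> 'a::comm_semiring_1) \<Rightarrow> ('n \<Rightarrow>\<^sub>0 nat) \<Rightarrow> 'a" where
  "mon_value x \<alpha> = (\<Prod>i\<in>UNIV. x i ^ Poly_Mapping.lookup \<alpha> i)"

lemma mon_value_0 [simp]: "mon_value x 0 = 1"
  by (simp add: mon_value_def)

lemma mon_value_add: "mon_value x (\<alpha> + \<beta>) = mon_value x \<alpha> * mon_value x \<beta>"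
  by (simp add: mon_value_def lookup_add power_add prod.distrib)

lemma mon_value_nonzero:
  fixes x :: "'n::finite \<Rightarrow> 'a::idom"
  assumes "\<And>i. x i \<noteq> 0"
  shows "mon_value x \<alpha> \<noteq> 0"
  using assms by (simp add: mon_value_def)

lemma mon_value_mult: "mon_value (\<lambda>i. x i * y i) \<alpha> = mon_value x \<alpha> * mon_value y \<alpha>"
  by (simp add: mon_value_def power_mult_distrib prod.distrib)

lemma subst_eq_sum: "subst h x f = (\<Sum>\<alpha>\<in>Poly_Mapping.keys f. h (coeff f \<alpha>) * mon_value x \<alpha>)"
  by (simp add: subst_def mon_value_def)

lemma subst_eq_sum_superset:
  assumes "finite A" "Poly_Mapping.keys f \<subseteq> A" "h 0 = 0"
  shows "subst h x f = (\<Sum>\<alpha>\<in>A. h (coeff f \<alpha>) * mon_value x \<alpha>)"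
  unfolding subst_eq_sum using assms
  by (intro sum.mono_neutral_left) (auto simp: in_keys_iff)

text \<open>Shared by all ring homomorphisms that occur: the identity, constants in the Puiseux
  series, constant terms of power series, power series in a root of \<open>t\<close>, complex
  conjugation, and evaluations of polynomials.\<close>

locale coeff_hom =
  fixes h :: "'c::comm_ring_1 \<Rightarrow> 'a::comm_ring_1"
  assumes hom_add: "h (a + b) = h a + h b"
    and hom_mult: "h (a * b) = h a * h b"
    and hom_one: "h 1 = 1"
begin

lemma hom_zero: "h 0 = 0"
  using hom_add[of 0 0] by simp

lemma hom_uminus: "h (- a) = - h a"
  by (rule minus_unique[symmetric]) (simp add: hom_zero flip: hom_add)

lemma hom_power: "h (a ^ n) = h a ^ n"
  by (induction n) (simp_all add: hom_one hom_mult)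

lemma hom_prod: "h (\<Prod>i\<in>A. f i) = (\<Prod>i\<in>A. h (f i))"
  by (induction A rule: infinite_finite_induct) (simp_all add: hom_one hom_mult)

lemma hom_sum: "h (\<Sum>i\<in>A. f i) = (\<Sum>i\<in>A. h (f i))"
  by (induction A rule: infinite_finite_induct) (simp_all add: hom_zero hom_add)

lemma hom_mon_value: "h (mon_value x \<alpha>) = mon_value (\<lambda>i. h (x i)) \<alpha>"
  by (simp add: mon_value_def hom_prod hom_power)

lemma subst_zero: "subst h x 0 = 0"
  by (simp add: subst_def)

lemma subst_mon: "subst h x (mon \<alpha> c) = h c * mon_value x \<alpha>"
  by (simp add: subst_eq_sum hom_zero)

lemma subst_add: "subst h x (f + g) = subst h x f + subst h x g"
proof -
  let ?A = "Poly_Mapping.keys f \<union> Poly_Mapping.keys g"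
  have "Poly_Mapping.keys (f + g) \<subseteq> ?A" by (rule keys_add)
  then show ?thesis
    by (simp add: subst_eq_sum_superset[of ?A] hom_zero lookup_add hom_add distrib_right
        sum.distrib)
qed

lemma subst_mult: "subst h x (f * g) = subst h x f * subst h x g"
proof (induction f rule: mpoly_induct)
  case (mon \<alpha> c)
  show ?case
  proof (induction g rule: mpoly_induct)
    case (add p q)
    then show ?case by (simp add: distrib_left subst_add)
  next
    case (mon \<beta> d)
    show ?case unfolding mult_single subst_mon hom_mult mon_value_add by (simp only: mult_ac)
  qed (simp add: subst_zero)
qed (simp_all add: subst_zero distrib_right subst_add)

lemma subst_sum: "subst h x (\<Sum>i\<in>A. f i) = (\<Sum>i\<in>A. subst h x (f i))"
  by (induction A rule: infinite_finite_induct) (simp_all add: subst_zero subst_add)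

lemma subst_span_eq_0:
  assumes "f \<in> ideal.span B" "\<And>b. b \<in> B \<Longrightarrow> subst h x b = 0"
  shows "subst h x f = 0"
  using assms(1)
proof (induction rule: ideal.span_induct_alt)
  case (step c b y)
  then show ?case by (simp add: subst_add subst_mult assms(2))
qed (rule subst_zero)

end

interpretation id_hom: coeff_hom "\<lambda>c::'c::comm_ring_1. c"
  by unfold_locales simp_all

section \<open>Coefficientwise maps\<close>

lemma coeff_map:
  assumes "h 0 = 0"
  shows "coeff (Poly_Mapping.map h f) \<alpha> = h (coeff f \<alpha>)"
  using assms by (simp add: Poly_Mapping.map.rep_eq when_def)

lemma map_zero_mpoly:
  assumes "h 0 = 0"
  shows "Poly_Mapping.map h (0 :: ('n, 'c::zero) mpoly) = 0"
  by (rule poly_mapping_eqI) (simp add: coeff_map assms)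

lemma map_add_mpoly:
  fixes f g :: "('n, 'c::comm_ring_1) mpoly"
  assumes "\<And>a b. h (a + b) = h a + h b" "h 0 = 0"
  shows "Poly_Mapping.map h (f + g) = Poly_Mapping.map h f + Poly_Mapping.map h g"
  by (rule poly_mapping_eqI) (simp add: coeff_map assms lookup_add)

lemma keys_map_subset:
  fixes f :: "('n, 'c::zero) mpoly"
  assumes "h 0 = 0"
  shows "Poly_Mapping.keys (Poly_Mapping.map h f) \<subseteq> Poly_Mapping.keys f"
  by (metis assms coeff_map in_keys_iff subsetI)

lemma (in coeff_hom) map_mult:
  fixes f g :: "('n, 'c) mpoly"
  shows
  "Poly_Mapping.map h (f * g) = Poly_Mapping.map h f * Poly_Mapping.map h g"
proof (induction f rule: mpoly_induct)
  case (mon \<alpha> c)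
  show ?case
    by (induction g rule: mpoly_induct)
      (simp_all add: map_zero_mpoly distrib_left map_add_mpoly hom_add hom_zero mult_single hom_mult)
qed (simp_all add: map_zero_mpoly distrib_right map_add_mpoly hom_add hom_zero)

section \<open>Degrees and weights of exponents\<close>

definition total_degree :: "('n::finite \<Rightarrow>\<^sub>0 nat) \<Rightarrow> nat" where
  "total_degree \<alpha> = (\<Sum>i\<in>UNIV. Poly_Mapping.lookup \<alpha> i)"

lemma total_degree_add: "total_degree (\<alpha> + \<beta>) = total_degree \<alpha> + total_degree \<beta>"
  by (simp add: total_degree_def lookup_add sum.distrib)

lemma weight_add: "weight w (\<alpha> + \<beta>) = weight w \<alpha> + weight w \<beta>"
  by (simp add: weight_def lookup_add sum.distrib algebra_simps)

text \<open>The degree bounds every exponent. Real weights are not well ordered, and this finiteness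
  is what lets \<open>standard_representation\<close> terminate.\<close>

lemma finite_total_degree: "finite {\<alpha>::'n::finite \<Rightarrow>\<^sub>0 nat. total_degree \<alpha> = d}"
proof (rule finite_imageD)
  have "Poly_Mapping.lookup \<alpha> i \<le> total_degree \<alpha>" for \<alpha> :: "'n \<Rightarrow>\<^sub>0 nat" and i
    unfolding total_degree_def by (rule member_le_sum) auto
  then have "Poly_Mapping.lookup ` {\<alpha>::'n \<Rightarrow>\<^sub>0 nat. total_degree \<alpha> = d}
      \<subseteq> {f. \<forall>i. (i \<in> UNIV \<longrightarrow> f i \<in> {..d}) \<and> (i \<notin> UNIV \<longrightarrow> f i = 0)}"
    by blast
  then show "finite (Poly_Mapping.lookup ` {\<alpha>::'n \<Rightarrow>\<^sub>0 nat. total_degree \<alpha> = d})"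
    by (rule finite_subset) (rule finite_set_of_finite_funs; simp)
  show "inj_on Poly_Mapping.lookup {\<alpha>::'n \<Rightarrow>\<^sub>0 nat. total_degree \<alpha> = d}"
    by (auto simp: inj_on_def)
qed

section \<open>Reduced Groebner bases of binomial ideals\<close>

text \<open>Divisibility of monomials appears as \<open>\<mu> = \<gamma> + l f\<close>. This turns
  membership in \<open>lead_ideal\<close> into divisibility by a leading monomial.\<close>

lemma keys_in_monomial_span:
  fixes p :: "('n, 'c::comm_ring_1) mpoly"
  assumes "p \<in> ideal.span ((\<lambda>f. mon (l f) 1) ` F)" "\<mu> \<in> Poly_Mapping.keys p"
  shows "\<exists>f\<in>F. \<exists>\<gamma>. \<mu> = \<gamma> + l f"
  using assms
proof (induction arbitrary: \<mu> rule: ideal.span_induct_alt)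
  case (step c x y)
  then obtain f where f: "f \<in> F" "x = mon (l f) 1" by blast
  from step.prems have "\<mu> \<in> Poly_Mapping.keys (c * x) \<or> \<mu> \<in> Poly_Mapping.keys y"
    using keys_add[of "c * x" y] by blast
  then show ?case
  proof
    assume "\<mu> \<in> Poly_Mapping.keys (c * x)"
    then obtain a b where "\<mu> = a + b" "b \<in> Poly_Mapping.keys x" using keys_mult[of c x] by blast
    then show ?thesis using f by auto
  qed (rule step.IH)
qed simp

section \<open>Monomial orderings and division\<close>

locale monomial_ordering =
  fixes leq :: "('n \<Rightarrow>\<^sub>0 nat) \<Rightarrow> ('n \<Rightarrow>\<^sub>0 nat) \<Rightarrow> bool"
  assumes monomial_order: "monomial_order leq"
begin

lemma leq_refl: "leq \<alpha> \<alpha>"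
  and leq_linear: "leq \<alpha> \<beta> \<or> leq \<beta> \<alpha>"
  and leq_antisym: "leq \<alpha> \<beta> \<Longrightarrow> leq \<beta> \<alpha> \<Longrightarrow> \<alpha> = \<beta>"
  and leq_trans: "leq \<alpha> \<beta> \<Longrightarrow> leq \<beta> \<gamma> \<Longrightarrow> leq \<alpha> \<gamma>"
  and leq_induct: "(\<And>\<alpha>. (\<And>\<beta>. leq \<beta> \<alpha> \<and> \<beta> \<noteq> \<alpha> \<Longrightarrow> P \<beta>) \<Longrightarrow> P \<alpha>) \<Longrightarrow> P \<alpha>"
proof -
  interpret wo: wellorder leq "\<lambda>\<alpha> \<beta>. leq \<alpha> \<beta> \<and> \<alpha> \<noteq> \<beta>"
    using monomial_order by (simp add: monomial_order_def)
  show "leq \<alpha> \<alpha>" by (rule wo.order_refl)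
  show "leq \<alpha> \<beta> \<or> leq \<beta> \<alpha>" by (rule wo.linear)
  show "leq \<alpha> \<beta> \<Longrightarrow> leq \<beta> \<alpha> \<Longrightarrow> \<alpha> = \<beta>" by (rule wo.order_antisym)
  show "leq \<alpha> \<beta> \<Longrightarrow> leq \<beta> \<gamma> \<Longrightarrow> leq \<alpha> \<gamma>" by (rule wo.order_trans)
  show "P \<alpha>" if "\<And>\<alpha>. (\<And>\<beta>. leq \<beta> \<alpha> \<and> \<beta> \<noteq> \<alpha> \<Longrightarrow> P \<beta>) \<Longrightarrow> P \<alpha>"
    by (induction \<alpha> rule: wo.less_induct) (rule that)
qed

lemma leq_plus: "leq \<alpha> \<beta> \<Longrightarrow> leq (\<gamma> + \<alpha>) (\<gamma> + \<beta>)"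
  using monomial_order by (simp add: monomial_order_def add.commute)

text \<open>If \<open>\<alpha>\<close> were below 0, compatibility with addition would make the
  multiples of \<open>\<alpha>\<close> an infinite descending chain.\<close>

lemma zero_leq: "leq 0 \<alpha>"
proof (rule ccontr)
  assume "\<not> leq 0 \<alpha>"
  then have lt: "leq \<alpha> 0" "\<alpha> \<noteq> 0" using leq_linear leq_refl by auto
  define P where "P = (\<lambda>\<beta>. \<exists>k. \<beta> = ((+) \<alpha> ^^ k) 0)"
  have "\<not> P \<beta>" for \<beta>
  proof (induction \<beta> rule: leq_induct)
    case (1 m)
    show ?case
    proof
      assume "P m"
      then have "P (\<alpha> + m)" unfolding P_def by (metis funpow.simps(2) o_apply)
      moreover have "leq (\<alpha> + m) m" using leq_plus[OF lt(1), of m] by (simp add: add.commute)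
      moreover have "\<alpha> + m \<noteq> m" using lt(2) by simp
      ultimately show False using 1 by blast
    qed
  qed
  moreover have "P 0" unfolding P_def by (rule exI[of _ 0]) simp
  ultimately show False by blast
qed

text \<open>A finite nonempty set of exponents has a greatest element, unique by antisymmetry; this
  gives meaning to the \<open>THE\<close> in \<open>lead_mon\<close>.\<close>

lemma lead_mon_properties:
  assumes "f \<noteq> 0"
  shows lead_mon_in_keys: "lead_mon leq f \<in> Poly_Mapping.keys f"
    and keys_leq_lead_mon: "\<beta> \<in> Poly_Mapping.keys f \<Longrightarrow> leq \<beta> (lead_mon leq f)"
proof -
  have "\<exists>\<alpha>\<in>A. \<forall>\<beta>\<in>A. leq \<beta> \<alpha>" if "finite A" "A \<noteq> {}" for A
    using that
  proof (induction A rule: finite_ne_induct)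
    case (insert a A)
    then show ?case by (metis insert_iff leq_linear leq_trans)
  qed (use leq_refl in auto)
  from this[of "Poly_Mapping.keys f"] assms
  obtain \<alpha> where \<alpha>: "\<alpha> \<in> Poly_Mapping.keys f" "\<forall>\<beta>\<in>Poly_Mapping.keys f. leq \<beta> \<alpha>"
    by (metis finite_keys poly_mapping_eqI not_in_keys_iff_lookup_eq_zero empty_iff lookup_zero)
  have "lead_mon leq f = \<alpha>"
    unfolding lead_mon_def by (rule the_equality) (use \<alpha> leq_antisym in blast)+
  with \<alpha> show "lead_mon leq f \<in> Poly_Mapping.keys f"
    and "\<beta> \<in> Poly_Mapping.keys f \<Longrightarrow> leq \<beta> (lead_mon leq f)" by auto
qed

context
  fixes G J :: "('n, 'c::field) mpoly set"
  assumes ideal: "ideal.subspace J"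
    and gb: "reduced_groebner_basis leq G J"
begin

lemma gb_subset: "g \<in> G \<Longrightarrow> g \<in> J"
  using gb by (auto simp: reduced_groebner_basis_def groebner_basis_def)

lemma gb_monic: "g \<in> G \<Longrightarrow> g \<noteq> 0" "g \<in> G \<Longrightarrow> coeff g (lead_mon leq g) = 1"
  using gb by (auto simp: reduced_groebner_basis_def)

lemma gb_divides:
  assumes "q \<in> J" "q \<noteq> 0"
  shows "\<exists>g\<in>G. \<exists>\<gamma>. lead_mon leq q = \<gamma> + lead_mon leq g"
proof -
  have "mon (lead_mon leq q) 1 \<in> lead_ideal leq J"
    unfolding lead_ideal_def using assms by (intro ideal.span_base) auto
  then have "mon (lead_mon leq q) 1 \<in> lead_ideal leq G"
    using gb by (simp add: reduced_groebner_basis_def groebner_basis_def)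
  from keys_in_monomial_span[OF this[unfolded lead_ideal_def], of "lead_mon leq q"]
  show ?thesis by auto
qed

text \<open>The monomial is divisible by the leading monomial of some \<open>g'\<close> in
  \<open>G\<close>. By reducedness \<open>g'\<close> can only be \<open>g\<close>, and then
  divisibility together with maximality of \<open>lead_mon leq g\<close> in \<open>g\<close> forces
  equality.\<close>

lemma gb_reduced:
  assumes "q \<in> J" "q \<noteq> 0" "g \<in> G" "lead_mon leq q \<in> Poly_Mapping.keys g"
  shows "lead_mon leq q = lead_mon leq g"
proof -
  obtain g' \<gamma> where g': "g' \<in> G" "lead_mon leq q = \<gamma> + lead_mon leq g'"
    using gb_divides[OF assms(1,2)] by blast
  show ?thesis
  proof (cases "g' = g")
    case True
    then have "leq (lead_mon leq g) (lead_mon leq q)"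
      using leq_plus[OF zero_leq, of "lead_mon leq g" \<gamma>] g'(2) by (simp add: add.commute)
    then show ?thesis using keys_leq_lead_mon[OF gb_monic(1)[OF assms(3)] assms(4)]
      by (rule leq_antisym[symmetric])
  next
    case False
    have "mon \<gamma> 1 * mon (lead_mon leq g') 1 \<in> lead_ideal leq (G - {g})"
      unfolding lead_ideal_def using False g'(1) gb_monic(1)
      by (intro ideal.span_scale ideal.span_base) auto
    then show ?thesis using gb assms(3,4)
      by (auto simp: mult_single g'(2) reduced_groebner_basis_def)
  qed
qed

text \<open>Division by \<open>G\<close>: subtracting a multiple of some \<open>g\<close> that
  cancels the leading term lowers the leading monomial, and the order is well-founded.\<close>

lemma gb_span: "J = ideal.span G"
proof
  show "ideal.span G \<subseteq> J"
    using gb_subset ideal by (intro ideal.span_minimal) auto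
  have "f \<in> ideal.span G" if "f \<in> J" "f \<noteq> 0" "lead_mon leq f = \<mu>" for f \<mu>
    using that
  proof (induction \<mu> arbitrary: f rule: leq_induct)
    case (1 \<mu>)
    obtain g \<gamma> where g: "g \<in> G" "\<mu> = \<gamma> + lead_mon leq g"
      using gb_divides[OF "1.prems"(1,2)] "1.prems"(3) by blast
    define h where "h = mon \<gamma> (coeff f \<mu>) * g"
    have hk: "leq \<beta> \<mu>" if "\<beta> \<in> Poly_Mapping.keys h" for \<beta>
      using keys_mon_times[of \<gamma> "coeff f \<mu>" g] that keys_leq_lead_mon[OF gb_monic(1)[OF g(1)]]
      unfolding h_def g(2) by (auto intro!: leq_plus)
    have "coeff (f - h) \<mu> = 0"
      using coeff_mon_times[of \<gamma> "coeff f \<mu>" g "lead_mon leq g"] gb_monic(2)[OF g(1)]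
      by (simp add: lookup_minus h_def flip: g(2))
    moreover have "leq \<beta> \<mu>" if "\<beta> \<in> Poly_Mapping.keys (f - h)" for \<beta>
      using that keys_diff[of f h] hk keys_leq_lead_mon[OF "1.prems"(2)] "1.prems"(3) by auto
    ultimately have lt: "leq \<beta> \<mu> \<and> \<beta> \<noteq> \<mu>" if "\<beta> \<in> Poly_Mapping.keys (f - h)" for \<beta>
      using that by (auto simp: in_keys_iff)
    have hJ: "h \<in> J" unfolding h_def by (rule ideal.subspace_scale[OF ideal gb_subset[OF g(1)]])
    have "f - h \<in> ideal.span G"
    proof (cases "f - h = 0")
      case False
      then show ?thesis
        using "1.IH"[OF lt ideal.subspace_diff[OF ideal "1.prems"(1) hJ] False refl]
          lead_mon_in_keys[OF False] by blast
    qed (simp add: ideal.span_zero)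
    moreover have "h \<in> ideal.span G"
      unfolding h_def by (intro ideal.span_scale ideal.span_base g(1))
    ultimately show ?case using ideal.span_add by fastforce
  qed
  then show "J \<subseteq> ideal.span G" using ideal.span_zero by blast
qed

text \<open>Proportionality of monomials modulo \<open>J\<close> splits \<open>g\<close> into parts
  that again lie in \<open>J\<close>, because the generators of \<open>J\<close> have at most two
  terms. Then \<open>gb_reduced\<close> leaves room for one class only and, in it, for one monomial
  besides the leading one.\<close>

lemma gb_binomial:
  assumes binomial: "binomial_ideal J" and no_mon: "\<And>\<alpha>. mon \<alpha> 1 \<notin> J" and g: "g \<in> G"
  obtains \<alpha> \<beta> c where "\<alpha> \<noteq> \<beta>" "c \<noteq> 0" "g = mon \<alpha> 1 - mon \<beta> c"
proof -
  define E where "E = (\<lambda>\<alpha> \<beta>. \<exists>c. c \<noteq> 0 \<and> mon \<alpha> 1 - mon \<beta> c \<in> J)"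
  have E_refl: "E \<alpha> \<alpha>" for \<alpha>
    unfolding E_def by (rule exI[of _ 1]) (simp add: ideal.subspace_0[OF ideal])
  have E_plus: "E (\<gamma> + \<alpha>) (\<gamma> + \<beta>)" if ab: "E \<alpha> \<beta>" for \<alpha> \<beta> \<gamma>
  proof -
    obtain c where c: "c \<noteq> 0" "mon \<alpha> 1 - mon \<beta> c \<in> J" using ab unfolding E_def by blast
    from ideal.subspace_scale[OF ideal c(2), of "mon \<gamma> 1"]
    show ?thesis unfolding E_def using c(1)
      by (intro exI[of _ c]) (simp add: right_diff_distrib mult_single)
  qed
  have E_sym: "E \<beta> \<alpha>" if ab: "E \<alpha> \<beta>" for \<alpha> \<beta>
  proof -
    obtain c where c: "c \<noteq> 0" "mon \<alpha> 1 - mon \<beta> c \<in> J" using ab unfolding E_def by blast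
    from ideal.subspace_scale[OF ideal c(2), of "mon 0 (- inverse c)"] c(1)
    show ?thesis unfolding E_def
      by (intro exI[of _ "inverse c"]) (simp add: right_diff_distrib mult_single single_uminus)
  qed
  have E_trans: "E \<alpha> \<gamma>" if ab: "E \<alpha> \<beta>" "E \<beta> \<gamma>" for \<alpha> \<beta> \<gamma>
  proof -
    obtain c where c: "c \<noteq> 0" "mon \<alpha> 1 - mon \<beta> c \<in> J" using ab(1) unfolding E_def by blast
    obtain d where d: "d \<noteq> 0" "mon \<beta> 1 - mon \<gamma> d \<in> J" using ab(2) unfolding E_def by blast
    from ideal.subspace_add[OF ideal c(2) ideal.subspace_scale[OF ideal d(2), of "mon 0 c"]]
    show ?thesis unfolding E_def using c(1) d(1)
      by (intro exI[of _ "c * d"]) (simp add: right_diff_distrib mult_single)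
  qed
  have class_part: "restrict_mpoly {\<beta>. E \<gamma> \<beta>} g \<in> J" for \<gamma>
  proof -
    obtain B where B: "\<And>f. f \<in> B \<Longrightarrow> card (Poly_Mapping.keys f) \<le> 2" "J = ideal.span B"
      using binomial unfolding binomial_ideal_def by blast
    have "E \<alpha> \<beta>" if b: "b \<in> B" "\<alpha> \<in> Poly_Mapping.keys b" "\<beta> \<in> Poly_Mapping.keys b" for b \<alpha> \<beta>
    proof (cases "\<alpha> = \<beta>")
      case False
      have "Poly_Mapping.keys b = {\<alpha>, \<beta>}"
        using B(1)[OF b(1)] b(2,3) False by (intro card_seteq[symmetric]) auto
      then have "b = mon \<alpha> (coeff b \<alpha>) + mon \<beta> (coeff b \<beta>)"
        using mpoly_expand[of b] False by simp
      moreover define a e where "a = coeff b \<alpha>" and "e = coeff b \<beta>"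
      ultimately have b_eq: "b = mon \<alpha> a + mon \<beta> e" by simp
      have ae: "a \<noteq> 0" "e \<noteq> 0" using b(2,3) by (simp_all add: a_def e_def in_keys_iff)
      have "mon 0 (inverse a) * b = mon \<alpha> 1 - mon \<beta> (- (e / a))"
        unfolding b_eq using ae by (simp add: distrib_left mult_single single_uminus field_simps)
      moreover have "mon 0 (inverse a) * b \<in> J"
        unfolding B(2) by (intro ideal.span_scale ideal.span_base b(1))
      ultimately show ?thesis using ae unfolding E_def
        by (intro exI[of _ "- (e / a)"]) simp
    qed (simp add: E_refl)
    moreover have "g \<in> ideal.span B" using gb_subset[OF g] B(2) by simp
    ultimately have "restrict_mpoly {\<beta>. E \<gamma> \<beta>} g \<in> ideal.span B"
    proof (intro restrict_mpoly_in_span[where E = E])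
      show "E (\<gamma> + \<alpha>) (\<gamma> + \<beta>)" if "E \<alpha> \<beta>" for \<alpha> \<beta> \<gamma> by (rule E_plus[OF that])
      show "\<alpha> \<in> {\<beta>. E \<gamma> \<beta>} \<longleftrightarrow> \<beta> \<in> {\<beta>. E \<gamma> \<beta>}" if "E \<alpha> \<beta>" for \<alpha> \<beta>
        using E_trans[OF _ that, of \<gamma>] E_trans[OF _ E_sym[OF that], of \<gamma>] by blast
    qed
    then show ?thesis unfolding B(2) .
  qed
  let ?l = "lead_mon leq g"
  have l: "?l \<in> Poly_Mapping.keys g" by (rule lead_mon_in_keys[OF gb_monic(1)[OF g]])
  \<comment> \<open>The leading monomial of the class part of \<open>\<gamma>\<close> occurs in
    \<open>g\<close>, so it must be \<open>?l\<close>.\<close>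
  have rel: "E \<gamma> ?l" if "\<gamma> \<in> Poly_Mapping.keys g" for \<gamma>
  proof -
    let ?q = "restrict_mpoly {\<beta>. E \<gamma> \<beta>} g"
    have "\<gamma> \<in> Poly_Mapping.keys ?q" by (simp add: keys_restrict_mpoly that E_refl)
    then have "?q \<noteq> 0" by auto
    moreover from lead_mon_in_keys[OF this] have "lead_mon leq ?q \<in> Poly_Mapping.keys g"
      "E \<gamma> (lead_mon leq ?q)" by (simp_all add: keys_restrict_mpoly)
    ultimately show ?thesis using gb_reduced[OF class_part _ g] by simp
  qed
  have "\<exists>\<gamma>\<in>Poly_Mapping.keys g. \<gamma> \<noteq> ?l"
  proof (rule ccontr)
    assume "\<not> ?thesis"
    then have "Poly_Mapping.keys g = {?l}" using l by blast
    then have "g = mon ?l 1" using mpoly_expand[of g] gb_monic(2)[OF g] by simp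
    then show False using no_mon gb_subset[OF g] by metis
  qed
  then obtain \<gamma> where \<gamma>: "\<gamma> \<in> Poly_Mapping.keys g" "\<gamma> \<noteq> ?l" by blast
  \<comment> \<open>Two nonleading monomials of \<open>g\<close> would be proportional modulo
    \<open>J\<close>, and the binomial expressing this would have one of them as its leading
    monomial.\<close>
  have "\<gamma>' = \<gamma>" if \<gamma>': "\<gamma>' \<in> Poly_Mapping.keys g" "\<gamma>' \<noteq> ?l" for \<gamma>'
  proof (rule ccontr)
    assume ne: "\<gamma>' \<noteq> \<gamma>"
    obtain c where c: "c \<noteq> 0" "mon \<gamma> 1 - mon \<gamma>' c \<in> J"
      using E_trans[OF rel[OF \<gamma>(1)] E_sym[OF rel[OF \<gamma>'(1)]]] unfolding E_def by blast
    let ?q = "mon \<gamma> 1 - mon \<gamma>' c :: ('n, 'c) mpoly"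
    have "coeff ?q \<gamma> = 1" using ne by (simp add: lookup_minus lookup_single)
    then have "?q \<noteq> 0" by auto
    moreover from lead_mon_in_keys[OF this] have "lead_mon leq ?q \<in> {\<gamma>, \<gamma>'}"
      using keys_diff[of "mon \<gamma> 1" "mon \<gamma>' c"] by (auto split: if_splits)
    ultimately show False using gb_reduced[OF c(2) _ g] \<gamma> \<gamma>' by auto
  qed
  then have "Poly_Mapping.keys g = {?l, \<gamma>}" using \<gamma> l by blast
  then have "g = mon ?l 1 - mon \<gamma> (- coeff g \<gamma>)"
    using mpoly_expand[of g] gb_monic(2)[OF g] \<gamma>(2) by (simp add: single_uminus)
  moreover have "- coeff g \<gamma> \<noteq> 0" using \<gamma>(1) by (simp add: in_keys_iff)
  ultimately show thesis using that \<gamma>(2) by metis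
qed

end

end

section \<open>Hensel lifting for systems of polynomials over power series\<close>

lemma square_dvd_power_minus_linear:
  fixes M a :: "'a::comm_ring_1"
  shows "M\<^sup>2 dvd (1 + M * a) ^ n - (1 + M * (of_nat n * a))"
proof (induction n)
  case (Suc n)
  have "(1 + M * a) ^ Suc n - (1 + M * (of_nat (Suc n) * a))
      = (1 + M * a) * ((1 + M * a) ^ n - (1 + M * (of_nat n * a))) + M\<^sup>2 * (of_nat n * a\<^sup>2)"
    by (simp add: algebra_simps power2_eq_square)
  then show ?case by (simp only:) (intro dvd_add dvd_mult Suc dvd_triv_left)
qed simp

lemma square_dvd_prod_minus_linear:
  fixes M :: "'a::comm_ring_1"
  assumes "\<And>i. i \<in> A \<Longrightarrow> M\<^sup>2 dvd f i - (1 + M * b i)"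
  shows "M\<^sup>2 dvd (\<Prod>i\<in>A. f i) - (1 + M * (\<Sum>i\<in>A. b i))"
  using assms
proof (induction A rule: infinite_finite_induct)
  case (insert i A)
  let ?P = "\<Prod>i\<in>A. f i" and ?S = "\<Sum>i\<in>A. b i"
  have "(\<Prod>i\<in>insert i A. f i) - (1 + M * (\<Sum>i\<in>insert i A. b i))
      = f i * (?P - (1 + M * ?S)) + (f i - (1 + M * b i)) * (1 + M * ?S) + M\<^sup>2 * (b i * ?S)"
    using insert(1,2) by (simp add: algebra_simps power2_eq_square)
  moreover have "M\<^sup>2 dvd f i - (1 + M * b i)" "M\<^sup>2 dvd ?P - (1 + M * ?S)"
    using insert by auto
  ultimately show ?case by (simp only:) (intro dvd_add dvd_mult dvd_mult2 dvd_triv_left)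
qed simp_all

text \<open>Increments enter multiplicatively, as factors \<open>1 + M * e i\<close>. The linear
  term of a monomial is then its exponent vector paired with \<open>e\<close>, so Jacobians can be
  written without formal derivatives.\<close>

lemma square_dvd_mon_value_minus_linear:
  fixes M :: "'a::comm_ring_1"
  shows "M\<^sup>2 dvd mon_value (\<lambda>i. 1 + M * e i) \<alpha>
    - (1 + M * (\<Sum>i\<in>UNIV. of_nat (Poly_Mapping.lookup \<alpha> i) * e i))"
  unfolding mon_value_def
  by (intro square_dvd_prod_minus_linear square_dvd_power_minus_linear)

lemma dvd_power_diff:
  fixes d a b :: "'a::comm_ring_1"
  assumes "d dvd a - b"
  shows "d dvd a ^ n - b ^ n"
proof (induction n)
  case (Suc n)
  have "a ^ Suc n - b ^ Suc n = a * (a ^ n - b ^ n) + (a - b) * b ^ n"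
    by (simp add: algebra_simps)
  then show ?case by (simp only:) (intro dvd_add dvd_mult dvd_mult2 Suc assms)
qed simp

lemma dvd_mon_value_diff:
  fixes d :: "'a::comm_ring_1"
  assumes "\<And>i. d dvd x i - y i"
  shows "d dvd mon_value x \<alpha> - mon_value y \<alpha>"
proof -
  have "d dvd (\<Prod>i\<in>A. x i ^ Poly_Mapping.lookup \<alpha> i) - (\<Prod>i\<in>A. y i ^ Poly_Mapping.lookup \<alpha> i)" for A
  proof (induction A rule: infinite_finite_induct)
    case (insert i A)
    let ?x = "\<lambda>i. x i ^ Poly_Mapping.lookup \<alpha> i" and ?y = "\<lambda>i. y i ^ Poly_Mapping.lookup \<alpha> i"
    have "prod ?x (insert i A) - prod ?y (insert i A)
        = ?x i * (prod ?x A - prod ?y A) + (?x i - ?y i) * prod ?y A"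
      using insert(1,2) by (simp add: algebra_simps)
    then show ?case by (simp only:) (intro dvd_add dvd_mult dvd_mult2 insert(3) dvd_power_diff assms)
  qed simp_all
  then show ?thesis by (simp add: mon_value_def)
qed

lemma dvd_subst_diff:
  fixes d :: "'a::comm_ring_1"
  assumes "\<And>i. d dvd x i - y i"
  shows "d dvd subst h x f - subst h y f"
proof -
  have "d dvd h (coeff f \<alpha>) * (mon_value x \<alpha> - mon_value y \<alpha>)" for \<alpha>
    by (intro dvd_mult dvd_mon_value_diff assms)
  then have "d dvd (\<Sum>\<alpha>\<in>Poly_Mapping.keys f. h (coeff f \<alpha>) * (mon_value x \<alpha> - mon_value y \<alpha>))"
    by (intro dvd_sum)
  then show ?thesis by (simp add: subst_eq_sum sum_subtractf right_diff_distrib)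
qed

section \<open>Newton iteration in the X-adic topology\<close>

lemma fps_X_power_dvd_iff:
  fixes f :: "'a::comm_ring_1 fps"
  shows "fps_X ^ k dvd f \<longleftrightarrow> (\<forall>m<k. fps_nth f m = 0)"
proof
  assume "\<forall>m<k. fps_nth f m = 0"
  then have "f = fps_X ^ k * fps_shift k f"
    by (intro fps_ext) (simp add: fps_X_power_mult_nth)
  then show "fps_X ^ k dvd f" by (rule dvdI)
qed (auto simp: fps_X_power_mult_nth elim!: dvdE)

interpretation fps_nth_0: coeff_hom "\<lambda>c::'a::comm_ring_1 fps. fps_nth c 0"
  by unfold_locales (simp_all add: fps_mult_nth_0)

text \<open>By \<open>zero\<close>, \<open>y\<close> solves the system modulo \<open>fps_X\<close>;
  by \<open>surj\<close>, the Jacobian at \<open>y\<close> is onto for increments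
  \<open>y i * \<epsilon> i\<close>. Each Newton step gains one order of vanishing by solving one
  linear system over the constant terms.\<close>

lemma hensel_system:
  fixes F :: "'j \<Rightarrow> ('n::finite, 'a::comm_ring_1 fps) mpoly" and y :: "'n \<Rightarrow> 'a"
  assumes zero: "\<And>j. j \<in> R \<Longrightarrow> subst (\<lambda>c. fps_nth c 0) y (F j) = 0"
    and surj: "\<And>\<tau>. \<exists>\<epsilon>. \<forall>j\<in>R. (\<Sum>\<alpha>\<in>Poly_Mapping.keys (F j). fps_nth (coeff (F j) \<alpha>) 0 * mon_value y \<alpha>
        * (\<Sum>i\<in>UNIV. of_nat (Poly_Mapping.lookup \<alpha> i) * \<epsilon> i)) = \<tau> j"
  obtains \<zeta> where "\<And>i. fps_nth (\<zeta> i) 0 = y i" "\<And>j. j \<in> R \<Longrightarrow> subst (\<lambda>c. c) \<zeta> (F j) = 0"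
proof -
  \<comment> \<open>The offset \<open>Suc n\<close> makes stage 0 the solution modulo
    \<open>fps_X\<close> given by \<open>zero\<close>.\<close>
  define P where "P = (\<lambda>n \<zeta>. (\<forall>i. fps_nth (\<zeta> i) 0 = y i)
    \<and> (\<forall>j\<in>R. fps_X ^ Suc n dvd subst (\<lambda>c. c) \<zeta> (F j)))"
  define Q where "Q = (\<lambda>n (\<zeta> :: 'n \<Rightarrow> 'a fps) \<zeta>'. \<forall>i. (fps_X ^ Suc n :: 'a fps) dvd \<zeta>' i - (\<zeta> i :: 'a fps))"
  have nth_0: "fps_nth (subst (\<lambda>c. c) \<zeta> f) 0 = subst (\<lambda>c. fps_nth c 0) y f"
    if "\<And>i. fps_nth (\<zeta> i) 0 = y i" for \<zeta> and f :: "('n, 'a fps) mpoly"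
    by (simp add: subst_eq_sum fps_nth_0.hom_sum fps_nth_0.hom_mult fps_nth_0.hom_mon_value that)
  have "\<exists>\<zeta>. P 0 \<zeta>"
    by (rule exI[of _ "\<lambda>i. fps_const (y i)"])
      (simp add: P_def fps_X_power_dvd_iff[where k = 1, simplified] nth_0 zero)
  moreover have "\<exists>\<zeta>'. P (Suc n) \<zeta>' \<and> Q n \<zeta> \<zeta>'" if "P n \<zeta>" for n \<zeta>
  proof -
    define k where "k = Suc n"
    have \<zeta>0: "\<And>i. fps_nth (\<zeta> i) 0 = y i"
      and \<zeta>k: "\<And>j. j \<in> R \<Longrightarrow> fps_X ^ k dvd subst (\<lambda>c. c) \<zeta> (F j)"
      using that by (auto simp: P_def k_def)
    \<comment> \<open>The right-hand side is chosen so that the correction cancels the coefficient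
      of order \<open>k\<close> in the values of the system.\<close>
    obtain \<epsilon> where \<epsilon>: "\<And>j. j \<in> R \<Longrightarrow> (\<Sum>\<alpha>\<in>Poly_Mapping.keys (F j). fps_nth (coeff (F j) \<alpha>) 0
        * mon_value y \<alpha> * (\<Sum>i\<in>UNIV. of_nat (Poly_Mapping.lookup \<alpha> i) * \<epsilon> i))
        = - fps_nth (subst (\<lambda>c. c) \<zeta> (F j)) k"
      using surj[of "\<lambda>j. - fps_nth (subst (\<lambda>c. c) \<zeta> (F j)) k"] by blast
    define L where "L = (\<lambda>\<alpha>. \<Sum>i\<in>UNIV. of_nat (Poly_Mapping.lookup \<alpha> i) * fps_const (\<epsilon> i))"
    define \<zeta>' where "\<zeta>' = (\<lambda>i. \<zeta> i * (1 + fps_X ^ k * fps_const (\<epsilon> i)))"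
    have "fps_nth (\<zeta>' i) 0 = y i" for i
      by (simp add: \<zeta>'_def fps_mult_nth_0 \<zeta>0 k_def)
    moreover have "fps_X ^ Suc k dvd subst (\<lambda>c. c) \<zeta>' (F j)" if j: "j \<in> R" for j
    proof -
      define T where "T = (\<Sum>\<alpha>\<in>Poly_Mapping.keys (F j). coeff (F j) \<alpha> * mon_value \<zeta> \<alpha> * L \<alpha>)"
      have L0: "fps_nth (L \<alpha>) 0 = (\<Sum>i\<in>UNIV. of_nat (Poly_Mapping.lookup \<alpha> i) * \<epsilon> i)" for \<alpha>
        by (simp add: L_def fps_nth_0.hom_sum fps_nth_0.hom_mult fps_nth_of_nat)
      have T0: "fps_nth T 0 = - fps_nth (subst (\<lambda>c. c) \<zeta> (F j)) k"
        unfolding T_def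
        by (simp add: fps_nth_0.hom_sum fps_nth_0.hom_mult fps_nth_0.hom_mon_value \<zeta>0 L0 \<epsilon>[OF j])
      \<comment> \<open>The quadratic error is negligible because \<open>k\<close> is at least
        1.\<close>
      have "fps_X ^ Suc k dvd (fps_X ^ k :: 'a fps)\<^sup>2"
        unfolding power_mult[symmetric] by (rule le_imp_power_dvd) (simp add: k_def)
      then have "fps_X ^ Suc k dvd coeff (F j) \<alpha> * mon_value \<zeta> \<alpha> *
          (mon_value (\<lambda>i. 1 + fps_X ^ k * fps_const (\<epsilon> i)) \<alpha> - (1 + fps_X ^ k * L \<alpha>))" for \<alpha>
        unfolding L_def by (intro dvd_mult dvd_trans[OF _ square_dvd_mon_value_minus_linear])
      then have "fps_X ^ Suc k dvd (\<Sum>\<alpha>\<in>Poly_Mapping.keys (F j). coeff (F j) \<alpha> * mon_value \<zeta> \<alpha> *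
          (mon_value (\<lambda>i. 1 + fps_X ^ k * fps_const (\<epsilon> i)) \<alpha> - (1 + fps_X ^ k * L \<alpha>)))"
        by (intro dvd_sum)
      also have "(\<Sum>\<alpha>\<in>Poly_Mapping.keys (F j). coeff (F j) \<alpha> * mon_value \<zeta> \<alpha> *
          (mon_value (\<lambda>i. 1 + fps_X ^ k * fps_const (\<epsilon> i)) \<alpha> - (1 + fps_X ^ k * L \<alpha>)))
        = subst (\<lambda>c. c) \<zeta>' (F j) - (subst (\<lambda>c. c) \<zeta> (F j) + fps_X ^ k * T)"
        unfolding subst_eq_sum T_def \<zeta>'_def mon_value_mult sum_distrib_left
          sum.distrib[symmetric] sum_subtractf[symmetric]
        by (rule sum.cong) (simp_all add: algebra_simps)
      finally have 1: "fps_X ^ Suc k dvd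
          subst (\<lambda>c. c) \<zeta>' (F j) - (subst (\<lambda>c. c) \<zeta> (F j) + fps_X ^ k * T)" .
      \<comment> \<open>Orders below \<open>k\<close> vanish by \<open>\<zeta>k\<close>, and order
        \<open>k\<close> cancels by \<open>T0\<close>.\<close>
      have "fps_X ^ Suc k dvd subst (\<lambda>c. c) \<zeta> (F j) + fps_X ^ k * T"
        using \<zeta>k[OF j] T0 unfolding fps_X_power_dvd_iff
        by (auto simp: fps_X_power_mult_nth less_Suc_eq)
      from dvd_add[OF 1 this] show ?thesis by simp
    qed
    moreover have "\<zeta>' i - \<zeta> i = fps_X ^ k * (\<zeta> i * fps_const (\<epsilon> i))" for i
      by (simp add: \<zeta>'_def algebra_simps)
    then have "Q n \<zeta> \<zeta>'"
      by (simp only: Q_def k_def[symmetric] dvd_triv_left simp_thms)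
    ultimately show ?thesis unfolding P_def k_def by blast
  qed
  ultimately obtain s where s: "\<And>n. P n (s n)" "\<And>n. Q n (s n) (s (Suc n))"
    using dependent_nat_choice[of P Q] by blast
  \<comment> \<open>Diagonal limit: coefficient \<open>m\<close> is final from stage
    \<open>m\<close> on.\<close>
  define \<zeta> where "\<zeta> = (\<lambda>i. Abs_fps (\<lambda>m. fps_nth (s m i) m))"
  have stable: "fps_nth (s n i) m = fps_nth (s m i) m" if "m \<le> n" for m n i
    using that
  proof (induction n rule: dec_induct)
    case (step n)
    have "fps_nth (s (Suc n) i - s n i) m = 0"
      using s(2)[of n] step(1) by (simp only: Q_def fps_X_power_dvd_iff)
    then show ?case using step by simp
  qed simp
  have close: "fps_X ^ Suc n dvd \<zeta> i - s n i" for n i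
    unfolding fps_X_power_dvd_iff
  proof (intro allI impI)
    fix m assume "m < Suc n"
    then show "fps_nth (\<zeta> i - s n i) m = 0" using stable[of m n i] by (simp add: \<zeta>_def)
  qed
  have "subst (\<lambda>c. c) \<zeta> (F j) = 0" if j: "j \<in> R" for j
  proof (rule fps_ext)
    fix m
    have "fps_X ^ Suc m dvd subst (\<lambda>c. c) \<zeta> (F j) - subst (\<lambda>c. c) (s m) (F j)"
      by (intro dvd_subst_diff close)
    moreover have "fps_X ^ Suc m dvd subst (\<lambda>c. c) (s m) (F j)"
      using s(1)[of m] j by (simp add: P_def)
    ultimately have "fps_X ^ Suc m dvd subst (\<lambda>c. c) \<zeta> (F j)"
      by (metis dvd_add diff_add_cancel)
    then show "fps_nth (subst (\<lambda>c. c) \<zeta> (F j)) m = fps_nth 0 m"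
      unfolding fps_X_power_dvd_iff by simp
  qed
  moreover have "fps_nth (\<zeta> i) 0 = y i" for i
    using s(1)[of 0] by (simp add: P_def \<zeta>_def)
  ultimately show thesis using that by blast
qed

section \<open>Puiseux series\<close>

interpretation puiseux_const: coeff_hom puiseux_const
proof
  fix a b :: complex
  show "puiseux_const (a + b) = puiseux_const a + puiseux_const b"
    by transfer (simp add: fun_eq_iff)
  show "puiseux_const 1 = 1"
    by transfer simp
  have "{x. (if x = 0 then a else 0) \<noteq> 0 \<and> (if q - x = 0 then b else 0) \<noteq> 0}
      = (if q = 0 \<and> a \<noteq> 0 \<and> b \<noteq> 0 then {0} else {})" for q :: rat
    by auto
  then have "(\<lambda>q. if q = 0 then a * b else 0)
      = puiseux_conv (\<lambda>q. if q = 0 then a else 0) (\<lambda>q. if q = 0 then b else 0)"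
    by (auto simp: fun_eq_iff puiseux_conv_def)
  then show "puiseux_const (a * b) = puiseux_const a * puiseux_const b"
    by transfer
qed

lemma puiseux_nth_add: "puiseux_nth (x + y) q = puiseux_nth x q + puiseux_nth y q"
  by transfer simp

lemma puiseux_nth_0: "puiseux_nth 0 q = 0"
  by transfer simp

lemma puiseux_nth_const_mult: "puiseux_nth (x * puiseux_const c) q = puiseux_nth x q * c"
proof -
  have "{a. puiseux_nth x a \<noteq> 0 \<and> (if q - a = 0 then c else 0) \<noteq> 0}
      = (if puiseux_nth x q \<noteq> 0 \<and> c \<noteq> 0 then {q} else {})"
    by auto
  then show ?thesis
    by (auto simp: times_puiseux.rep_eq puiseux_const.rep_eq puiseux_conv_def)
qed

text \<open>
  \<open>x = c t\<^sup>q + higher terms\<close>, where \<open>c\<close> may be \<open>0\<close>; unlike the valuation this is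
  compatible with sums.
\<close>

definition puiseux_leads :: "rat \<Rightarrow> complex \<Rightarrow> puiseux \<Rightarrow> bool" where
  "puiseux_leads q c x \<longleftrightarrow> puiseux_nth x q = c \<and> (\<forall>r<q. puiseux_nth x r = 0)"

lemma puiseux_leads_val_lc:
  assumes "x \<noteq> 0"
  shows "puiseux_leads (puiseux_val x) (puiseux_lc x) x"
  using puiseux_val_least(2)[OF assms] by (auto simp: puiseux_leads_def puiseux_lc_def not_less[symmetric])

lemma puiseux_leadsD:
  assumes "puiseux_leads q c x" "c \<noteq> 0"
  shows "x \<noteq> 0" "puiseux_val x = q" "puiseux_lc x = c"
proof -
  show "x \<noteq> 0" using assms by (auto simp: puiseux_leads_def puiseux_nth_0)
  show *: "puiseux_val x = q"
    unfolding puiseux_val_def using assms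
    by (intro Least_equality) (auto simp: puiseux_leads_def not_less[symmetric])
  show "puiseux_lc x = c" using assms by (simp add: puiseux_lc_def * puiseux_leads_def)
qed

lemma puiseux_leads_0: "puiseux_leads q 0 0"
  by (simp add: puiseux_leads_def puiseux_nth_0)

lemma puiseux_leads_0D: "puiseux_leads q c 0 \<Longrightarrow> c = 0"
  by (simp add: puiseux_leads_def puiseux_nth_0)

lemma puiseux_leads_const: "puiseux_leads 0 c (puiseux_const c)"
  by (simp add: puiseux_leads_def puiseux_const.rep_eq)

lemma puiseux_leads_less: "puiseux_leads q c x \<Longrightarrow> r < q \<Longrightarrow> puiseux_leads r 0 x"
  by (simp add: puiseux_leads_def)

lemma puiseux_leads_add:
  "puiseux_leads q c x \<Longrightarrow> puiseux_leads q d y \<Longrightarrow> puiseux_leads q (c + d) (x + y)"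
  by (simp add: puiseux_leads_def puiseux_nth_add)

lemma puiseux_leads_sum:
  "(\<And>i. i \<in> A \<Longrightarrow> puiseux_leads q (c i) (x i)) \<Longrightarrow> puiseux_leads q (\<Sum>i\<in>A. c i) (\<Sum>i\<in>A. x i)"
  by (induction A rule: infinite_finite_induct) (auto intro: puiseux_leads_0 puiseux_leads_add)

text \<open>In the convolution no pair of exponents contributes below order \<open>q + r\<close>,
  and at that order only the pair of \<open>q\<close> and \<open>r\<close> can. Zero coefficients
  are allowed, so mere bounds on orders multiply as well.\<close>

lemma puiseux_leads_mult:
  assumes "puiseux_leads q c x" "puiseux_leads r d y"
  shows "puiseux_leads (q + r) (c * d) (x * y)"
proof -
  have "puiseux_nth (x * y) s = 0" if "s < q + r" for s
  proof -
    have "a < q \<or> s - a < r" for a using that by linarith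
    then have "{a. puiseux_nth x a \<noteq> 0 \<and> puiseux_nth y (s - a) \<noteq> 0} = {}"
      using assms by (auto simp: puiseux_leads_def)
    then show ?thesis by (simp only: times_puiseux.rep_eq puiseux_conv_def sum.empty)
  qed
  moreover have "{a. puiseux_nth x a \<noteq> 0 \<and> puiseux_nth y (q + r - a) \<noteq> 0}
      = (if c \<noteq> 0 \<and> d \<noteq> 0 then {q} else {})"
  proof -
    have "a = q" if "puiseux_nth x a \<noteq> 0" "puiseux_nth y (q + r - a) \<noteq> 0" for a
    proof (rule ccontr)
      assume "a \<noteq> q"
      then have "a < q \<or> q + r - a < r" by auto
      then show False using assms that by (auto simp: puiseux_leads_def)
    qed
    then have "puiseux_nth x a \<noteq> 0 \<and> puiseux_nth y (q + r - a) \<noteq> 0 \<longleftrightarrow> a = q \<and> c \<noteq> 0 \<and> d \<noteq> 0" for a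
      using assms by (cases "a = q") (auto simp: puiseux_leads_def)
    then show ?thesis by auto
  qed
  then have "puiseux_nth (x * y) (q + r) = c * d"
    using assms by (simp add: puiseux_leads_def times_puiseux.rep_eq puiseux_conv_def)
  ultimately show ?thesis by (simp add: puiseux_leads_def)
qed

lemma puiseux_leads_power:
  "puiseux_leads q c x \<Longrightarrow> puiseux_leads (of_nat n * q) (c ^ n) (x ^ n)"
proof (induction n)
  case 0
  then show ?case using puiseux_leads_const[of 1] by (simp add: puiseux_const.hom_one)
next
  case (Suc n)
  then show ?case using puiseux_leads_mult[of q c x "of_nat n * q" "c ^ n" "x ^ n"]
    by (simp add: algebra_simps)
qed

lemma puiseux_leads_mon_value:
  assumes "\<And>i. puiseux_leads (q i) (c i) (x i)"
  shows "puiseux_leads (\<Sum>i\<in>UNIV. of_nat (Poly_Mapping.lookup \<alpha> i) * q i) (mon_value c \<alpha>) (mon_value x \<alpha>)"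
proof -
  have "puiseux_leads (\<Sum>i\<in>A. of_nat (Poly_Mapping.lookup \<alpha> i) * q i)
      (\<Prod>i\<in>A. c i ^ Poly_Mapping.lookup \<alpha> i) (\<Prod>i\<in>A. x i ^ Poly_Mapping.lookup \<alpha> i)" if "finite A" for A
    using that
  proof (induction A rule: finite_induct)
    case empty
    then show ?case using puiseux_leads_const[of 1] by (simp add: puiseux_const.hom_one)
  next
    case (insert i A)
    then show ?case
      using puiseux_leads_mult[OF puiseux_leads_power[OF assms] insert(3)] by simp
  qed
  then show ?thesis by (simp add: mon_value_def)
qed

section \<open>Initial ideals of ideals generated by constant polynomials\<close>

text \<open>Extracting the coefficient of \<open>t\<close> to the power \<open>q\<close> is linear
  over the constants. This carries elements of an ideal with constant generators to complex
  polynomials in the ideal of the same generators.\<close>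

lemma puiseux_nth_map_mult:
  fixes h :: "('n, puiseux) mpoly"
  shows "Poly_Mapping.map (\<lambda>x. puiseux_nth x q) (h * Poly_Mapping.map puiseux_const b)
    = Poly_Mapping.map (\<lambda>x. puiseux_nth x q) h * b"
proof (induction h rule: mpoly_induct)
  case (mon \<alpha> c)
  show ?case
    by (induction b rule: mpoly_induct)
      (simp_all add: map_zero_mpoly map_add_mpoly puiseux_nth_0 puiseux_nth_add mult_single
        puiseux_const.hom_zero puiseux_const.hom_add distrib_left puiseux_nth_const_mult)
qed (simp_all add: map_zero_mpoly map_add_mpoly puiseux_nth_0 puiseux_nth_add distrib_right)

text \<open>The intersection of \<open>I\<close> with the complex polynomials. All nonzero
  coefficients have valuation 0 there, so weights alone decide initial forms.\<close>

definition constant_part :: "('n, puiseux) mpoly set \<Rightarrow> ('n, complex) mpoly set" where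
  "constant_part I = {f. Poly_Mapping.map puiseux_const f \<in> I}"

lemma puiseux_nth_map_const: "Poly_Mapping.map (\<lambda>x. puiseux_nth x 0) (Poly_Mapping.map puiseux_const f)
    = (f :: ('n, complex) mpoly)"
  by (rule poly_mapping_eqI)
    (simp add: coeff_map puiseux_nth_0 puiseux_const.hom_zero puiseux_const.rep_eq)

text \<open>One set \<open>B\<close> generates both ideals. Extraction of a power of
  \<open>t\<close> maps \<open>I\<close> into \<open>ideal.span B\<close> and, for
  \<open>q = 0\<close>, fixes constant polynomials; this puts \<open>constant_part I\<close> inside
  \<open>ideal.span B\<close>.\<close>

lemma real_generators:
  fixes I :: "('n, puiseux) mpoly set"
  assumes "generated_by_real_polys I"
  obtains B where "\<And>b \<alpha>. b \<in> B \<Longrightarrow> coeff b \<alpha> \<in> \<real>" "I = ideal.span (Poly_Mapping.map puiseux_const ` B)"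
    "constant_part I = ideal.span B"
    "\<And>f q. f \<in> I \<Longrightarrow> Poly_Mapping.map (\<lambda>x. puiseux_nth x q) f \<in> constant_part I"
proof -
  from assms obtain C where
    C: "\<And>f \<alpha>. f \<in> C \<Longrightarrow> \<exists>r::real. coeff f \<alpha> = puiseux_const (complex_of_real r)"
      "I = ideal.span C"
    unfolding generated_by_real_polys_def by blast
  let ?ext = "\<lambda>q. Poly_Mapping.map (\<lambda>x. puiseux_nth x q) :: ('n, puiseux) mpoly \<Rightarrow> ('n, complex) mpoly"
  let ?const = "Poly_Mapping.map puiseux_const :: ('n, complex) mpoly \<Rightarrow> ('n, puiseux) mpoly"
  define B where "B = ?ext 0 ` C"
  have const_ext: "?const (?ext 0 f) = f" if "f \<in> C" for f
  proof (rule poly_mapping_eqI)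
    fix \<alpha>
    obtain r :: real where "coeff f \<alpha> = puiseux_const (complex_of_real r)" using C(1) \<open>f \<in> C\<close> by blast
    then show "coeff (?const (?ext 0 f)) \<alpha> = coeff f \<alpha>"
      by (simp add: coeff_map puiseux_nth_0 puiseux_const.hom_zero puiseux_const.rep_eq)
  qed
  then have "?const ` B = C" by (force simp: B_def image_image)
  then have I: "I = ideal.span (?const ` B)" using C(2) by simp
  have real: "coeff b \<alpha> \<in> \<real>" if bB: "b \<in> B" for b \<alpha>
  proof -
    obtain f where f: "f \<in> C" "b = ?ext 0 f" using bB unfolding B_def by blast
    obtain r :: real where "coeff f \<alpha> = puiseux_const (complex_of_real r)" using C(1) f(1) by blast
    then show ?thesis by (simp add: f(2) coeff_map puiseux_nth_0 puiseux_const.rep_eq)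
  qed
  have ext: "?ext q f \<in> ideal.span B" if "f \<in> I" for f q
    using that unfolding I
  proof (induction rule: ideal.span_induct_alt)
    case base
    then show ?case by (simp add: map_zero_mpoly puiseux_nth_0 ideal.span_zero)
  next
    case (step c x y)
    then obtain b where b: "b \<in> B" "x = ?const b" by blast
    have "?ext q (c * x + y) = ?ext q c * b + ?ext q y"
      unfolding b(2) by (simp add: map_add_mpoly puiseux_nth_0 puiseux_nth_add puiseux_nth_map_mult)
    then show ?case
      using step(2) b(1) by (simp add: ideal.span_add ideal.span_scale ideal.span_base)
  qed
  have "?const f \<in> I" if "f \<in> ideal.span B" for f
    using that
  proof (induction rule: ideal.span_induct_alt)
    case base
    then show ?case by (simp add: map_zero_mpoly puiseux_const.hom_zero I ideal.span_zero)
  next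
    case (step c x y)
    then have "?const x \<in> I" unfolding I by (intro ideal.span_base) simp
    with step(2) show ?case
      unfolding I by (simp add: map_add_mpoly puiseux_const.hom_add puiseux_const.hom_zero
          puiseux_const.map_mult ideal.span_add ideal.span_scale)
  qed
  moreover have "f \<in> ideal.span B" if "?const f \<in> I" for f
    using ext[OF that, of 0] by (simp add: puiseux_nth_map_const)
  ultimately have "constant_part I = ideal.span B" unfolding constant_part_def by blast
  with real I ext show thesis using that by metis
qed

lemma homogeneous_ideal_restrict:
  fixes I :: "('n::finite, 'c::comm_ring_1) mpoly set"
  assumes "homogeneous_ideal I" "f \<in> I"
  shows "restrict_mpoly {\<alpha>. total_degree \<alpha> = d} f \<in> I"
proof -
  obtain B where B: "\<And>b. b \<in> B \<Longrightarrow> homogeneous b" "I = ideal.span B"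
    using assms(1) unfolding homogeneous_ideal_def by blast
  have "restrict_mpoly {\<alpha>. total_degree \<alpha> = d} f \<in> ideal.span B"
  proof (rule restrict_mpoly_in_span[where E = "\<lambda>\<alpha> \<beta>. total_degree \<alpha> = total_degree \<beta>"])
    show "total_degree \<alpha> = total_degree \<beta>"
      if "b \<in> B" "\<alpha> \<in> Poly_Mapping.keys b" "\<beta> \<in> Poly_Mapping.keys b" for b \<alpha> \<beta>
      using B(1)[OF that(1)] that(2,3) unfolding homogeneous_def total_degree_def by metis
    show "f \<in> ideal.span B" using assms(2) B(2) by simp
  qed (simp_all add: total_degree_add)
  then show ?thesis unfolding B(2) .
qed

lemma constant_part_restrict:
  fixes I :: "('n::finite, puiseux) mpoly set"
  assumes "homogeneous_ideal I" "f \<in> constant_part I"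
  shows "restrict_mpoly {\<alpha>. total_degree \<alpha> = d} f \<in> constant_part I"
proof -
  have "Poly_Mapping.map puiseux_const (restrict_mpoly {\<alpha>. total_degree \<alpha> = d} f)
      = restrict_mpoly {\<alpha>. total_degree \<alpha> = d} (Poly_Mapping.map puiseux_const f)"
    by (rule poly_mapping_eqI) (simp add: coeff_map coeff_restrict_mpoly puiseux_const.hom_zero)
  then show ?thesis
    using homogeneous_ideal_restrict[OF assms(1)] assms(2) by (simp add: constant_part_def)
qed

section \<open>Initial forms as leading parts of constant polynomials\<close>

lemma coeff_initial_form:
  "coeff (initial_form w f) \<alpha> =
    (if \<alpha> \<in> Poly_Mapping.keys f \<and> (\<forall>\<beta>\<in>Poly_Mapping.keys f. trop_weight w f \<beta> \<le> trop_weight w f \<alpha>)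
     then puiseux_lc (coeff f \<alpha>) else 0)"
  by (simp add: initial_form_def lookup_sum lookup_single when_def puiseux_residue_normalized)

lemma puiseux_val_const: "c \<noteq> 0 \<Longrightarrow> puiseux_val (puiseux_const c) = 0"
  and puiseux_lc_const: "c \<noteq> 0 \<Longrightarrow> puiseux_lc (puiseux_const c) = c"
  using puiseux_leadsD[OF puiseux_leads_const] by auto

text \<open>Nonzero constants have valuation 0, so \<open>trop_weight\<close> reduces to
  \<open>weight\<close> and the initial form of a constant polynomial is its part of maximal weight.
  If \<open>a\<close> is not attained, the part is 0.\<close>

lemma top_part_in_initial_ideal:
  assumes f: "f \<in> constant_part I" and le: "\<And>\<kappa>. \<kappa> \<in> Poly_Mapping.keys f \<Longrightarrow> weight w \<kappa> \<le> a"
  shows "restrict_mpoly {\<kappa>. weight w \<kappa> = a} f \<in> initial_ideal w I"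
proof (cases "restrict_mpoly {\<kappa>. weight w \<kappa> = a} f = 0")
  case False
  then have "Poly_Mapping.keys (restrict_mpoly {\<kappa>. weight w \<kappa> = a} f) \<noteq> {}" by simp
  then obtain \<kappa> where \<kappa>: "\<kappa> \<in> Poly_Mapping.keys f" "weight w \<kappa> = a"
    unfolding keys_restrict_mpoly by blast
  let ?f = "Poly_Mapping.map puiseux_const f"
  have c: "coeff ?f \<alpha> = puiseux_const (coeff f \<alpha>)" for \<alpha>
    by (simp add: coeff_map puiseux_const.hom_zero)
  have "puiseux_const z = 0 \<longleftrightarrow> z = 0" for z
    using puiseux_leads_const[of z] puiseux_leads_0D puiseux_const.hom_zero by metis
  then have k: "Poly_Mapping.keys ?f = Poly_Mapping.keys f"
    unfolding set_eq_iff in_keys_iff c by blast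
  have t: "trop_weight w ?f \<alpha> = weight w \<alpha>" if "\<alpha> \<in> Poly_Mapping.keys f" for \<alpha>
    using that by (simp add: trop_weight_def c puiseux_val_const in_keys_iff)
  have "initial_form w ?f = restrict_mpoly {\<kappa>. weight w \<kappa> = a} f"
  proof (rule poly_mapping_eqI)
    fix \<alpha>
    have "(\<alpha> \<in> Poly_Mapping.keys f \<and> (\<forall>\<beta>\<in>Poly_Mapping.keys f. weight w \<beta> \<le> weight w \<alpha>))
        \<longleftrightarrow> \<alpha> \<in> Poly_Mapping.keys f \<and> weight w \<alpha> = a"
      using \<kappa> le by force
    then show "coeff (initial_form w ?f) \<alpha> = coeff (restrict_mpoly {\<kappa>. weight w \<kappa> = a} f) \<alpha>"
      by (auto simp: coeff_initial_form coeff_restrict_mpoly k t c in_keys_iff puiseux_lc_const)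
  qed
  moreover have "initial_form w ?f \<in> initial_ideal w I"
    unfolding initial_ideal_def using f by (intro ideal.span_base) (simp add: constant_part_def)
  ultimately show ?thesis by simp
qed (simp add: initial_ideal_def ideal.span_zero)

text \<open>A converse to \<open>top_part_in_initial_ideal\<close>. The terms of weight
  \<open>a\<close> and degree \<open>d\<close> in an initial form share one valuation
  \<open>q\<close>; the coefficient of \<open>t\<close> to the power \<open>q\<close> in the
  polynomial, cut down to degree \<open>d\<close>, is the constant lift.\<close>

lemma lift_component:
  fixes I :: "('n::finite, puiseux) mpoly set"
  assumes hom: "homogeneous_ideal I" and real: "generated_by_real_polys I"
    and p: "p \<in> initial_ideal w I"
  shows "\<exists>f\<in>constant_part I. (\<forall>\<kappa>\<in>Poly_Mapping.keys f. total_degree \<kappa> = d \<and> weight w \<kappa> \<le> a)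
    \<and> (\<forall>\<kappa>. weight w \<kappa> = a \<and> total_degree \<kappa> = d \<longrightarrow> coeff f \<kappa> = coeff p \<kappa>)"
proof -
  obtain B where B: "constant_part I = ideal.span B"
    and ext: "\<And>f q. f \<in> I \<Longrightarrow> Poly_Mapping.map (\<lambda>x. puiseux_nth x q) f \<in> constant_part I"
    using real_generators[OF real] by metis
  \<comment> \<open>All \<open>a\<close> and \<open>d\<close> are quantified because multiplication
    by a monomial shifts both. Closure of \<open>P\<close> under sums and monomial multiples reduces
    the claim to initial forms.\<close>
  define P where "P = (\<lambda>p. \<forall>a d. \<exists>f\<in>constant_part I.
    (\<forall>\<kappa>\<in>Poly_Mapping.keys f. total_degree \<kappa> = d \<and> weight w \<kappa> \<le> a)
    \<and> (\<forall>\<kappa>. weight w \<kappa> = a \<and> total_degree \<kappa> = d \<longrightarrow> coeff f \<kappa> = coeff p \<kappa>))"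
  have P_0: "P 0" unfolding P_def
    by (intro allI bexI[of _ 0]) (simp_all add: B ideal.span_zero)
  have P_add: "P (p + q)" if pq: "P p" "P q" for p q
    unfolding P_def
  proof (intro allI)
    fix a d
    obtain f where f: "f \<in> constant_part I"
      "\<And>\<kappa>. \<kappa> \<in> Poly_Mapping.keys f \<Longrightarrow> total_degree \<kappa> = d \<and> weight w \<kappa> \<le> a"
      "\<And>\<kappa>. weight w \<kappa> = a \<and> total_degree \<kappa> = d \<Longrightarrow> coeff f \<kappa> = coeff p \<kappa>"
      using pq(1) unfolding P_def by metis
    obtain g where g: "g \<in> constant_part I"
      "\<And>\<kappa>. \<kappa> \<in> Poly_Mapping.keys g \<Longrightarrow> total_degree \<kappa> = d \<and> weight w \<kappa> \<le> a"
      "\<And>\<kappa>. weight w \<kappa> = a \<and> total_degree \<kappa> = d \<Longrightarrow> coeff g \<kappa> = coeff q \<kappa>"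
      using pq(2) unfolding P_def by metis
    have "f + g \<in> constant_part I" using f(1) g(1) by (simp add: B ideal.span_add)
    then show "\<exists>f\<in>constant_part I. (\<forall>\<kappa>\<in>Poly_Mapping.keys f. total_degree \<kappa> = d \<and> weight w \<kappa> \<le> a)
      \<and> (\<forall>\<kappa>. weight w \<kappa> = a \<and> total_degree \<kappa> = d \<longrightarrow> coeff f \<kappa> = coeff (p + q) \<kappa>)"
      using f(2,3) g(2,3) keys_add[of f g] by (intro bexI[of _ "f + g"]) (auto simp: lookup_add)
  qed
  have P_mon: "P (mon \<gamma> e * p)" if Pp: "P p" for \<gamma> e p
    unfolding P_def
  proof (intro allI)
    fix a d
    show "\<exists>f\<in>constant_part I. (\<forall>\<kappa>\<in>Poly_Mapping.keys f. total_degree \<kappa> = d \<and> weight w \<kappa> \<le> a)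
      \<and> (\<forall>\<kappa>. weight w \<kappa> = a \<and> total_degree \<kappa> = d \<longrightarrow> coeff f \<kappa> = coeff (mon \<gamma> e * p) \<kappa>)"
    \<comment> \<open>Guards the natural subtraction; if the degree of \<open>\<gamma>\<close>
      exceeds \<open>d\<close>, the product has no term of degree \<open>d\<close> and 0 is a
      lift.\<close>
    proof (cases "total_degree \<gamma> \<le> d")
      case True
      obtain f where f: "f \<in> constant_part I"
        "\<And>\<kappa>. \<kappa> \<in> Poly_Mapping.keys f \<Longrightarrow>
          total_degree \<kappa> = d - total_degree \<gamma> \<and> weight w \<kappa> \<le> a - weight w \<gamma>"
        "\<And>\<kappa>. weight w \<kappa> = a - weight w \<gamma> \<and> total_degree \<kappa> = d - total_degree \<gamma> \<Longrightarrow>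
          coeff f \<kappa> = coeff p \<kappa>"
        using Pp unfolding P_def by metis
      have "mon \<gamma> e * f \<in> constant_part I" using f(1) by (simp add: B ideal.span_scale)
      moreover have "total_degree \<kappa> = d \<and> weight w \<kappa> \<le> a" if "\<kappa> \<in> Poly_Mapping.keys (mon \<gamma> e * f)" for \<kappa>
      proof -
        obtain \<beta> where "\<kappa> = \<gamma> + \<beta>" "\<beta> \<in> Poly_Mapping.keys f" using \<open>\<kappa> \<in> _\<close> keys_mon_times[of \<gamma> e f] by blast
        then show ?thesis using f(2)[of \<beta>] True by (simp add: total_degree_add weight_add)
      qed
      moreover have "coeff (mon \<gamma> e * f) \<kappa> = coeff (mon \<gamma> e * p) \<kappa>"
        if "weight w \<kappa> = a" "total_degree \<kappa> = d" for \<kappa>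
      proof (cases "\<exists>\<beta>. \<kappa> = \<gamma> + \<beta>")
        case True
        then obtain \<beta> where \<beta>: "\<kappa> = \<gamma> + \<beta>" by blast
        show ?thesis
          unfolding \<beta> coeff_mon_times using f(3)[of \<beta>] that by (simp add: \<beta> total_degree_add weight_add)
      next
        case False
        then have "coeff (mon \<gamma> e * q) \<kappa> = 0" for q :: "('n, complex) mpoly"
          using keys_mon_times[of \<gamma> e q] by (metis imageE in_keys_iff subsetD)
        then show ?thesis by simp
      qed
      ultimately show ?thesis by blast
    next
      case False
      have "coeff (mon \<gamma> e * p) \<kappa> = 0" if "total_degree \<kappa> = d" for \<kappa>
      proof (rule ccontr)
        assume "coeff (mon \<gamma> e * p) \<kappa> \<noteq> 0"
        then obtain \<beta> where "\<kappa> = \<gamma> + \<beta>"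
          using keys_mon_times[of \<gamma> e p] by (metis imageE in_keys_iff subsetD)
        then show False using that False by (simp add: total_degree_add)
      qed
      then show ?thesis by (intro bexI[of _ 0]) (simp_all add: B ideal.span_zero)
    qed
  qed
  have P_initial: "P (initial_form w f)" if fI: "f \<in> I" for f
    unfolding P_def
  proof (intro allI)
    fix a d
    let ?p = "initial_form w f"
    show "\<exists>f\<in>constant_part I. (\<forall>\<kappa>\<in>Poly_Mapping.keys f. total_degree \<kappa> = d \<and> weight w \<kappa> \<le> a)
      \<and> (\<forall>\<kappa>. weight w \<kappa> = a \<and> total_degree \<kappa> = d \<longrightarrow> coeff f \<kappa> = coeff ?p \<kappa>)"
    proof (cases "\<exists>\<alpha>. weight w \<alpha> = a \<and> total_degree \<alpha> = d \<and> coeff ?p \<alpha> \<noteq> 0")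
      case True
      then obtain \<alpha> where \<alpha>: "weight w \<alpha> = a" "total_degree \<alpha> = d" "coeff ?p \<alpha> \<noteq> 0" by blast
      then have top: "\<alpha> \<in> Poly_Mapping.keys f"
        "\<And>\<beta>. \<beta> \<in> Poly_Mapping.keys f \<Longrightarrow> trop_weight w f \<beta> \<le> trop_weight w f \<alpha>"
        unfolding coeff_initial_form by (auto split: if_splits)
      define q where "q = puiseux_val (coeff f \<alpha>)"
      let ?e = "Poly_Mapping.map (\<lambda>x. puiseux_nth x q) f"
      let ?g = "restrict_mpoly {\<kappa>. total_degree \<kappa> = d} ?e"
      have e: "coeff ?e \<kappa> = puiseux_nth (coeff f \<kappa>) q" for \<kappa>
        by (simp add: coeff_map puiseux_nth_0)
      have topW: "trop_weight w f \<alpha> = a - real_of_rat q"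
        by (simp add: trop_weight_def \<alpha> q_def)
      \<comment> \<open>A term that survives the extraction has valuation at most \<open>q\<close>;
        as its tropical weight is at most \<open>a - q\<close>, its weight is at most
        \<open>a\<close>.\<close>
      have "total_degree \<kappa> = d \<and> weight w \<kappa> \<le> a" if "\<kappa> \<in> Poly_Mapping.keys ?g" for \<kappa>
      proof -
        from that have \<kappa>: "total_degree \<kappa> = d" "puiseux_nth (coeff f \<kappa>) q \<noteq> 0"
          by (auto simp: keys_restrict_mpoly in_keys_iff e)
        then have nz: "coeff f \<kappa> \<noteq> 0" by (auto simp: puiseux_nth_0)
        have "puiseux_val (coeff f \<kappa>) \<le> q" by (rule puiseux_val_least(2)[OF nz \<kappa>(2)])
        then have "real_of_rat (puiseux_val (coeff f \<kappa>)) \<le> real_of_rat q" by (simp add: of_rat_less_eq)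
        moreover have "trop_weight w f \<kappa> \<le> trop_weight w f \<alpha>"
          using nz by (intro top(2)) (simp add: in_keys_iff)
        ultimately show ?thesis using \<kappa>(1) topW by (simp add: trop_weight_def)
      qed
      moreover have "coeff ?g \<kappa> = coeff ?p \<kappa>" if \<kappa>: "weight w \<kappa> = a" "total_degree \<kappa> = d" for \<kappa>
      proof (cases "\<kappa> \<in> Poly_Mapping.keys f")
        case True
        have tw: "trop_weight w f \<kappa> = a - real_of_rat (puiseux_val (coeff f \<kappa>))"
          by (simp add: trop_weight_def \<kappa>)
        have le: "trop_weight w f \<kappa> \<le> trop_weight w f \<alpha>" by (rule top(2)[OF True])
        show ?thesis
        \<comment> \<open>With valuation \<open>q\<close>, \<open>\<kappa>\<close> is maximal and
          contributes its leading coefficient. Otherwise the valuation exceeds \<open>q\<close>, and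
          \<open>\<kappa>\<close> contributes neither to the extracted polynomial nor to the initial
          form.\<close>
        proof (cases "puiseux_val (coeff f \<kappa>) = q")
          case eq: True
          then have "\<forall>\<beta>\<in>Poly_Mapping.keys f. trop_weight w f \<beta> \<le> trop_weight w f \<kappa>"
            using top(2) tw topW by simp
          then show ?thesis
            using True eq \<kappa> by (simp add: coeff_restrict_mpoly e coeff_initial_form puiseux_lc_def)
        next
          case ne: False
          have lt: "q < puiseux_val (coeff f \<kappa>)"
            using le ne unfolding tw topW by (simp add: of_rat_less_eq)
          then have "puiseux_nth (coeff f \<kappa>) q = 0"
            using puiseux_val_least(2)[of "coeff f \<kappa>" q] True by (force simp: in_keys_iff)
          moreover have "trop_weight w f \<kappa> < trop_weight w f \<alpha>"
            using lt unfolding tw topW by (simp add: of_rat_less)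
          then have "\<not> (\<forall>\<beta>\<in>Poly_Mapping.keys f. trop_weight w f \<beta> \<le> trop_weight w f \<kappa>)"
            using top(1) by (auto simp: not_le)
          ultimately show ?thesis
            unfolding coeff_initial_form coeff_restrict_mpoly e by (auto simp only: if_cancel split: if_split)
        qed
      next
        case False
        then show ?thesis
          by (simp add: coeff_restrict_mpoly e coeff_initial_form in_keys_iff puiseux_nth_0)
      qed
      moreover have "?g \<in> constant_part I" by (rule constant_part_restrict[OF hom ext[OF fI]])
      ultimately show ?thesis by blast
    next
      case False
      then show ?thesis by (intro bexI[of _ 0]) (auto simp: B ideal.span_zero)
    qed
  qed
  have "P (h * initial_form w f)" if "f \<in> I" for h f
    by (induction h rule: mpoly_induct)
      (auto simp: distrib_right intro: P_0 P_add P_mon P_initial that)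
  note P_scale = this
  have "P p" using p unfolding initial_ideal_def
    by (induction rule: ideal.span_induct_alt) (auto intro: P_0 P_add P_scale)
  then show ?thesis unfolding P_def by blast
qed

section \<open>Signed permutations and positive points\<close>

definition permute_exponent :: "('n::finite \<Rightarrow> 'n) \<Rightarrow> ('n \<Rightarrow>\<^sub>0 nat) \<Rightarrow> 'n \<Rightarrow>\<^sub>0 nat" where
  "permute_exponent p \<alpha> = (\<Sum>i\<in>UNIV. Poly_Mapping.single (p i) (Poly_Mapping.lookup \<alpha> i))"

lemma lookup_permute_exponent:
  assumes "bij p"
  shows "Poly_Mapping.lookup (permute_exponent p \<alpha>) (p i) = Poly_Mapping.lookup \<alpha> i"
  using assms by (simp add: permute_exponent_def lookup_sum lookup_single when_def bij_is_inj inj_eq)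

lemma inj_permute_exponent:
  assumes "bij p"
  shows "inj (permute_exponent p)"
  by (rule injI, rule poly_mapping_eqI) (metis lookup_permute_exponent[OF assms])

text \<open>The sign picked up by a monomial is its value at the sign vector \<open>u\<close>, which
  is how \<open>mon_value\<close> comes to carry all sign conditions.\<close>

lemma signed_perm_eq_sum:
  fixes f :: "('n::finite, 'c::comm_ring_1) mpoly"
  shows "signed_perm p u f = (\<Sum>\<alpha>\<in>Poly_Mapping.keys f.
    mon (permute_exponent p \<alpha>) (coeff f \<alpha> * mon_value (\<lambda>i. of_int (u i)) \<alpha>))"
proof -
  have pow: "Var i ^ k = (mon (Poly_Mapping.single i k) 1 :: ('n, 'c) mpoly)" for i k
    by (induction k) (simp_all add: Var_def mult_single single_add[symmetric])
  have prod: "(\<Prod>i\<in>A. mon (e i) (1 :: 'c)) = mon (\<Sum>i\<in>A. e i) 1" if "finite A"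
    for A :: "'n set" and e :: "'n \<Rightarrow> 'n \<Rightarrow>\<^sub>0 nat"
    using that by (induction A rule: finite_induct) (simp_all add: mult_single)
  have const: "mon_value (\<lambda>i. of_int (u i)) \<alpha> = (mon 0 (mon_value (\<lambda>i. of_int (u i)) \<alpha>) :: ('n, 'c) mpoly)" for \<alpha>
  proof -
    interpret mon_0: coeff_hom "mon 0 :: 'c \<Rightarrow> ('n, 'c) mpoly"
      by unfold_locales (simp_all add: single_add mult_single)
    show ?thesis by (simp add: mon_0.hom_mon_value)
  qed
  have "mon_value (\<lambda>i. of_int (u i) * Var (p i)) \<alpha>
      = (mon (permute_exponent p \<alpha>) (mon_value (\<lambda>i. of_int (u i)) \<alpha>) :: ('n, 'c) mpoly)" for \<alpha>
  proof -
    have "mon_value (\<lambda>i. Var (p i)) \<alpha> = (mon (permute_exponent p \<alpha>) 1 :: ('n, 'c) mpoly)"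
      by (simp add: mon_value_def pow prod permute_exponent_def)
    then show ?thesis by (simp add: mon_value_mult const mult_single)
  qed
  then show ?thesis by (simp add: signed_perm_def subst_eq_sum mult_single)
qed

text \<open>Distinct monomials keep distinct images, and coefficients outside the image are 0,
  whence \<open>0 \<in> A\<close>. For the nonnegative and the nonpositive reals this moves the sign
  conditions from the permuted polynomial to the terms of \<open>f\<close> at
  \<open>u\<close>.\<close>

lemma coeffs_signed_perm_iff:
  fixes f :: "('n::finite, 'c::comm_ring_1) mpoly"
  assumes "bij p" "0 \<in> A"
  shows "(\<forall>\<beta>. coeff (signed_perm p u f) \<beta> \<in> A)
    \<longleftrightarrow> (\<forall>\<alpha>. coeff f \<alpha> * mon_value (\<lambda>i. of_int (u i)) \<alpha> \<in> A)"
proof -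
  have "coeff (signed_perm p u f) (permute_exponent p \<alpha>)
      = coeff f \<alpha> * mon_value (\<lambda>i. of_int (u i)) \<alpha>" for \<alpha>
    by (simp add: signed_perm_eq_sum lookup_sum lookup_single when_def in_keys_iff
        inj_eq[OF inj_permute_exponent[OF assms(1)]])
  moreover have "coeff (signed_perm p u f) \<beta> = 0" if "\<beta> \<notin> range (permute_exponent p)" for \<beta>
    using that by (auto simp: signed_perm_eq_sum lookup_sum lookup_single when_def intro!: sum.neutral)
  ultimately show ?thesis using assms(2) by (metis rangeE)
qed

lemma subst_signed_perm:
  fixes f :: "('n::finite, 'c::comm_ring_1) mpoly"
  shows "subst (\<lambda>c. c) z (signed_perm p u f) = subst (\<lambda>c. c) (\<lambda>i. of_int (u i) * z (p i)) f"
proof -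
  interpret z: coeff_hom "subst (\<lambda>c. c) z :: ('n, 'c) mpoly \<Rightarrow> 'c"
    by unfold_locales (simp_all add: id_hom.subst_add id_hom.subst_mult id_hom.subst_mon
        flip: single_one)
  have 1: "subst (\<lambda>c. c) z (mon 0 c) = c" for c
    by (simp add: id_hom.subst_mon)
  have "mon_value z (Poly_Mapping.single i 1) = z i" for i
    by (simp add: mon_value_def lookup_single when_def if_distrib if_distribR cong: if_cong)
  then have 2: "subst (\<lambda>c. c) z (of_int (u i) * Var (p i)) = of_int (u i) * z (p i)" for i
    using 1[of "of_int (u i)"] by (simp add: z.hom_mult Var_def id_hom.subst_mon)
  show ?thesis
    unfolding signed_perm_def subst_eq_sum[of "mon 0"] subst_eq_sum[of "\<lambda>c. c" _ f]
    by (simp add: z.hom_sum z.hom_mult 1 z.hom_mon_value 2[unfolded z.hom_mult])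
qed

text \<open>Trades positive points of \<open>V(I)\<close> for points with sign pattern
  \<open>u\<close>, so that afterwards only \<open>I\<close> and the unpermuted \<open>w\<close>
  have to be considered.\<close>

lemma variety_signed_perm:
  assumes "signed_perm p u ` I = I"
  shows "z \<in> variety I \<longleftrightarrow> (\<forall>f\<in>I. subst (\<lambda>c. c) (\<lambda>i. of_int (u i) * z $ p i) f = 0)"
proof -
  have "z \<in> variety I \<longleftrightarrow> (\<forall>f\<in>signed_perm p u ` I. subst (\<lambda>c. c) (($) z) f = 0)"
    unfolding assms by (simp add: variety_def)
  then show ?thesis by (simp add: subst_signed_perm)
qed

lemma subst_map_const:
  "subst (\<lambda>c. c) z (Poly_Mapping.map puiseux_const f) = subst puiseux_const z f"
proof -
  have "Poly_Mapping.keys (Poly_Mapping.map puiseux_const f) \<subseteq> Poly_Mapping.keys f"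
    by (rule keys_map_subset) (rule puiseux_const.hom_zero)
  then show ?thesis
    by (simp add: subst_eq_sum_superset[of "Poly_Mapping.keys f"] subst_eq_sum[of puiseux_const]
        coeff_map puiseux_const.hom_zero)
qed

section \<open>Obstruction to positivity from coefficients of one sign\<close>

lemma mon_value_of_real: "mon_value (\<lambda>i. of_real (r i)) \<alpha> = (of_real (mon_value r \<alpha>) :: complex)"
  by (simp add: mon_value_def)

text \<open>A component of \<open>g\<close> lifts to a constant \<open>f\<close> in
  \<open>I\<close>. At a zero with sign pattern \<open>u\<close> that tropicalizes near
  \<open>w\<close>, the terms of lowest order in \<open>f\<close> all come from that component and
  have one sign, so they cannot cancel.\<close>

lemma initial_ideal_not_sign_coherent:
  fixes I :: "('n::finite, puiseux) mpoly set"
  assumes hom: "homogeneous_ideal I" and real: "generated_by_real_polys I"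
    and inv: "signed_perm p u ` I = I" and p: "bij p" and u: "\<And>i. u i \<in> {1, -1}"
    and pos: "perm_vec p w \<in> Trop_pos I"
    and g: "g \<in> initial_ideal w I" "g \<noteq> 0"
    and sign: "\<And>\<alpha>. coeff g \<alpha> * mon_value (\<lambda>i. of_int (u i)) \<alpha> \<in> \<real>\<^sub>\<ge>\<^sub>0"
  shows False
proof -
  obtain \<kappa>0 where \<kappa>0: "\<kappa>0 \<in> Poly_Mapping.keys g"
    using g(2) by (metis keys_eq_empty ex_in_conv)
  define a where "a = weight w \<kappa>0"
  obtain f where f: "f \<in> constant_part I"
    "\<And>\<kappa>. \<kappa> \<in> Poly_Mapping.keys f \<Longrightarrow> total_degree \<kappa> = total_degree \<kappa>0 \<and> weight w \<kappa> \<le> a"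
    "\<And>\<kappa>. weight w \<kappa> = a \<and> total_degree \<kappa> = total_degree \<kappa>0 \<Longrightarrow> coeff f \<kappa> = coeff g \<kappa>"
    using lift_component[OF hom real g(1), of "total_degree \<kappa>0" a] by metis
  \<comment> \<open>\<open>W v\<close> is the weight of \<open>v\<close> pulled back along
    \<open>p\<close>. Only finitely many strict inequalities between such weights go into
    \<open>U\<close>, so they persist near the permuted \<open>w\<close>.\<close>
  define W where "W = (\<lambda>(v :: real ^ 'n) \<kappa>. \<Sum>i\<in>UNIV. v $ p i * real (Poly_Mapping.lookup \<kappa> i))"
  define U where "U = (\<Inter>\<kappa>\<in>{\<kappa>\<in>Poly_Mapping.keys f. weight w \<kappa> < a}. {v. W v \<kappa> < W v \<kappa>0})"
  have "open {v. W v \<kappa> < W v \<kappa>0}" for \<kappa>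
    unfolding W_def by (intro open_Collect_less continuous_intros)
  then have "open U" unfolding U_def by (intro open_INT) auto
  moreover have "W (perm_vec p w) \<kappa> = weight w \<kappa>" for \<kappa>
    by (simp add: W_def weight_def perm_vec_nth[OF p])
  then have "perm_vec p w \<in> U" by (simp add: U_def a_def)
  moreover obtain S where S: "S = (\<lambda>z. \<chi> i. - real_of_rat (puiseux_val (z $ i)))
      ` (variety I \<inter> {z. \<forall>i. z $ i \<in> R_pos})" by blast
  ultimately have "U \<inter> S \<noteq> {}"
    using pos open_Int_closure_eq_empty[of U S] unfolding Trop_pos_def S by blast
  then obtain z :: "puiseux ^ 'n" where z: "z \<in> variety I" "\<And>i. z $ i \<in> R_pos"
    "(\<chi> i. - real_of_rat (puiseux_val (z $ i))) \<in> U" unfolding S by blast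
  \<comment> \<open>\<open>x\<close> is the zero with sign pattern \<open>u\<close>,
    \<open>lc\<close> gives the moduli of its leading coefficients, and \<open>q \<kappa>\<close> is
    the order of \<open>mon_value x \<kappa>\<close>.\<close>
  define lc where "lc = (\<lambda>i. Re (puiseux_lc (z $ p i)))"
  define q where "q = (\<lambda>\<kappa>. \<Sum>i\<in>UNIV. of_nat (Poly_Mapping.lookup \<kappa> i) * puiseux_val (z $ p i))"
  define x where "x = (\<lambda>i. of_int (u i) * z $ p i)"
  have lc: "lc i > 0" "puiseux_lc (z $ p i) = complex_of_real (lc i)" for i
    using z(2)[of "p i"] by (auto simp: R_pos_def lc_def complex_is_Real_iff complex_eq_iff)
  have q_less: "q \<kappa>0 < q \<kappa>" if "\<kappa> \<in> Poly_Mapping.keys f" "weight w \<kappa> < a" for \<kappa>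
  proof -
    have "W (\<chi> i. - real_of_rat (puiseux_val (z $ i))) \<kappa>' = - real_of_rat (q \<kappa>')" for \<kappa>'
      by (simp add: W_def q_def of_rat_sum of_rat_mult sum_negf mult.commute)
    then have "- real_of_rat (q \<kappa>) < - real_of_rat (q \<kappa>0)"
      using z(3) that unfolding U_def by auto
    then show ?thesis by (simp add: of_rat_less)
  qed
  have x_leads: "puiseux_leads (puiseux_val (z $ p i)) (of_int (u i) * complex_of_real (lc i)) (x i)" for i
  proof -
    have "z $ p i \<noteq> 0" using z(2)[of "p i"] by (simp add: R_pos_def)
    from puiseux_leads_val_lc[OF this] show ?thesis
      using u[of i] lc(2)[of i] puiseux_leads_mult[OF puiseux_leads_const[of "- 1"]]
      by (fastforce simp: x_def puiseux_const.hom_uminus puiseux_const.hom_one)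
  qed
  \<comment> \<open>The terms of top weight may have different orders at \<open>x\<close>, which
    only tropicalizes near \<open>w\<close>; those of least order \<open>m\<close> decide.
    \<open>c\<close> collects the coefficients at order \<open>m\<close>.\<close>
  define K where "K = {\<kappa> \<in> Poly_Mapping.keys f. weight w \<kappa> = a}"
  define m where "m = Min (q ` K)"
  define c where "c = (\<lambda>\<kappa>. if q \<kappa> = m then
    coeff f \<kappa> * mon_value (\<lambda>i. of_int (u i) * complex_of_real (lc i)) \<kappa> else 0)"
  have "\<kappa>0 \<in> K" using \<kappa>0 f(3)[of \<kappa>0] by (simp add: K_def a_def in_keys_iff)
  moreover have "finite K" by (simp add: K_def)
  ultimately have m: "m \<in> q ` K" "\<And>\<kappa>. \<kappa> \<in> K \<Longrightarrow> m \<le> q \<kappa>" "m \<le> q \<kappa>0"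
    unfolding m_def by (auto intro!: Min_in)
  have m_less: "m < q \<kappa>" if "\<kappa> \<in> Poly_Mapping.keys f" "\<kappa> \<notin> K" for \<kappa>
    using q_less[of \<kappa>] f(2)[of \<kappa>] that m(3) by (force simp: K_def)
  have "puiseux_leads m (c \<kappa>) (puiseux_const (coeff f \<kappa>) * mon_value x \<kappa>)"
    if "\<kappa> \<in> Poly_Mapping.keys f" for \<kappa>
  proof -
    have l: "puiseux_leads (q \<kappa>) (coeff f \<kappa> * mon_value (\<lambda>i. of_int (u i) * complex_of_real (lc i)) \<kappa>)
        (puiseux_const (coeff f \<kappa>) * mon_value x \<kappa>)"
      using puiseux_leads_mult[OF puiseux_leads_const puiseux_leads_mon_value[OF x_leads]]
      by (simp add: q_def)
    have "m \<le> q \<kappa>" using m(2) m_less[OF that] by fastforce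
    then show ?thesis using l puiseux_leads_less[OF l] by (auto simp: c_def)
  qed
  then have "puiseux_leads m (\<Sum>\<kappa>\<in>Poly_Mapping.keys f. c \<kappa>) (subst puiseux_const x f)"
    unfolding subst_eq_sum by (intro puiseux_leads_sum)
  moreover have "subst puiseux_const x f = 0"
    using f(1) z(1) unfolding variety_signed_perm[OF inv] constant_part_def x_def
    by (simp flip: subst_map_const)
  ultimately have sum_0: "(\<Sum>\<kappa>\<in>Poly_Mapping.keys f. c \<kappa>) = 0"
    using puiseux_leads_0D by metis
  have c_pos: "Re (c \<kappa>) > 0" if "\<kappa> \<in> K" "q \<kappa> = m" for \<kappa>
  proof -
    have \<kappa>: "\<kappa> \<in> Poly_Mapping.keys f" "coeff f \<kappa> = coeff g \<kappa>"
      using that(1) f(2,3)[of \<kappa>] by (auto simp: K_def)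
    define s where "s = coeff g \<kappa> * mon_value (\<lambda>i. of_int (u i)) \<kappa>"
    have "mon_value (\<lambda>i. of_int (u i) :: complex) \<kappa> \<noteq> 0"
      using u by (intro mon_value_nonzero) (metis insertE of_int_0_eq_iff singletonD zero_neq_neg_one zero_neq_one)
    then have "s \<noteq> 0" using \<kappa> by (simp add: s_def in_keys_iff)
    moreover have "s \<in> \<real>\<^sub>\<ge>\<^sub>0" unfolding s_def by (rule sign)
    ultimately have "Re s > 0" by (auto simp: complex_nonneg_Reals_iff complex_eq_iff)
    moreover have "mon_value lc \<kappa> > 0" using lc(1) by (simp add: mon_value_def prod_pos)
    moreover have "c \<kappa> = s * of_real (mon_value lc \<kappa>)"
      using that(2) by (simp add: c_def s_def \<kappa>(2) mon_value_mult mon_value_of_real mult.assoc)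
    ultimately show ?thesis by simp
  qed
  have c_nonneg: "Re (c \<kappa>) \<ge> 0" if "\<kappa> \<in> Poly_Mapping.keys f" for \<kappa>
    using c_pos[of \<kappa>] m_less[OF that] by (cases "\<kappa> \<in> K"; cases "q \<kappa> = m") (auto simp: c_def)
  obtain \<kappa>1 where \<kappa>1: "\<kappa>1 \<in> K" "q \<kappa>1 = m" using m(1) by blast
  have "0 < (\<Sum>\<kappa>\<in>Poly_Mapping.keys f. Re (c \<kappa>))"
    using \<kappa>1 c_pos[OF \<kappa>1] c_nonneg by (intro sum_pos2[of _ \<kappa>1]) (auto simp: K_def)
  then show False using sum_0 by (simp flip: Re_sum)
qed

section \<open>Integer linear algebra\<close>

text \<open>Gaussian elimination, one row at a time. The dual basis \<open>d\<close> is a right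
  inverse of the independent rows \<open>R\<close> and later solves linear systems over the reals
  and over the complex numbers; \<open>r\<close> records the dependencies.\<close>

lemma dual_basis_exists:
  fixes m :: "'a \<Rightarrow> 'n::finite \<Rightarrow> rat"
  assumes "finite A"
  shows "\<exists>R d r. R \<subseteq> A
    \<and> (\<forall>i\<in>R. \<forall>j\<in>R. (\<Sum>l\<in>UNIV. m i l * d j l) = (if i = j then 1 else 0))
    \<and> (\<forall>i\<in>A. \<forall>l. m i l = (\<Sum>j\<in>R. r i j * m j l))"
  using assms
proof (induction A rule: finite_induct)
  case empty
  then show ?case by simp
next
  case (insert a A)
  from insert.IH obtain R d r where R: "R \<subseteq> A"
    and d': "\<forall>i\<in>R. \<forall>j\<in>R. (\<Sum>l\<in>UNIV. m i l * d j l) = (if i = j then 1 else 0)"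
    and r': "\<forall>i\<in>A. \<forall>l. m i l = (\<Sum>j\<in>R. r i j * m j l)"
    by (elim exE conjE)
  have d: "(\<Sum>l\<in>UNIV. m i l * d j l) = (if i = j then 1 else 0)" if "i \<in> R" "j \<in> R" for i j
    using d' that by blast
  have r: "m i l = (\<Sum>j\<in>R. r i j * m j l)" if "i \<in> A" for i l
    using r' that by blast
  have fin: "finite R" and a: "a \<notin> R" using R insert.hyps finite_subset by auto
  define s where "s = (\<lambda>j. \<Sum>l\<in>UNIV. m a l * d j l)"
  \<comment> \<open>What is left of the new row after its expansion along \<open>R\<close>; if it
    vanishes, \<open>a\<close> is dependent and \<open>R\<close> stays as it is.\<close>
  define m' where "m' = (\<lambda>l. m a l - (\<Sum>j\<in>R. s j * m j l))"
  show ?case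
  proof (cases "\<forall>l. m' l = 0")
    case True
    then have "m a l = (\<Sum>j\<in>R. s j * m j l)" for l unfolding m'_def by (metis eq_iff_diff_eq_0)
    then have "\<forall>i\<in>insert a A. \<forall>l. m i l = (\<Sum>j\<in>R. (if i = a then s else r i) j * m j l)"
      using r insert.hyps by auto
    then show ?thesis
      using R d by (intro exI[of _ R] exI[of _ d] exI[of _ "\<lambda>i. if i = a then s else r i"]) blast
  next
    case False
    then obtain l0 where l0: "m' l0 \<noteq> 0" by blast
    \<comment> \<open>The unit vector at \<open>l0\<close>, made orthogonal to the rows in
      \<open>R\<close> and scaled to pair to 1 with row \<open>a\<close>.\<close>
    define e where "e = (\<lambda>l. ((if l = l0 then 1 else 0) - (\<Sum>j\<in>R. m j l0 * d j l)) / m' l0)"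
    have pair: "(\<Sum>l\<in>UNIV. x l * e l)
        = (x l0 - (\<Sum>j\<in>R. m j l0 * (\<Sum>l\<in>UNIV. x l * d j l))) / m' l0" for x
    proof -
      have "(\<Sum>l\<in>UNIV. x l * e l) = (\<Sum>l\<in>UNIV. (x l * (if l = l0 then 1 else 0)
          - (\<Sum>j\<in>R. m j l0 * (x l * d j l))) / m' l0)"
        by (simp add: e_def right_diff_distrib sum_distrib_left mult.left_commute)
      also have "\<dots> = (x l0 - (\<Sum>l\<in>UNIV. \<Sum>j\<in>R. m j l0 * (x l * d j l))) / m' l0"
        by (simp only: sum_subtractf flip: sum_divide_distrib) (simp add: if_distrib cong: if_cong)
      also have "(\<Sum>l\<in>UNIV. \<Sum>j\<in>R. m j l0 * (x l * d j l))
          = (\<Sum>j\<in>R. m j l0 * (\<Sum>l\<in>UNIV. x l * d j l))"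
        by (subst sum.swap) (simp add: sum_distrib_left)
      finally show ?thesis .
    qed
    have e_R: "(\<Sum>l\<in>UNIV. m i l * e l) = 0" if "i \<in> R" for i
      using that fin by (simp add: pair d if_distrib cong: if_cong)
    have e_a: "(\<Sum>l\<in>UNIV. m a l * e l) = 1"
    proof -
      have "(\<Sum>l\<in>UNIV. m a l * d j l) = s j" for j by (simp add: s_def)
      then have "(\<Sum>l\<in>UNIV. m a l * e l) = (m a l0 - (\<Sum>j\<in>R. m j l0 * s j)) / m' l0"
        by (simp only: pair)
      also have "\<dots> = m' l0 / m' l0" by (simp add: m'_def mult.commute)
      finally have "(\<Sum>l\<in>UNIV. m a l * e l) = m' l0 / m' l0" .
      then show ?thesis using l0 by simp
    qed
    \<comment> \<open>The old dual vectors are corrected by multiples of \<open>e\<close> so that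
      they pair to 0 with row \<open>a\<close>.\<close>
    define d' where "d' = (\<lambda>j l. if j = a then e l else d j l - s j * e l)"
    have "(\<Sum>l\<in>UNIV. m i l * d' j l) = (if i = j then 1 else 0)"
      if "i \<in> insert a R" "j \<in> insert a R" for i j
    proof (cases "j = a")
      case True
      then show ?thesis using that e_R e_a by (auto simp: d'_def)
    next
      case False
      then have "(\<Sum>l\<in>UNIV. m i l * d' j l)
          = (\<Sum>l\<in>UNIV. m i l * d j l) - s j * (\<Sum>l\<in>UNIV. m i l * e l)"
        by (simp add: d'_def right_diff_distrib sum_subtractf sum_distrib_left mult.left_commute)
      then show ?thesis using that False d e_R e_a a by (auto simp: s_def)
    qed
    moreover define t where "t = (\<lambda>i j. if i = a then of_bool (j = a) else if j = a then 0 else r i j)"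
    have "m i l = (\<Sum>j\<in>insert a R. t i j * m j l)"
      if "i \<in> insert a A" for i l
    proof (cases "i = a")
      case True
      have "(\<Sum>j\<in>R. of_bool (j = a) * m j l) = 0" using a by (intro sum.neutral) auto
      then show ?thesis using True fin a by (simp add: t_def)
    next
      case False
      have "(\<Sum>j\<in>R. (if j = a then 0 else r i j) * m j l) = (\<Sum>j\<in>R. r i j * m j l)"
        using a by (intro sum.cong) auto
      then show ?thesis using False fin a r that by (simp add: t_def)
    qed
    moreover have "insert a R \<subseteq> insert a A" using R by blast
    ultimately show ?thesis
      by (intro exI[of _ "insert a R"] exI[of _ d'] exI[of _ t]) blast
  qed
qed

lemma common_denominator:
  fixes r :: "'a \<Rightarrow> rat"
  assumes "finite A"
  shows "\<exists>k>0::nat. \<forall>j\<in>A. of_nat k * r j \<in> \<int>"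
  using assms
proof (induction A rule: finite_induct)
  case empty
  then show ?case by auto
next
  case (insert a A)
  then obtain k where k: "k > 0" "\<And>j. j \<in> A \<Longrightarrow> of_nat k * r j \<in> \<int>" by blast
  obtain x y where xy: "quotient_of (r a) = (x, y)" by fastforce
  then have y: "y > 0" "r a = of_int x / of_int y"
    using quotient_of_denom_pos quotient_of_div by auto
  have "of_nat (k * nat y) * r j \<in> \<int>" if "j \<in> insert a A" for j
  proof (cases "j = a")
    case True
    have "of_nat (k * nat y) * r a = of_int (int k * x)" using y by simp
    then show ?thesis using True by (metis Ints_of_int)
  next
    case False
    then have "of_nat k * r j \<in> \<int>" using that k(2) by blast
    from Ints_mult[OF Ints_of_nat this]
    have "of_nat (nat y) * (of_nat k * r j) \<in> \<int>" .
    then show ?thesis by (simp add: mult_ac)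
  qed
  then show ?case using k(1) y(1) by (intro exI[of _ "k * nat y"]) auto
qed

section \<open>Rational approximation of weights\<close>

lemma simultaneous_approximation:
  fixes w :: "real ^ 'n::finite"
  assumes "\<epsilon> > 0"
  obtains N :: nat and V :: "'n \<Rightarrow> int"
  where "N > 0" "\<And>i. \<bar>real N * w $ i - of_int (V i)\<bar> < \<epsilon>"
proof -
  obtain M :: nat where M: "M > 0" "inverse (real M) < \<epsilon>" by (metis reals_Archimedean[OF assms] zero_less_Suc)
  obtain e :: "'n \<Rightarrow> nat" where e: "bij_betw e UNIV {..<CARD('n)}"
    using ex_bij_betw_finite_nat[of "UNIV :: 'n set"] by (auto simp: atLeast0LessThan)
  obtain q v where q: "0 < q" and v: "\<And>i. i < CARD('n) \<Longrightarrow>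
      \<bar>of_int q * (w $ inv_into UNIV e i) - of_int (v i)\<bar> < 1 / M"
    using Dirichlet_approx_simult[OF M(1), of "CARD('n)" "\<lambda>i. w $ inv_into UNIV e i"] by metis
  have "\<bar>real (nat q) * w $ i - of_int (v (e i))\<bar> < \<epsilon>" for i
  proof -
    have "e i < CARD('n)" "inv_into UNIV e (e i) = i"
      using e by (auto simp: bij_betw_def)
    then show ?thesis using v[of "e i"] M(2) q by (simp add: inverse_eq_divide)
  qed
  then show thesis using that[of "nat q" "\<lambda>i. v (e i)"] q by simp
qed

text \<open>Dirichlet approximation brings \<open>real N * w\<close> itself, not only
  \<open>w\<close>, close to an integral vector. Equal weights become integers differing by less
  than 1, hence equal, while the finitely many gaps between distinct weights survive.\<close>

lemma order_preserving_approximation: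
  fixes w :: "real ^ 'n::finite"
  assumes "finite E" "\<epsilon> > 0"
  obtains N :: nat and V :: "real ^ 'n"
  where "N > 0" "\<And>i. V $ i \<in> \<int>" "\<And>i. \<bar>real N * w $ i - V $ i\<bar> < \<epsilon>"
    "\<And>\<kappa> \<kappa>'. \<kappa> \<in> E \<Longrightarrow> \<kappa>' \<in> E \<Longrightarrow> weight w \<kappa> = weight w \<kappa>' \<Longrightarrow> weight V \<kappa> = weight V \<kappa>'"
    "\<And>\<kappa> \<kappa>'. \<kappa> \<in> E \<Longrightarrow> \<kappa>' \<in> E \<Longrightarrow> weight w \<kappa> < weight w \<kappa>' \<Longrightarrow> weight V \<kappa> < weight V \<kappa>'"
proof -
  \<comment> \<open>\<open>\<delta>\<close> bounds the gaps between distinct weights on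
    \<open>E\<close> from below; inserting 1 makes \<open>T\<close> nonempty and
    \<open>\<delta>\<close> at most 1, as the integrality argument requires.\<close>
  define T where "T = insert 1 ((\<lambda>(\<kappa>, \<kappa>'). weight w \<kappa>' - weight w \<kappa>) `
    {(\<kappa>, \<kappa>') \<in> E \<times> E. weight w \<kappa> < weight w \<kappa>'})"
  define \<delta> where "\<delta> = Min T"
  have "finite {(\<kappa>, \<kappa>') \<in> E \<times> E. weight w \<kappa> < weight w \<kappa>'}"
    by (rule finite_subset[of _ "E \<times> E"]) (use assms(1) in auto)
  then have finT: "finite T" unfolding T_def by (intro finite.insertI finite_imageI)
  then have "\<delta> \<in> T" unfolding \<delta>_def by (intro Min_in) (auto simp: T_def)
  then have \<delta>: "\<delta> > 0" "\<delta> \<le> 1" using finT by (auto simp: T_def \<delta>_def)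
  have \<delta>_le: "\<delta> \<le> weight w \<kappa>' - weight w \<kappa>" if "\<kappa> \<in> E" "\<kappa>' \<in> E" "weight w \<kappa> < weight w \<kappa>'" for \<kappa> \<kappa>'
    unfolding \<delta>_def using finT that by (intro Min_le) (auto simp: T_def)
  \<comment> \<open>Bounds the exponent sums on \<open>E\<close>, so that an error of
    \<open>\<epsilon>'\<close> per coordinate costs each weight less than
    \<open>\<delta> / 2\<close>; the summand 1 keeps \<open>C\<close> positive.\<close>
  define C where "C = 1 + (\<Sum>\<kappa>\<in>E. \<Sum>i\<in>UNIV. real (Poly_Mapping.lookup \<kappa> i))"
  have C: "C > 0" unfolding C_def by (intro add_pos_nonneg sum_nonneg) auto
  define \<epsilon>' where "\<epsilon>' = min \<epsilon> (\<delta> / (2 * C))"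
  have "\<epsilon>' > 0" using assms(2) \<delta> C by (simp add: \<epsilon>'_def)
  then obtain N and v :: "'n \<Rightarrow> int" where N: "N > 0"
    and v: "\<And>i. \<bar>real N * w $ i - of_int (v i)\<bar> < \<epsilon>'"
    using simultaneous_approximation by metis
  define V :: "real ^ 'n" where "V = (\<chi> i. of_int (v i))"
  have diff: "2 * \<bar>real N * weight w \<kappa> - weight V \<kappa>\<bar> < \<delta>" if "\<kappa> \<in> E" for \<kappa>
  proof -
    have "\<bar>real N * weight w \<kappa> - weight V \<kappa>\<bar>
        = \<bar>\<Sum>i\<in>UNIV. (real N * w $ i - V $ i) * real (Poly_Mapping.lookup \<kappa> i)\<bar>"
      by (simp add: weight_def sum_distrib_left left_diff_distrib sum_subtractf mult.assoc)
    also have "\<dots> \<le> (\<Sum>i\<in>UNIV. \<bar>(real N * w $ i - V $ i) * real (Poly_Mapping.lookup \<kappa> i)\<bar>)"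
      by (rule sum_abs)
    also have "\<dots> \<le> (\<Sum>i\<in>UNIV. \<epsilon>' * real (Poly_Mapping.lookup \<kappa> i))"
      using v by (intro sum_mono) (simp add: abs_mult V_def mult_right_mono less_imp_le)
    also have "\<dots> \<le> \<epsilon>' * (\<Sum>i\<in>UNIV. real (Poly_Mapping.lookup \<kappa> i))"
      by (simp add: sum_distrib_left)
    also have "\<dots> \<le> \<epsilon>' * (\<Sum>\<kappa>\<in>E. \<Sum>i\<in>UNIV. real (Poly_Mapping.lookup \<kappa> i))"
      using member_le_sum[OF that _ assms(1), of "\<lambda>\<kappa>. \<Sum>i\<in>UNIV. real (Poly_Mapping.lookup \<kappa> i)"]
        \<open>\<epsilon>' > 0\<close> by (intro mult_left_mono) (auto simp: sum_nonneg)
    also have "\<dots> < \<epsilon>' * C" using \<open>\<epsilon>' > 0\<close> by (simp add: C_def)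
    also have "\<dots> \<le> \<delta> / (2 * C) * C" using C by (intro mult_right_mono) (auto simp: \<epsilon>'_def)
    also have "\<dots> = \<delta> / 2" using C by simp
    finally show ?thesis by simp
  qed
  have close: "\<bar>y - x - (b - a)\<bar> < \<delta>" if "2 * \<bar>a - x\<bar> < \<delta>" "2 * \<bar>b - y\<bar> < \<delta>" for a b x y :: real
    using that by (auto simp: abs_if split: if_splits)
  have "weight V \<kappa> = weight V \<kappa>'" if "\<kappa> \<in> E" "\<kappa>' \<in> E" "weight w \<kappa> = weight w \<kappa>'" for \<kappa> \<kappa>'
  proof -
    have "\<bar>weight V \<kappa> - weight V \<kappa>'\<bar> < 1"
      using close[OF diff[OF that(2)] diff[OF that(1)]] \<delta>(2) that(3) by simp
    moreover define s where "s = (\<lambda>\<kappa>. \<Sum>i\<in>UNIV. v i * int (Poly_Mapping.lookup \<kappa> i))"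
    have s: "weight V \<kappa> = of_int (s \<kappa>)" for \<kappa>
      by (simp add: weight_def V_def s_def)
    ultimately have "\<bar>s \<kappa> - s \<kappa>'\<bar> < 1" unfolding s by linarith
    then show ?thesis unfolding s by simp
  qed
  moreover have "weight V \<kappa> < weight V \<kappa>'" if "\<kappa> \<in> E" "\<kappa>' \<in> E" "weight w \<kappa> < weight w \<kappa>'" for \<kappa> \<kappa>'
  proof -
    have "1 * (weight w \<kappa>' - weight w \<kappa>) \<le> real N * (weight w \<kappa>' - weight w \<kappa>)"
      using N that(3) by (intro mult_right_mono) auto
    then have "\<delta> \<le> real N * weight w \<kappa>' - real N * weight w \<kappa>"
      using \<delta>_le[OF that] by (simp add: right_diff_distrib)
    then show ?thesis using close[OF diff[OF that(1)] diff[OF that(2)]] by linarith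
  qed
  moreover have "\<bar>real N * w $ i - V $ i\<bar> < \<epsilon>" for i
    using v[of i] by (simp add: V_def \<epsilon>'_def)
  moreover have "V $ i \<in> \<int>" for i by (simp add: V_def)
  ultimately show thesis using that N by blast
qed

section \<open>Lifting binomial generators of an initial ideal\<close>

text \<open>Multiplication by a bihomogeneous \<open>g\<close> shifts weight and degree. The shift
  is written additively since degrees are natural numbers.\<close>

lemma restrict_mpoly_mult_homogeneous:
  fixes g :: "('n::finite, 'c::comm_ring_1) mpoly"
  assumes "\<And>\<kappa>. \<kappa> \<in> Poly_Mapping.keys g \<Longrightarrow> weight w \<kappa> = b \<and> total_degree \<kappa> = e"
  shows "restrict_mpoly {\<kappa>. weight w \<kappa> = a \<and> total_degree \<kappa> = d} (r * g)
    = restrict_mpoly {\<gamma>. weight w \<gamma> + b = a \<and> total_degree \<gamma> + e = d} r * g"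
proof (induction r rule: mpoly_induct)
  case (mon \<gamma> x)
  let ?X = "{\<kappa>. weight w \<kappa> = a \<and> total_degree \<kappa> = d}"
  let ?Y = "{\<gamma>. weight w \<gamma> + b = a \<and> total_degree \<gamma> + e = d}"
  have in_X: "\<kappa> \<in> ?X \<longleftrightarrow> \<gamma> \<in> ?Y" if "\<kappa> \<in> Poly_Mapping.keys (mon \<gamma> x * g)" for \<kappa>
    using that keys_mon_times[of \<gamma> x g] assms by (auto simp: weight_add total_degree_add)
  show ?case
  proof (cases "\<gamma> \<in> ?Y")
    case True
    then have "Poly_Mapping.keys (mon \<gamma> x * g) \<subseteq> ?X" using in_X by blast
    moreover have "Poly_Mapping.keys (mon \<gamma> x) \<subseteq> ?Y" using True by simp
    ultimately show ?thesis by (simp only: restrict_mpoly_ident)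
  next
    case False
    then have "Poly_Mapping.keys (mon \<gamma> x * g) \<inter> ?X = {}" using in_X by blast
    moreover have "Poly_Mapping.keys (mon \<gamma> x) \<inter> ?Y = {}" using False by simp
    ultimately show ?thesis by (simp only: restrict_mpoly_disjoint mult_zero_left)
  qed
qed (simp_all add: restrict_mpoly_add distrib_right)

lemma mon_power: "mon \<alpha> c ^ k = mon (\<Sum>j<k. \<alpha>) (c ^ k :: 'c::comm_ring_1)"
  by (induction k) (simp_all add: mult_single add.commute)

text \<open>To be applied with the constant part of \<open>I\<close> as \<open>I0\<close>.
  \<open>F g\<close> extends the binomial \<open>g\<close> by terms of lower weight, and
  \<open>top\<close> places all leading parts of \<open>I0\<close> in \<open>ideal.span G\<close>,
  so the \<open>F g\<close> form a standard basis for the filtration by weight.\<close>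

locale binomial_lift =
  fixes I0 :: "('n::finite, complex) mpoly set" and w :: "real ^ 'n"
    and G :: "('n, complex) mpoly set" and \<alpha> \<beta> :: "('n, complex) mpoly \<Rightarrow> 'n \<Rightarrow>\<^sub>0 nat"
    and c :: "('n, complex) mpoly \<Rightarrow> complex"
    and F :: "('n, complex) mpoly \<Rightarrow> ('n, complex) mpoly"
  assumes ideal: "ideal.subspace I0"
    and fin: "finite G"
    and G_eq: "g \<in> G \<Longrightarrow> g = mon (\<alpha> g) 1 - mon (\<beta> g) (c g)"
    and c_nz: "g \<in> G \<Longrightarrow> c g \<noteq> 0"
    and weight_eq: "g \<in> G \<Longrightarrow> weight w (\<beta> g) = weight w (\<alpha> g)"
    and degree_eq: "g \<in> G \<Longrightarrow> total_degree (\<beta> g) = total_degree (\<alpha> g)"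
    and F_in: "g \<in> G \<Longrightarrow> F g \<in> I0"
    and rest: "g \<in> G \<Longrightarrow> \<kappa> \<in> Poly_Mapping.keys (F g - g) \<Longrightarrow>
      total_degree \<kappa> = total_degree (\<alpha> g) \<and> weight w \<kappa> < weight w (\<alpha> g)"
    and top: "f \<in> I0 \<Longrightarrow> (\<And>\<kappa>. \<kappa> \<in> Poly_Mapping.keys f \<Longrightarrow> weight w \<kappa> \<le> a) \<Longrightarrow>
      restrict_mpoly {\<kappa>. weight w \<kappa> = a} f \<in> ideal.span G"
    and no_mon: "mon \<kappa> 1 \<notin> ideal.span G"
begin

lemma keys_G:
  assumes "g \<in> G" "\<kappa> \<in> Poly_Mapping.keys g"
  shows "weight w \<kappa> = weight w (\<alpha> g) \<and> total_degree \<kappa> = total_degree (\<alpha> g)"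
proof -
  have "\<kappa> \<in> Poly_Mapping.keys (mon (\<alpha> g) 1 - mon (\<beta> g) (c g))"
    using assms(2) by (subst G_eq[OF assms(1), symmetric])
  then have "\<kappa> = \<alpha> g \<or> \<kappa> = \<beta> g"
    using keys_diff[of "mon (\<alpha> g) 1" "mon (\<beta> g) (c g)"] by (auto split: if_splits)
  then show ?thesis using weight_eq degree_eq assms(1) by auto
qed

text \<open>Since the elements of \<open>G\<close> are bihomogeneous, the coefficients of any
  representation may be cut down to the matching weight and degree.\<close>

lemma homogeneous_combination:
  assumes R: "R \<subseteq> G" and p: "p \<in> ideal.span R"
    and keys: "\<And>\<kappa>. \<kappa> \<in> Poly_Mapping.keys p \<Longrightarrow> weight w \<kappa> = a \<and> total_degree \<kappa> = d"
  shows "\<exists>q. p = (\<Sum>g\<in>R. q g * g) \<and> (\<forall>g\<in>R. \<forall>\<gamma>\<in>Poly_Mapping.keys (q g).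
    weight w \<gamma> + weight w (\<alpha> g) = a \<and> total_degree \<gamma> + total_degree (\<alpha> g) = d)"
proof -
  have "finite R" using R fin finite_subset by blast
  then obtain r where r: "p = (\<Sum>g\<in>R. r g * g)" using p ideal.span_finite[of R] by blast
  define q where "q = (\<lambda>g. restrict_mpoly {\<gamma>. weight w \<gamma> + weight w (\<alpha> g) = a
    \<and> total_degree \<gamma> + total_degree (\<alpha> g) = d} (r g))"
  have "p = restrict_mpoly {\<kappa>. weight w \<kappa> = a \<and> total_degree \<kappa> = d} p"
    using keys by (intro restrict_mpoly_ident[symmetric]) blast
  also have "\<dots> = (\<Sum>g\<in>R. restrict_mpoly {\<kappa>. weight w \<kappa> = a \<and> total_degree \<kappa> = d} (r g * g))"
    by (subst r) (rule restrict_mpoly_sum)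
  also have "\<dots> = (\<Sum>g\<in>R. q g * g)"
    unfolding q_def using R keys_G
    by (intro sum.cong refl restrict_mpoly_mult_homogeneous) blast
  finally show ?thesis
    by (intro exI[of _ q]) (auto simp: q_def keys_restrict_mpoly)
qed

text \<open>Division by the lifts: the top part of \<open>f\<close> is a combination of
  \<open>G\<close>, and subtracting the same combination of the lifts leaves lower weights. The
  induction counts the monomials of degree \<open>d\<close> below the weight bound.\<close>

lemma standard_representation:
  assumes "f \<in> I0" "\<And>\<kappa>. \<kappa> \<in> Poly_Mapping.keys f \<Longrightarrow> total_degree \<kappa> = d \<and> weight w \<kappa> < a"
  shows "\<exists>q. f = (\<Sum>g\<in>G. q g * F g) \<and>
    (\<forall>g\<in>G. \<forall>\<gamma>\<in>Poly_Mapping.keys (q g). weight w \<gamma> + weight w (\<alpha> g) < a)"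
  using assms
proof (induction "card {\<kappa>::'n \<Rightarrow>\<^sub>0 nat. total_degree \<kappa> = d \<and> weight w \<kappa> < a}" arbitrary: f a rule: less_induct)
  case less
  show ?case
  proof (cases "f = 0")
    case True
    then show ?thesis by (intro exI[of _ "\<lambda>_. 0"]) simp
  next
    case False
    then have ne: "Poly_Mapping.keys f \<noteq> {}" by simp
    define a' where "a' = Max (weight w ` Poly_Mapping.keys f)"
    have "a' \<in> weight w ` Poly_Mapping.keys f" unfolding a'_def using ne by (intro Max_in) auto
    then obtain \<kappa>0 where \<kappa>0: "\<kappa>0 \<in> Poly_Mapping.keys f" "weight w \<kappa>0 = a'" by blast
    have le: "weight w \<kappa> \<le> a'" if "\<kappa> \<in> Poly_Mapping.keys f" for \<kappa>
      unfolding a'_def using that by (intro Max_ge) auto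
    have a': "a' < a" using less.prems(2)[OF \<kappa>0(1)] \<kappa>0(2) by simp
    define p where "p = restrict_mpoly {\<kappa>. weight w \<kappa> = a'} f"
    have p_in: "p \<in> ideal.span G" unfolding p_def by (rule top[OF less.prems(1) le])
    have p_keys: "weight w \<kappa> = a' \<and> total_degree \<kappa> = d" if "\<kappa> \<in> Poly_Mapping.keys p" for \<kappa>
      using that less.prems(2) by (auto simp: p_def keys_restrict_mpoly)
    obtain q where q: "p = (\<Sum>g\<in>G. q g * g)"
      "\<forall>g\<in>G. \<forall>\<gamma>\<in>Poly_Mapping.keys (q g).
        weight w \<gamma> + weight w (\<alpha> g) = a' \<and> total_degree \<gamma> + total_degree (\<alpha> g) = d"
      using homogeneous_combination[OF subset_refl p_in p_keys] by blast
    define f' where "f' = f - (\<Sum>g\<in>G. q g * F g)"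
    have "f' \<in> I0" unfolding f'_def
      by (intro ideal.subspace_diff[OF ideal less.prems(1)] ideal.subspace_sum[OF ideal]
          ideal.subspace_scale[OF ideal] F_in)
    moreover have "total_degree \<kappa> = d \<and> weight w \<kappa> < a'" if \<kappa>: "\<kappa> \<in> Poly_Mapping.keys f'" for \<kappa>
    proof -
      \<comment> \<open>Splits \<open>f'\<close> into what \<open>f\<close> has below its top part
        and the tails of the lifts, both of weight below \<open>a'\<close>.\<close>
      have "f' = (f - p) - (\<Sum>g\<in>G. q g * (F g - g))"
        by (simp add: f'_def q(1) right_diff_distrib sum_subtractf)
      then have "\<kappa> \<in> Poly_Mapping.keys (f - p) \<or> \<kappa> \<in> Poly_Mapping.keys (\<Sum>g\<in>G. q g * (F g - g))"
        using \<kappa> keys_diff[of "f - p" "\<Sum>g\<in>G. q g * (F g - g)"] by auto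
      then show ?thesis
      proof
        assume "\<kappa> \<in> Poly_Mapping.keys (f - p)"
        then have "\<kappa> \<in> Poly_Mapping.keys f" "weight w \<kappa> \<noteq> a'"
          by (auto simp: in_keys_iff lookup_minus p_def coeff_restrict_mpoly split: if_splits)
        then show ?thesis using le[of \<kappa>] less.prems(2)[of \<kappa>] by simp
      next
        assume "\<kappa> \<in> Poly_Mapping.keys (\<Sum>g\<in>G. q g * (F g - g))"
        then obtain g where g: "g \<in> G" "\<kappa> \<in> Poly_Mapping.keys (q g * (F g - g))"
          using keys_sum[of "\<lambda>g. q g * (F g - g)" G] by blast
        then obtain \<gamma> \<delta> where "\<kappa> = \<gamma> + \<delta>" "\<gamma> \<in> Poly_Mapping.keys (q g)" "\<delta> \<in> Poly_Mapping.keys (F g - g)"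
          using keys_mult[of "q g" "F g - g"] by blast
        then show ?thesis using bspec[OF q(2) g(1)] rest[OF g(1), of \<delta>]
          by (fastforce simp: weight_add total_degree_add)
      qed
    qed
    \<comment> \<open>\<open>\<kappa>0\<close> has weight \<open>a'\<close> and is counted on the
      right only.\<close>
    moreover have "card {\<kappa>::'n \<Rightarrow>\<^sub>0 nat. total_degree \<kappa> = d \<and> weight w \<kappa> < a'}
        < card {\<kappa>::'n \<Rightarrow>\<^sub>0 nat. total_degree \<kappa> = d \<and> weight w \<kappa> < a}"
    proof (rule psubset_card_mono)
      show "finite {\<kappa>::'n \<Rightarrow>\<^sub>0 nat. total_degree \<kappa> = d \<and> weight w \<kappa> < a}"
        by (rule finite_subset[OF _ finite_total_degree[of d]]) blast
      show "{\<kappa>::'n \<Rightarrow>\<^sub>0 nat. total_degree \<kappa> = d \<and> weight w \<kappa> < a'}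
          \<subset> {\<kappa>::'n \<Rightarrow>\<^sub>0 nat. total_degree \<kappa> = d \<and> weight w \<kappa> < a}"
        using a' \<kappa>0 less.prems(2)[OF \<kappa>0(1)] by force
    qed
    ultimately obtain q' where q': "f' = (\<Sum>g\<in>G. q' g * F g)"
      "\<forall>g\<in>G. \<forall>\<gamma>\<in>Poly_Mapping.keys (q' g). weight w \<gamma> + weight w (\<alpha> g) < a'"
      using less.hyps[of a' f'] by blast
    have "f = f' + (\<Sum>g\<in>G. q g * F g)" by (simp add: f'_def)
    then have "f = (\<Sum>g\<in>G. (q' g + q g) * F g)"
      unfolding q'(1) by (simp add: distrib_right sum.distrib)
    moreover have "weight w \<gamma> + weight w (\<alpha> g) < a"
      if g: "g \<in> G" and \<gamma>: "\<gamma> \<in> Poly_Mapping.keys (q' g + q g)" for g \<gamma>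
      using \<gamma> keys_add[of "q' g" "q g"] q'(2) bspec[OF q(2) g] g a' by fastforce
    ultimately show ?thesis by (intro exI[of _ "\<lambda>g. q' g + q g"]) blast
  qed
qed

section \<open>Laurent binomials modulo an ideal\<close>

definition exponent_diff :: "('n, complex) mpoly \<Rightarrow> 'n \<Rightarrow> int" where
  "exponent_diff g l = int (Poly_Mapping.lookup (\<alpha> g) l) - int (Poly_Mapping.lookup (\<beta> g) l)"

text \<open>
  Modulo the ideal generated by \<open>R\<close>, and up to multiplication by a monomial, the Laurent monomial
  with exponent vector \<open>m\<close> equals the constant \<open>C\<close>.
\<close>

definition laurent_relation :: "('n, complex) mpoly set \<Rightarrow> ('n \<Rightarrow> int) \<Rightarrow> complex \<Rightarrow> bool" where
  "laurent_relation R m C \<longleftrightarrow> (\<exists>\<kappa> \<kappa>'.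
    (\<forall>l. int (Poly_Mapping.lookup \<kappa> l) - int (Poly_Mapping.lookup \<kappa>' l) = m l)
    \<and> mon \<kappa> 1 - mon \<kappa>' C \<in> ideal.span R)"

lemma laurent_relation_base:
  assumes "g \<in> R" "R \<subseteq> G"
  shows "laurent_relation R (exponent_diff g) (c g)"
proof -
  have "g \<in> G" using assms by blast
  from ideal.span_base[OF assms(1)] have "mon (\<alpha> g) 1 - mon (\<beta> g) (c g) \<in> ideal.span R"
    unfolding G_eq[OF \<open>g \<in> G\<close>, symmetric] .
  then show ?thesis unfolding laurent_relation_def exponent_diff_def by blast
qed

lemma laurent_relation_zero: "laurent_relation R (\<lambda>_. 0) 1"
  unfolding laurent_relation_def by (intro exI[of _ 0]) (simp add: ideal.span_zero)

lemma laurent_relation_add: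
  assumes "laurent_relation R m C" "laurent_relation R m' C'"
  shows "laurent_relation R (\<lambda>l. m l + m' l) (C * C')"
proof -
  obtain \<kappa>1 \<kappa>2 where 1: "\<And>l. int (Poly_Mapping.lookup \<kappa>1 l) - int (Poly_Mapping.lookup \<kappa>2 l) = m l"
    "mon \<kappa>1 1 - mon \<kappa>2 C \<in> ideal.span R" using assms(1) unfolding laurent_relation_def by blast
  obtain \<kappa>3 \<kappa>4 where 2: "\<And>l. int (Poly_Mapping.lookup \<kappa>3 l) - int (Poly_Mapping.lookup \<kappa>4 l) = m' l"
    "mon \<kappa>3 1 - mon \<kappa>4 C' \<in> ideal.span R" using assms(2) unfolding laurent_relation_def by blast
  \<comment> \<open>Telescoping: the product of two congruences with denominators cleared.\<close>
  have "mon \<kappa>3 1 * (mon \<kappa>1 1 - mon \<kappa>2 C) + mon \<kappa>2 C * (mon \<kappa>3 1 - mon \<kappa>4 C')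
      = mon (\<kappa>1 + \<kappa>3) 1 - mon (\<kappa>2 + \<kappa>4) (C * C')"
    by (simp add: right_diff_distrib mult_single add.commute)
  moreover have "mon \<kappa>3 1 * (mon \<kappa>1 1 - mon \<kappa>2 C) + mon \<kappa>2 C * (mon \<kappa>3 1 - mon \<kappa>4 C') \<in> ideal.span R"
    by (intro ideal.span_add ideal.span_scale 1(2) 2(2))
  moreover have "int (Poly_Mapping.lookup (\<kappa>1 + \<kappa>3) l) - int (Poly_Mapping.lookup (\<kappa>2 + \<kappa>4) l) = m l + m' l" for l
    using 1(1)[of l] 2(1)[of l] by (simp add: lookup_add)
  ultimately show ?thesis unfolding laurent_relation_def by metis
qed

lemma laurent_relation_uminus:
  assumes "laurent_relation R m C" "C \<noteq> 0"
  shows "laurent_relation R (\<lambda>l. - m l) (inverse C)"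
proof -
  obtain \<kappa> \<kappa>' where 1: "\<And>l. int (Poly_Mapping.lookup \<kappa> l) - int (Poly_Mapping.lookup \<kappa>' l) = m l"
    "mon \<kappa> 1 - mon \<kappa>' C \<in> ideal.span R" using assms(1) unfolding laurent_relation_def by blast
  have "mon 0 (- inverse C) * (mon \<kappa> 1 - mon \<kappa>' C) = mon \<kappa>' 1 - mon \<kappa> (inverse C)"
    using assms(2) by (simp add: right_diff_distrib mult_single single_uminus)
  moreover have "mon 0 (- inverse C) * (mon \<kappa> 1 - mon \<kappa>' C) \<in> ideal.span R"
    by (intro ideal.span_scale 1(2))
  moreover have "int (Poly_Mapping.lookup \<kappa>' l) - int (Poly_Mapping.lookup \<kappa> l) = - m l" for l
    using 1(1)[of l] by simp
  ultimately show ?thesis unfolding laurent_relation_def by metis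
qed

lemma laurent_relation_scale:
  assumes "laurent_relation R m C" "C \<noteq> 0"
  shows "laurent_relation R (\<lambda>l. k * m l) (C powi k)"
proof -
  have nat: "laurent_relation R (\<lambda>l. int n * m l) (C ^ n)" for n
  proof (induction n)
    case (Suc n)
    then show ?case using laurent_relation_add[OF assms(1) Suc] by (simp add: algebra_simps)
  qed (simp add: laurent_relation_zero)
  show ?thesis
  proof (cases "k \<ge> 0")
    case True
    then show ?thesis using nat[of "nat k"] by (simp add: power_int_def)
  next
    case False
    then show ?thesis using laurent_relation_uminus[OF nat[of "nat (- k)"]] assms(2)
      by (simp add: power_int_def power_inverse)
  qed
qed

lemma laurent_relation_sum:
  assumes "finite A" "\<And>j. j \<in> A \<Longrightarrow> laurent_relation R (m j) (C j)"
  shows "laurent_relation R (\<lambda>l. \<Sum>j\<in>A. m j l) (\<Prod>j\<in>A. C j)"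
  using assms
  by (induction A rule: finite_induct) (auto simp: laurent_relation_zero intro: laurent_relation_add)

text \<open>For the Laurent monomial \<open>X\<close> that is 1 exactly where \<open>g\<close>
  vanishes on the torus, this is the factor \<open>X - 1\<close> of \<open>X ^ k - 1\<close>;
  \<open>u\<close> is the cofactor with denominators cleared. The functions \<open>\<phi>\<close>
  will be the weight \<open>w\<close>, the degree, and the weight of an integral approximation of
  \<open>w\<close>.\<close>

lemma unit_multiple_in_span:
  assumes R: "R \<subseteq> G" and g: "g \<in> G" and k: "k > 0"
    and rel: "laurent_relation R (\<lambda>l. int k * exponent_diff g l) C"
  shows "C = c g ^ k"
    and "\<exists>u \<delta>. u * g \<in> ideal.span R
      \<and> (\<forall>\<gamma>\<in>Poly_Mapping.keys u. \<forall>\<phi> :: ('n \<Rightarrow>\<^sub>0 nat) \<Rightarrow> real. (\<forall>\<kappa> \<kappa>'. \<phi> (\<kappa> + \<kappa>') = \<phi> \<kappa> + \<phi> \<kappa>')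
          \<longrightarrow> \<phi> (\<alpha> g) = \<phi> (\<beta> g) \<longrightarrow> \<phi> \<gamma> = \<phi> \<delta>)
      \<and> (\<forall>y. (\<forall>i. y i \<noteq> 0) \<longrightarrow> mon_value y (\<alpha> g) = c g * mon_value y (\<beta> g) \<longrightarrow> subst (\<lambda>x. x) y u \<noteq> 0)"
proof -
  obtain \<kappa> \<kappa>' where \<kappa>: "\<And>l. int (Poly_Mapping.lookup \<kappa> l) - int (Poly_Mapping.lookup \<kappa>' l)
      = int k * exponent_diff g l" "mon \<kappa> 1 - mon \<kappa>' C \<in> ideal.span R"
    using rel unfolding laurent_relation_def by blast
  let ?A = "\<Sum>j<k. \<alpha> g" and ?B = "\<Sum>j<k. \<beta> g"
  let ?x = "mon (\<alpha> g) 1 :: ('n, complex) mpoly" and ?y = "mon (\<beta> g) (c g)"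
  have xy: "g = ?x - ?y" by (rule G_eq[OF g])
  have pow: "?x ^ k = mon ?A 1" "?y ^ k = mon ?B (c g ^ k)" by (simp_all add: mon_power)
  \<comment> \<open>Both sides clear denominators in \<open>k\<close> times the exponent difference
    of \<open>g\<close>.\<close>
  have exp: "\<kappa> + ?B = \<kappa>' + ?A"
  proof (rule poly_mapping_eqI)
    fix l
    have "int (Poly_Mapping.lookup (\<kappa> + ?B) l) = int (Poly_Mapping.lookup (\<kappa>' + ?A) l)"
      using \<kappa>(1)[of l] by (simp add: exponent_diff_def lookup_add lookup_sum algebra_simps)
    then show "Poly_Mapping.lookup (\<kappa> + ?B) l = Poly_Mapping.lookup (\<kappa>' + ?A) l" by simp
  qed
  have R_rel: "mon (\<kappa>' + ?A) 1 - mon (\<kappa>' + ?B) C \<in> ideal.span R"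
    using ideal.span_scale[OF \<kappa>(2), of "mon ?B 1"]
    by (simp add: right_diff_distrib mult_single exp[symmetric] add.commute)
  define u where "u = mon \<kappa>' 1 * (\<Sum>l<k. ?y ^ (k - Suc l) * ?x ^ l)"
  have ug: "u * g = mon (\<kappa>' + ?A) 1 - mon (\<kappa>' + ?B) (c g ^ k)"
  proof -
    have "u * g = mon \<kappa>' 1 * ((?x - ?y) * (\<Sum>l<k. ?y ^ (k - Suc l) * ?x ^ l))"
      by (subst xy) (simp add: u_def mult_ac)
    also have "\<dots> = mon \<kappa>' 1 * (?x ^ k - ?y ^ k)" by (simp only: power_diff_sumr2)
    finally show ?thesis unfolding pow by (simp add: right_diff_distrib mult_single)
  qed
  \<comment> \<open>Otherwise two binomials in \<open>ideal.span G\<close> with the same first term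
    would differ by a nonzero multiple of a monomial.\<close>
  show C: "C = c g ^ k"
  proof (rule ccontr)
    assume ne: "C \<noteq> c g ^ k"
    have "mon (\<kappa>' + ?A) 1 - mon (\<kappa>' + ?B) C \<in> ideal.span G"
      using R_rel ideal.span_mono[OF R] by blast
    moreover have "u * g \<in> ideal.span G" by (intro ideal.span_scale ideal.span_base g)
    ultimately have "mon (\<kappa>' + ?A) 1 - mon (\<kappa>' + ?B) C - u * g \<in> ideal.span G"
      by (rule ideal.span_diff)
    then have "mon 0 (inverse (c g ^ k - C)) * (mon (\<kappa>' + ?A) 1 - mon (\<kappa>' + ?B) C - u * g) \<in> ideal.span G"
      by (rule ideal.span_scale)
    moreover have "mon (\<kappa>' + ?A) 1 - mon (\<kappa>' + ?B) C - u * g = mon (\<kappa>' + ?B) (c g ^ k - C)"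
      unfolding ug by (simp add: single_diff)
    ultimately have "mon (\<kappa>' + ?B) 1 \<in> ideal.span G" using ne by (simp add: mult_single)
    then show False using no_mon by blast
  qed
  \<comment> \<open>The exponent of the last summand of \<open>u\<close>, at
    \<open>l = k - 1\<close>.\<close>
  let ?\<delta> = "\<kappa>' + (\<Sum>j<k - 1. \<alpha> g)"
  have "u * g \<in> ideal.span R" using R_rel unfolding ug C .
  moreover have "\<phi> \<gamma> = \<phi> ?\<delta>" if \<gamma>: "\<gamma> \<in> Poly_Mapping.keys u"
    and \<phi>: "\<forall>\<kappa> \<kappa>'. \<phi> (\<kappa> + \<kappa>') = \<phi> \<kappa> + \<phi> \<kappa>'" "\<phi> (\<alpha> g) = \<phi> (\<beta> g)"
    for \<gamma> and \<phi> :: "('n \<Rightarrow>\<^sub>0 nat) \<Rightarrow> real"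
  proof -
    have "\<phi> (0 + 0) = \<phi> 0 + \<phi> 0" using \<phi>(1) by blast
    then have \<phi>0: "\<phi> 0 = 0" by simp
    have \<phi>_sum: "\<phi> (\<Sum>j<n. \<kappa>) = real n * \<phi> \<kappa>" for n \<kappa>
      by (induction n) (simp_all add: \<phi>0 \<phi>(1) algebra_simps)
    have "u = (\<Sum>l<k. mon (\<kappa>' + ((\<Sum>j<k - Suc l. \<beta> g) + (\<Sum>j<l. \<alpha> g))) (c g ^ (k - Suc l)))"
      by (simp add: u_def sum_distrib_left mon_power mult_single)
    then obtain l where "l < k" "\<gamma> = \<kappa>' + ((\<Sum>j<k - Suc l. \<beta> g) + (\<Sum>j<l. \<alpha> g))"
      using \<gamma> keys_sum[of "\<lambda>l. mon (\<kappa>' + ((\<Sum>j<k - Suc l. \<beta> g) + (\<Sum>j<l. \<alpha> g))) (c g ^ (k - Suc l))" "{..<k}"]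
      by (auto split: if_splits)
    moreover from this(1) have "real (k - Suc l) + real l = real (k - 1)" by simp
    ultimately show ?thesis
      by (simp only: \<phi>(1) \<phi>_sum \<phi>(2)[symmetric] distrib_right[symmetric])
  qed
  moreover have "subst (\<lambda>x. x) y u \<noteq> 0" if y: "\<And>i. y i \<noteq> 0"
    and eq: "mon_value y (\<alpha> g) = c g * mon_value y (\<beta> g)" for y
  proof -
    interpret ev: coeff_hom "subst (\<lambda>c. c) y :: ('n, complex) mpoly \<Rightarrow> complex"
      by unfold_locales (simp_all add: id_hom.subst_add id_hom.subst_mult id_hom.subst_mon
          flip: single_one)
    have "subst (\<lambda>x. x) y u = mon_value y \<kappa>' * (\<Sum>l<k. mon_value y (\<alpha> g) ^ (k - Suc l) * mon_value y (\<alpha> g) ^ l)"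
      unfolding u_def by (simp add: ev.hom_mult ev.hom_sum ev.hom_power id_hom.subst_mon eq)
    \<comment> \<open>At a zero of \<open>g\<close> all \<open>k\<close> summands are equal, so
      their sum is \<open>k\<close> times a nonzero number.\<close>
    also have "(\<Sum>l<k. mon_value y (\<alpha> g) ^ (k - Suc l) * mon_value y (\<alpha> g) ^ l)
        = (\<Sum>l<k. mon_value y (\<alpha> g) ^ (k - 1))"
      by (intro sum.cong refl) (simp flip: power_add)
    finally show ?thesis using k mon_value_nonzero[of y, OF y] by simp
  qed
  ultimately show "\<exists>u \<delta>. u * g \<in> ideal.span R
      \<and> (\<forall>\<gamma>\<in>Poly_Mapping.keys u. \<forall>\<phi> :: ('n \<Rightarrow>\<^sub>0 nat) \<Rightarrow> real. (\<forall>\<kappa> \<kappa>'. \<phi> (\<kappa> + \<kappa>') = \<phi> \<kappa> + \<phi> \<kappa>')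
          \<longrightarrow> \<phi> (\<alpha> g) = \<phi> (\<beta> g) \<longrightarrow> \<phi> \<gamma> = \<phi> \<delta>)
      \<and> (\<forall>y. (\<forall>i. y i \<noteq> 0) \<longrightarrow> mon_value y (\<alpha> g) = c g * mon_value y (\<beta> g) \<longrightarrow> subst (\<lambda>x. x) y u \<noteq> 0)"
    by (intro exI[of _ u] exI[of _ ?\<delta>]) blast
qed

end

section \<open>Lifting positive points to Puiseux series\<close>

definition puiseux_of_fps :: "nat \<Rightarrow> complex fps \<Rightarrow> puiseux" where
  "puiseux_of_fps N f = Abs_puiseux (ramify N (fps_to_fls f))"

lemma puiseux_nth_of_fps: "N > 0 \<Longrightarrow> puiseux_nth (puiseux_of_fps N f) = ramify N (fps_to_fls f)"
  by (simp add: puiseux_of_fps_def Abs_puiseux_inverse ramify_in_puiseux_coeffs)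

lemma coeff_hom_puiseux_of_fps:
  assumes N: "N > 0"
  shows "coeff_hom (puiseux_of_fps N)"
proof
  fix f g :: "complex fps"
  show "puiseux_of_fps N (f + g) = puiseux_of_fps N f + puiseux_of_fps N g"
    by (simp add: puiseux_nth_inject[symmetric] puiseux_nth_of_fps[OF N] plus_puiseux.rep_eq ramify_add)
  show "puiseux_of_fps N (f * g) = puiseux_of_fps N f * puiseux_of_fps N g"
    by (simp add: puiseux_nth_inject[symmetric] puiseux_nth_of_fps[OF N] times_puiseux.rep_eq
        ramify_mult[OF N] fls_times_fps_to_fls)
  show "puiseux_of_fps N 1 = 1"
    by (simp add: puiseux_nth_inject[symmetric] puiseux_nth_of_fps[OF N] one_puiseux.rep_eq
        ramify_1[OF N])
qed

lemma puiseux_leads_of_fps: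
  assumes N: "N > 0"
  shows "puiseux_leads 0 (fps_nth f 0) (puiseux_of_fps N f)"
proof -
  have "ramify N (fps_to_fls f) r = 0" if "r < 0" for r
  proof (rule ccontr)
    assume "\<not> ?thesis"
    then obtain k where k: "r = of_int k / of_nat N" "fls_nth (fps_to_fls f) k \<noteq> 0"
      using ramify_nonzeroE[OF N] by metis
    then have "k < 0" using that N by (simp add: divide_less_0_iff)
    then show False using k(2) by simp
  qed
  moreover have "ramify N (fps_to_fls f) 0 = fps_nth f 0" by (simp add: ramify_def)
  ultimately show ?thesis by (simp add: puiseux_leads_def puiseux_nth_of_fps[OF N])
qed

lemma puiseux_of_fps_const: "N > 0 \<Longrightarrow> puiseux_of_fps N (fps_const c) = puiseux_const c"
  by (simp add: puiseux_nth_inject[symmetric] puiseux_nth_of_fps puiseux_const.rep_eq)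
    (auto simp: ramify_def fun_eq_iff elim!: Ints_cases)

lemma puiseux_of_fps_X_power:
  assumes "N > 0"
  shows "puiseux_of_fps N (fps_X ^ k) = t_power (of_nat k / of_nat N)"
proof -
  have "ramify N (fps_to_fls (fps_X ^ k)) q = (if q = of_nat k / of_nat N then 1 else 0)" for q
  proof (cases "of_nat N * q \<in> \<int>")
    case True
    then obtain j where j: "of_nat N * q = of_int j" by (auto elim: Ints_cases)
    then have q: "q = of_int j / of_nat N" using assms by (simp add: field_simps)
    have "q = of_nat k / of_nat N \<longleftrightarrow> j = int k"
      unfolding q using assms by (metis divide_cancel_right of_int_eq_iff of_int_of_nat_eq of_nat_0_eq_iff less_irrefl)
    then show ?thesis using j by (auto simp: ramify_def)
  next
    case False
    then have "q \<noteq> of_nat k / of_nat N" using assms by auto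
    then show ?thesis using False by (simp add: ramify_def)
  qed
  then show ?thesis
    by (simp add: puiseux_nth_inject[symmetric] puiseux_nth_of_fps[OF assms] t_power.rep_eq fun_eq_iff)
qed

lemma t_power_leads: "puiseux_leads q 1 (t_power q)"
  by (simp add: puiseux_leads_def t_power.rep_eq)

lemma t_power_add: "t_power (a + b) = t_power a * t_power b"
proof -
  have "{x. (if x = a then 1 else 0 :: complex) \<noteq> 0 \<and> (if q - x = b then 1 else 0 :: complex) \<noteq> 0}
      = (if q = a + b then {a} else {})" for q
    by auto
  then have "puiseux_nth (t_power a * t_power b) q = puiseux_nth (t_power (a + b)) q" for q
    unfolding times_puiseux.rep_eq t_power.rep_eq puiseux_conv_def by (simp only:) simp
  then show ?thesis by (simp add: puiseux_nth_inject[symmetric] fun_eq_iff)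
qed

lemma t_power_0: "t_power 0 = 1"
  by (simp add: puiseux_nth_inject[symmetric] t_power.rep_eq one_puiseux.rep_eq)

lemma t_power_power: "t_power a ^ n = t_power (of_nat n * a)"
  by (induction n) (simp_all add: t_power_0 algebra_simps flip: t_power_add)

lemma t_power_prod: "finite A \<Longrightarrow> (\<Prod>i\<in>A. t_power (f i)) = t_power (\<Sum>i\<in>A. f i)"
  by (induction A rule: finite_induct) (simp_all add: t_power_0 t_power_add)

lemma t_power_nonzero: "t_power q \<noteq> 0"
  using puiseux_leadsD(1)[OF t_power_leads] by simp

text \<open>The weights of integral vectors are kept as integers because their differences become
  powers of \<open>fps_X\<close>.\<close>

definition int_weight :: "('n::finite \<Rightarrow> int) \<Rightarrow> ('n \<Rightarrow>\<^sub>0 nat) \<Rightarrow> int" where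
  "int_weight v \<kappa> = (\<Sum>i\<in>UNIV. v i * int (Poly_Mapping.lookup \<kappa> i))"

text \<open>The sign of the orders comes from the max convention: coordinates of order
  \<open>- v i / N\<close> tropicalize to \<open>v / N\<close>.\<close>

lemma puiseux_leads_mon_value_int_weight:
  assumes "\<And>i. puiseux_leads (- of_int (v i) / of_nat N) (y i) (z i)"
  shows "puiseux_leads (- of_int (int_weight v \<kappa>) / of_nat N) (mon_value y \<kappa>) (mon_value z \<kappa>)"
proof -
  have "(\<Sum>i\<in>UNIV. of_nat (Poly_Mapping.lookup \<kappa> i) * (- of_int (v i) / of_nat N :: rat))
      = - of_int (int_weight v \<kappa>) / of_nat N"
    by (simp add: int_weight_def sum_negf mult.commute flip: sum_divide_distrib)
  then show ?thesis
    using puiseux_leads_mon_value[where q = "\<lambda>i. - of_int (v i) / of_nat N" and c = y and x = z,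
        OF assms, of \<kappa>] by (simp only:)
qed

section \<open>Zeros of the lifts\<close>

context binomial_lift
begin

text \<open>With the monomial values as \<open>\<phi>\<close> this evaluates \<open>g\<close>; with
  a further linear factor it evaluates the Jacobian. \<open>A\<close> may exceed the support of
  \<open>g\<close> because the sums run over the support of a deformation of
  \<open>g\<close>.\<close>

lemma sum_over_G:
  assumes g: "g \<in> G" and ne: "\<alpha> g \<noteq> \<beta> g" and A: "finite A" "Poly_Mapping.keys g \<subseteq> A"
  shows "(\<Sum>\<kappa>\<in>A. coeff g \<kappa> * \<phi> \<kappa>) = \<phi> (\<alpha> g) - c g * \<phi> (\<beta> g)"
proof -
  have co: "coeff g \<kappa> = (if \<kappa> = \<alpha> g then 1 else if \<kappa> = \<beta> g then - c g else 0)" for \<kappa>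
    using ne arg_cong[OF G_eq[OF g], of "\<lambda>x. coeff x \<kappa>"]
    by (simp add: lookup_minus lookup_single when_def)
  then have "Poly_Mapping.keys g = {\<alpha> g, \<beta> g}"
    using c_nz[OF g] by (auto simp: in_keys_iff split: if_splits)
  moreover have "(\<Sum>\<kappa>\<in>A. coeff g \<kappa> * \<phi> \<kappa>) = (\<Sum>\<kappa>\<in>Poly_Mapping.keys g. coeff g \<kappa> * \<phi> \<kappa>)"
    using A by (intro sum.mono_neutral_right) (auto simp: in_keys_iff)
  ultimately show ?thesis using ne by (simp add: co)
qed

text \<open>Substituting \<open>t_power (- v i / N) * \<zeta> i\<close> for the variables and
  clearing a power of \<open>t\<close> turns \<open>F g\<close> into a polynomial \<open>H g\<close>
  over power series whose residue is \<open>g\<close>. By \<open>surj\<close> the Jacobian at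
  \<open>y\<close> is onto, so \<open>hensel_system\<close> applies.\<close>

lemma puiseux_solution:
  assumes R: "R \<subseteq> G" and N: "N > 0" and ne: "\<And>g. g \<in> R \<Longrightarrow> \<alpha> g \<noteq> \<beta> g"
    and V_eq: "\<And>g. g \<in> R \<Longrightarrow> int_weight v (\<alpha> g) = int_weight v (\<beta> g)"
    and V_less: "\<And>g \<kappa>. g \<in> R \<Longrightarrow> \<kappa> \<in> Poly_Mapping.keys (F g - g) \<Longrightarrow>
      int_weight v \<kappa> < int_weight v (\<alpha> g)"
    and y: "\<And>i. y i \<noteq> 0"
    and root: "\<And>g. g \<in> R \<Longrightarrow> mon_value y (\<alpha> g) = c g * mon_value y (\<beta> g)"
    and surj: "\<And>\<tau>. \<exists>\<epsilon>. \<forall>g\<in>R. (\<Sum>i\<in>UNIV. of_int (exponent_diff g i) * \<epsilon> i) = (\<tau> g :: complex)"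
  shows "\<exists>z. (\<forall>i. puiseux_leads (- of_int (v i) / of_nat N) (y i) (z i))
    \<and> (\<forall>g\<in>R. subst puiseux_const z (F g) = 0)"
proof -
  \<comment> \<open>For \<open>g\<close> in \<open>R\<close> the difference is not negative on the
    support of \<open>F g\<close>, by \<open>V_eq\<close> and \<open>V_less\<close>, so
    \<open>nat\<close> truncates nothing there.\<close>
  define e where "e = (\<lambda>g \<kappa>. nat (int_weight v (\<alpha> g) - int_weight v \<kappa>))"
  define H where "H = (\<lambda>g. \<Sum>\<kappa>\<in>Poly_Mapping.keys (F g). mon \<kappa> (fps_const (coeff (F g) \<kappa>) * fps_X ^ e g \<kappa>))"
  have coeff_H: "coeff (H g) \<kappa> = fps_const (coeff (F g) \<kappa>) * fps_X ^ e g \<kappa>" for g \<kappa>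
    by (auto simp: H_def lookup_sum lookup_single when_def in_keys_iff)
  then have keys_H: "Poly_Mapping.keys (H g) \<subseteq> Poly_Mapping.keys (F g)" for g
    by (auto simp: in_keys_iff)
  have keys_g: "int_weight v \<kappa> = int_weight v (\<alpha> g)"
    if "g \<in> R" "\<kappa> \<in> Poly_Mapping.keys g" for g \<kappa>
  proof -
    have "g \<in> G" using that(1) R by blast
    have "\<kappa> \<in> Poly_Mapping.keys (mon (\<alpha> g) 1 - mon (\<beta> g) (c g))"
      using that(2) by (subst G_eq[OF \<open>g \<in> G\<close>, symmetric])
    then show ?thesis
      using keys_diff[of "mon (\<alpha> g) 1" "mon (\<beta> g) (c g)"] V_eq[OF that(1)] by (auto split: if_splits)
  qed
  have coeff_H_0: "fps_nth (coeff (H g) \<kappa>) 0 = coeff g \<kappa>" if g: "g \<in> R" for g \<kappa>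
  proof (cases "\<kappa> \<in> Poly_Mapping.keys (F g - g)")
    case True
    then have "int_weight v \<kappa> < int_weight v (\<alpha> g)" by (rule V_less[OF g])
    moreover from this have "coeff g \<kappa> = 0" using keys_g[OF g, of \<kappa>] by (force simp: in_keys_iff)
    ultimately show ?thesis by (simp add: coeff_H e_def fps_X_power_nth)
  next
    case False
    then have "coeff (F g) \<kappa> = coeff g \<kappa>" by (simp add: in_keys_iff lookup_minus)
    then show ?thesis using keys_g[OF g, of \<kappa>]
      by (cases "coeff g \<kappa> = 0") (simp_all add: coeff_H e_def in_keys_iff)
  qed
  have keys_g_H: "Poly_Mapping.keys g \<subseteq> Poly_Mapping.keys (H g)" if "g \<in> R" for g
  proof
    fix \<kappa> assume "\<kappa> \<in> Poly_Mapping.keys g"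
    then have "fps_nth (coeff (H g) \<kappa>) 0 \<noteq> 0" by (simp add: coeff_H_0[OF that] in_keys_iff)
    then have "coeff (H g) \<kappa> \<noteq> 0" by (metis fps_zero_nth)
    then show "\<kappa> \<in> Poly_Mapping.keys (H g)" by (simp add: in_keys_iff)
  qed
  have zero: "subst (\<lambda>c. fps_nth c 0) y (H g) = 0" if g: "g \<in> R" for g
    using sum_over_G[OF _ ne[OF g] finite_keys keys_g_H[OF g], of "mon_value y"] g R root[OF g]
    by (auto simp: subst_eq_sum coeff_H_0[OF g])
  have surj': "\<exists>\<epsilon>. \<forall>g\<in>R. (\<Sum>\<kappa>\<in>Poly_Mapping.keys (H g). fps_nth (coeff (H g) \<kappa>) 0 * mon_value y \<kappa>
      * (\<Sum>i\<in>UNIV. of_nat (Poly_Mapping.lookup \<kappa> i) * \<epsilon> i)) = \<tau> g" for \<tau>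
  proof -
    \<comment> \<open>At \<open>y\<close> the Jacobian of \<open>g\<close> is
      \<open>mon_value y (\<alpha> g)\<close> times the exponent difference; hence the
      division.\<close>
    obtain \<epsilon> where \<epsilon>: "\<And>g. g \<in> R \<Longrightarrow>
        (\<Sum>i\<in>UNIV. of_int (exponent_diff g i) * \<epsilon> i) = \<tau> g / mon_value y (\<alpha> g)"
      using surj[of "\<lambda>g. \<tau> g / mon_value y (\<alpha> g)"] by blast
    have "(\<Sum>\<kappa>\<in>Poly_Mapping.keys (H g). fps_nth (coeff (H g) \<kappa>) 0 * mon_value y \<kappa>
      * (\<Sum>i\<in>UNIV. of_nat (Poly_Mapping.lookup \<kappa> i) * \<epsilon> i)) = \<tau> g" if g: "g \<in> R" for g
    proof -
      define L where "L = (\<lambda>\<kappa>. \<Sum>i\<in>UNIV. of_nat (Poly_Mapping.lookup \<kappa> i) * \<epsilon> i)"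
      have "(\<Sum>\<kappa>\<in>Poly_Mapping.keys (H g). fps_nth (coeff (H g) \<kappa>) 0 * mon_value y \<kappa> * L \<kappa>)
          = mon_value y (\<alpha> g) * L (\<alpha> g) - c g * (mon_value y (\<beta> g) * L (\<beta> g))"
        using sum_over_G[OF _ ne[OF g] finite_keys keys_g_H[OF g], of "\<lambda>\<kappa>. mon_value y \<kappa> * L \<kappa>"] g R
        by (auto simp: coeff_H_0[OF g] mult.assoc)
      also have "\<dots> = mon_value y (\<alpha> g) * (L (\<alpha> g) - L (\<beta> g))"
        by (simp add: root[OF g] algebra_simps)
      also have "L (\<alpha> g) - L (\<beta> g) = (\<Sum>i\<in>UNIV. of_int (exponent_diff g i) * \<epsilon> i)"
        by (simp add: L_def exponent_diff_def left_diff_distrib sum_subtractf)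
      finally show ?thesis using mon_value_nonzero[of y, OF y] by (simp add: \<epsilon>[OF g] L_def)
    qed
    then show ?thesis by blast
  qed
  obtain \<zeta> where \<zeta>: "\<And>i. fps_nth (\<zeta> i) 0 = y i" "\<And>g. g \<in> R \<Longrightarrow> subst (\<lambda>c. c) \<zeta> (H g) = 0"
    using hensel_system[of R y H] zero surj' by blast
  interpret \<iota>: coeff_hom "puiseux_of_fps N" by (rule coeff_hom_puiseux_of_fps[OF N])
  define z where "z = (\<lambda>i. t_power (- of_int (v i) / of_nat N) * puiseux_of_fps N (\<zeta> i))"
  have z_leads: "puiseux_leads (- of_int (v i) / of_nat N) (y i) (z i)" for i
    using puiseux_leads_mult[OF t_power_leads puiseux_leads_of_fps[OF N, of "\<zeta> i"]]
    by (simp add: z_def \<zeta>(1))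
  have z_mon: "mon_value z \<kappa> = t_power (- of_int (int_weight v \<kappa>) / of_nat N)
      * puiseux_of_fps N (mon_value \<zeta> \<kappa>)" for \<kappa>
  proof -
    have "mon_value (\<lambda>i. t_power (- of_int (v i) / of_nat N)) \<kappa>
        = t_power (- of_int (int_weight v \<kappa>) / of_nat N)"
      unfolding mon_value_def t_power_power t_power_prod[OF finite]
      by (rule arg_cong[of _ _ t_power])
        (simp add: int_weight_def sum_negf mult.commute flip: sum_divide_distrib)
    then show ?thesis unfolding z_def mon_value_mult by (simp add: \<iota>.hom_mon_value)
  qed
  have "subst puiseux_const z (F g) = 0" if g: "g \<in> R" for g
  proof -
    \<comment> \<open>The power of \<open>t\<close> cleared in passing from \<open>F g\<close> to
      \<open>H g\<close>.\<close>
    let ?t = "t_power (of_int (int_weight v (\<alpha> g)) / of_nat N)"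
    have "0 = puiseux_of_fps N (subst (\<lambda>c. c) \<zeta> (H g))" by (simp add: \<zeta>(2)[OF g] \<iota>.hom_zero)
    also have "\<dots> = (\<Sum>\<kappa>\<in>Poly_Mapping.keys (F g). puiseux_of_fps N (coeff (H g) \<kappa>)
        * puiseux_of_fps N (mon_value \<zeta> \<kappa>))"
      using keys_H by (simp add: subst_eq_sum_superset[of "Poly_Mapping.keys (F g)"] \<iota>.hom_sum \<iota>.hom_mult)
    also have "\<dots> = (\<Sum>\<kappa>\<in>Poly_Mapping.keys (F g). ?t * (puiseux_const (coeff (F g) \<kappa>) * mon_value z \<kappa>))"
    proof (rule sum.cong)
      fix \<kappa> assume \<kappa>: "\<kappa> \<in> Poly_Mapping.keys (F g)"
      have "int_weight v \<kappa> \<le> int_weight v (\<alpha> g)"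
      proof (cases "\<kappa> \<in> Poly_Mapping.keys (F g - g)")
        case True
        then show ?thesis using V_less[OF g] by (simp add: less_imp_le)
      next
        case False
        then have "\<kappa> \<in> Poly_Mapping.keys g" using \<kappa> by (simp add: in_keys_iff lookup_minus)
        then show ?thesis using keys_g[OF g] by simp
      qed
      then have "of_nat (e g \<kappa>) / of_nat N
          = of_int (int_weight v (\<alpha> g)) / of_nat N + - of_int (int_weight v \<kappa>) / (of_nat N :: rat)"
        by (simp add: e_def diff_divide_distrib)
      then have "puiseux_of_fps N (fps_X ^ e g \<kappa>) = ?t * t_power (- of_int (int_weight v \<kappa>) / of_nat N)"
        by (simp only: puiseux_of_fps_X_power[OF N] t_power_add)
      then show "puiseux_of_fps N (coeff (H g) \<kappa>) * puiseux_of_fps N (mon_value \<zeta> \<kappa>)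
          = ?t * (puiseux_const (coeff (F g) \<kappa>) * mon_value z \<kappa>)"
        by (simp add: coeff_H \<iota>.hom_mult puiseux_of_fps_const[OF N] z_mon mult_ac)
    qed simp
    also have "\<dots> = ?t * subst puiseux_const z (F g)"
      by (simp add: subst_eq_sum sum_distrib_left)
    finally show ?thesis using t_power_nonzero by simp
  qed
  with z_leads show ?thesis by blast
qed

text \<open>Among the \<open>F g\<close> not vanishing at \<open>z\<close>, take one whose order
  exceeds that of the monomial \<open>\<alpha> g\<close> by the least amount. As \<open>u g\<close>
  does not cancel to leading order, the left side of \<open>rel\<close> has a known order at
  \<open>z\<close>, while every term on the right has larger order or vanishes.\<close>

lemma all_lifts_vanish:
  assumes N: "N > 0" and z: "\<And>i. puiseux_leads (- of_int (v i) / of_nat N) (y i) (z i)"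
    and R: "\<And>j. j \<in> R \<Longrightarrow> subst puiseux_const z (F j) = 0"
    and rel: "\<And>g. g \<in> G \<Longrightarrow> u g * F g = (\<Sum>j\<in>R. p g j * F j) + (\<Sum>h\<in>G. q g h * F h)"
    and u: "\<And>g \<gamma>. g \<in> G \<Longrightarrow> \<gamma> \<in> Poly_Mapping.keys (u g) \<Longrightarrow> int_weight v \<gamma> = int_weight v (\<delta> g)"
    and q: "\<And>g h \<gamma>. g \<in> G \<Longrightarrow> h \<in> G \<Longrightarrow> \<gamma> \<in> Poly_Mapping.keys (q g h) \<Longrightarrow>
      int_weight v (\<gamma> + \<alpha> h) < int_weight v (\<delta> g + \<alpha> g)"
    and unit: "\<And>g. g \<in> G \<Longrightarrow> subst (\<lambda>x. x) y (u g) \<noteq> 0"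
    and g: "g \<in> G"
  shows "subst puiseux_const z (F g) = 0"
proof (rule ccontr)
  assume nz: "subst puiseux_const z (F g) \<noteq> 0"
  define Z where "Z = {g \<in> G. subst puiseux_const z (F g) \<noteq> 0}"
  \<comment> \<open>The order of the monomial \<open>\<alpha> g\<close> at \<open>z\<close> is
    \<open>- int_weight v (\<alpha> g) / N\<close>; \<open>d\<close> measures how far the order of
    \<open>F g\<close> exceeds it.\<close>
  define d where "d = (\<lambda>g. puiseux_val (subst puiseux_const z (F g)) + of_int (int_weight v (\<alpha> g)) / of_nat N)"
  have "finite Z" "g \<in> Z" using fin g nz by (auto simp: Z_def)
  then obtain g0 where g0: "g0 \<in> Z" "\<And>h. h \<in> Z \<Longrightarrow> d g0 \<le> d h"
    using ex_is_arg_min_if_finite[of Z d] by (auto simp: is_arg_min_linorder)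
  then have g0G: "g0 \<in> G" and g0_nz: "subst puiseux_const z (F g0) \<noteq> 0" by (auto simp: Z_def)
  \<comment> \<open>The order of the left side of \<open>rel\<close> at \<open>z\<close>, attained
    because of \<open>unit\<close>.\<close>
  define \<mu> where "\<mu> = - of_int (int_weight v (\<delta> g0)) / of_nat N + puiseux_val (subst puiseux_const z (F g0))"
  note z_mon = puiseux_leads_mon_value_int_weight[of v N y z, OF z]
  have "puiseux_leads (- of_int (int_weight v (\<delta> g0)) / of_nat N)
      (\<Sum>\<gamma>\<in>Poly_Mapping.keys (u g0). coeff (u g0) \<gamma> * mon_value y \<gamma>) (subst puiseux_const z (u g0))"
    unfolding subst_eq_sum
  proof (intro puiseux_leads_sum)
    fix \<gamma> assume \<gamma>: "\<gamma> \<in> Poly_Mapping.keys (u g0)"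
    show "puiseux_leads (- of_int (int_weight v (\<delta> g0)) / of_nat N) (coeff (u g0) \<gamma> * mon_value y \<gamma>)
        (puiseux_const (coeff (u g0) \<gamma>) * mon_value z \<gamma>)"
      using puiseux_leads_mult[OF puiseux_leads_const z_mon[of \<gamma>], of "coeff (u g0) \<gamma>"] u[OF g0G \<gamma>] by simp
  qed
  from puiseux_leads_mult[OF this puiseux_leads_val_lc[OF g0_nz]]
  have 1: "puiseux_leads \<mu> (subst (\<lambda>x. x) y (u g0) * puiseux_lc (subst puiseux_const z (F g0)))
      (subst puiseux_const z (u g0 * F g0))"
    by (simp add: \<mu>_def subst_eq_sum[of "\<lambda>x. x"] puiseux_const.subst_mult)
  have "puiseux_leads \<mu> 0 (subst puiseux_const z (q g0 h * F h))" if h: "h \<in> G" for h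
  proof (cases "h \<in> Z")
    case False
    then show ?thesis using h by (simp add: Z_def puiseux_const.subst_mult puiseux_leads_0)
  next
    case True
    then have h_nz: "subst puiseux_const z (F h) \<noteq> 0" by (simp add: Z_def)
    have "puiseux_leads \<mu> 0 (puiseux_const (coeff (q g0 h) \<gamma>) * mon_value z \<gamma> * subst puiseux_const z (F h))"
      if \<gamma>: "\<gamma> \<in> Poly_Mapping.keys (q g0 h)" for \<gamma>
    proof -
      have add: "int_weight v (a + b) = int_weight v a + int_weight v b" for a b
        by (simp add: int_weight_def lookup_add algebra_simps sum.distrib)
      have "(of_int (int_weight v \<gamma> + int_weight v (\<alpha> h)) :: rat)
          < of_int (int_weight v (\<delta> g0) + int_weight v (\<alpha> g0))"
        using q[OF g0G h \<gamma>] unfolding add of_int_less_iff .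
      then have "of_int (int_weight v \<gamma> + int_weight v (\<alpha> h)) / (of_nat N :: rat)
          < of_int (int_weight v (\<delta> g0) + int_weight v (\<alpha> g0)) / of_nat N"
        using N by (intro divide_strict_right_mono) auto
      \<comment> \<open>The smaller weight from \<open>q\<close> and the minimality of
        \<open>g0\<close> combine to a strictly larger order.\<close>
      then have lt: "\<mu> < - of_int (int_weight v \<gamma>) / of_nat N + puiseux_val (subst puiseux_const z (F h))"
        using g0(2)[OF True] by (simp add: \<mu>_def d_def add_divide_distrib)
      show ?thesis
        using puiseux_leads_less[OF puiseux_leads_mult[OF puiseux_leads_mult[OF puiseux_leads_const
            z_mon[of \<gamma>]] puiseux_leads_val_lc[OF h_nz]]] lt by simp
    qed
    then have "puiseux_leads \<mu> (\<Sum>\<gamma>\<in>Poly_Mapping.keys (q g0 h). 0) (\<Sum>\<gamma>\<in>Poly_Mapping.keys (q g0 h).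
        puiseux_const (coeff (q g0 h) \<gamma>) * mon_value z \<gamma> * subst puiseux_const z (F h))"
      by (rule puiseux_leads_sum)
    then show ?thesis
      by (simp add: puiseux_const.subst_mult subst_eq_sum[of _ _ "q g0 h"] sum_distrib_right)
  qed
  then have "puiseux_leads \<mu> (\<Sum>h\<in>G. 0) (\<Sum>h\<in>G. subst puiseux_const z (q g0 h * F h))"
    by (rule puiseux_leads_sum)
  moreover have "subst puiseux_const z (u g0 * F g0) = (\<Sum>h\<in>G. subst puiseux_const z (q g0 h * F h))"
    unfolding rel[OF g0G]
    by (simp add: puiseux_const.subst_add puiseux_const.subst_sum puiseux_const.subst_mult R)
  ultimately have "puiseux_leads \<mu> 0 (subst puiseux_const z (u g0 * F g0))" by simp
  with 1 have "subst (\<lambda>x. x) y (u g0) * puiseux_lc (subst puiseux_const z (F g0)) = 0"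
    by (simp add: puiseux_leads_def)
  then show False using unit[OF g0G] puiseux_val_least(1)[OF g0_nz] by simp
qed

text \<open>\<open>u * g\<close> is a combination of \<open>R\<close>. Replacing every binomial by
  its lift leaves a remainder in \<open>I0\<close> below the common weight of \<open>u * g\<close>,
  and \<open>standard_representation\<close> expands it in the lifts.\<close>

lemma lifted_relation:
  assumes R: "R \<subseteq> G" and g: "g \<in> G" and k: "k > 0"
    and rel: "laurent_relation R (\<lambda>l. int k * exponent_diff g l) C"
  shows "\<exists>u \<delta> p q. u * F g = (\<Sum>j\<in>R. p j * F j) + (\<Sum>h\<in>G. q h * F h)
      \<and> (\<forall>\<gamma>\<in>Poly_Mapping.keys u. \<forall>\<phi> :: ('n \<Rightarrow>\<^sub>0 nat) \<Rightarrow> real. (\<forall>\<kappa> \<kappa>'. \<phi> (\<kappa> + \<kappa>') = \<phi> \<kappa> + \<phi> \<kappa>')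
          \<longrightarrow> \<phi> (\<alpha> g) = \<phi> (\<beta> g) \<longrightarrow> \<phi> \<gamma> = \<phi> \<delta>)
      \<and> (\<forall>h\<in>G. \<forall>\<gamma>\<in>Poly_Mapping.keys (q h). weight w (\<gamma> + \<alpha> h) < weight w (\<delta> + \<alpha> g))
      \<and> (\<forall>y. (\<forall>i. y i \<noteq> 0) \<longrightarrow> mon_value y (\<alpha> g) = c g * mon_value y (\<beta> g) \<longrightarrow> subst (\<lambda>x. x) y u \<noteq> 0)"
proof -
  obtain u \<delta> where u: "u * g \<in> ideal.span R"
    and u_keys: "\<forall>\<gamma>\<in>Poly_Mapping.keys u. \<forall>\<phi> :: ('n \<Rightarrow>\<^sub>0 nat) \<Rightarrow> real.
      (\<forall>\<kappa> \<kappa>'. \<phi> (\<kappa> + \<kappa>') = \<phi> \<kappa> + \<phi> \<kappa>') \<longrightarrow> \<phi> (\<alpha> g) = \<phi> (\<beta> g) \<longrightarrow> \<phi> \<gamma> = \<phi> \<delta>"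
    and unit: "\<forall>y. (\<forall>i. y i \<noteq> 0) \<longrightarrow> mon_value y (\<alpha> g) = c g * mon_value y (\<beta> g) \<longrightarrow> subst (\<lambda>x. x) y u \<noteq> 0"
    using unit_multiple_in_span(2)[OF assms] by (elim exE conjE)
  define a where "a = weight w \<delta> + weight w (\<alpha> g)"
  define d where "d = total_degree \<delta> + total_degree (\<alpha> g)"
  have u_hom: "weight w \<gamma> = weight w \<delta> \<and> total_degree \<gamma> = total_degree \<delta>"
    if "\<gamma> \<in> Poly_Mapping.keys u" for \<gamma>
  proof
    show "weight w \<gamma> = weight w \<delta>"
      using u_keys that weight_eq[OF g] by (simp add: weight_add)
    have "real (total_degree \<gamma>) = real (total_degree \<delta>)"
      using bspec[OF u_keys that, THEN spec, of "\<lambda>\<kappa>. real (total_degree \<kappa>)"] degree_eq[OF g]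
      by (simp add: total_degree_add)
    then show "total_degree \<gamma> = total_degree \<delta>" by simp
  qed
  have ug_keys: "weight w \<kappa> = a \<and> total_degree \<kappa> = d" if "\<kappa> \<in> Poly_Mapping.keys (u * g)" for \<kappa>
  proof -
    obtain \<gamma> \<kappa>' where "\<kappa> = \<gamma> + \<kappa>'" "\<gamma> \<in> Poly_Mapping.keys u" "\<kappa>' \<in> Poly_Mapping.keys g"
      using \<open>\<kappa> \<in> _\<close> keys_mult[of u g] by blast
    then show ?thesis using u_hom[of \<gamma>] keys_G[OF g, of \<kappa>'] by (simp add: a_def d_def weight_add total_degree_add)
  qed
  obtain p where p: "u * g = (\<Sum>j\<in>R. p j * j)" "\<forall>j\<in>R. \<forall>\<gamma>\<in>Poly_Mapping.keys (p j).
      weight w \<gamma> + weight w (\<alpha> j) = a \<and> total_degree \<gamma> + total_degree (\<alpha> j) = d"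
    using homogeneous_combination[OF R u ug_keys] by blast
  define f where "f = u * F g - (\<Sum>j\<in>R. p j * F j)"
  have f_eq: "f = u * (F g - g) - (\<Sum>j\<in>R. p j * (F j - j))"
    by (simp add: f_def p(1) right_diff_distrib sum_subtractf)
  have "f \<in> I0" unfolding f_def using R g
    by (intro ideal.subspace_diff[OF ideal] ideal.subspace_sum[OF ideal]
        ideal.subspace_scale[OF ideal] F_in) auto
  moreover have "total_degree \<kappa> = d \<and> weight w \<kappa> < a" if \<kappa>: "\<kappa> \<in> Poly_Mapping.keys f" for \<kappa>
  proof -
    have "\<kappa> \<in> Poly_Mapping.keys (u * (F g - g)) \<or> \<kappa> \<in> Poly_Mapping.keys (\<Sum>j\<in>R. p j * (F j - j))"
      using \<kappa> keys_diff[of "u * (F g - g)" "\<Sum>j\<in>R. p j * (F j - j)"] unfolding f_eq by blast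
    then show ?thesis
    proof
      assume "\<kappa> \<in> Poly_Mapping.keys (u * (F g - g))"
      then obtain \<gamma> \<kappa>' where "\<kappa> = \<gamma> + \<kappa>'" "\<gamma> \<in> Poly_Mapping.keys u" "\<kappa>' \<in> Poly_Mapping.keys (F g - g)"
        using keys_mult[of u "F g - g"] by blast
      then show ?thesis using u_hom[of \<gamma>] rest[OF g, of \<kappa>']
        by (simp add: a_def d_def weight_add total_degree_add)
    next
      assume "\<kappa> \<in> Poly_Mapping.keys (\<Sum>j\<in>R. p j * (F j - j))"
      then obtain j where j: "j \<in> R" "\<kappa> \<in> Poly_Mapping.keys (p j * (F j - j))"
        using keys_sum[of "\<lambda>j. p j * (F j - j)" R] by blast
      then obtain \<gamma> \<kappa>' where "\<kappa> = \<gamma> + \<kappa>'" "\<gamma> \<in> Poly_Mapping.keys (p j)" "\<kappa>' \<in> Poly_Mapping.keys (F j - j)"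
        using keys_mult[of "p j" "F j - j"] by blast
      then show ?thesis using bspec[OF p(2) j(1)] rest[of j \<kappa>'] j(1) R
        by (fastforce simp: weight_add total_degree_add)
    qed
  qed
  ultimately obtain q where q: "f = (\<Sum>h\<in>G. q h * F h)"
    "\<forall>h\<in>G. \<forall>\<gamma>\<in>Poly_Mapping.keys (q h). weight w \<gamma> + weight w (\<alpha> h) < a"
    using standard_representation[of f d a] by blast
  have "u * F g = (\<Sum>j\<in>R. p j * F j) + (\<Sum>h\<in>G. q h * F h)"
    using q(1) by (simp add: f_def algebra_simps)
  moreover have "\<forall>h\<in>G. \<forall>\<gamma>\<in>Poly_Mapping.keys (q h). weight w (\<gamma> + \<alpha> h) < weight w (\<delta> + \<alpha> g)"
    using q(2) by (simp add: weight_add a_def)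
  ultimately show ?thesis using u_keys unit
    by (intro exI[of _ u] exI[of _ \<delta>] exI[of _ p] exI[of _ q] conjI)
qed

end

section \<open>Nearby zeros with prescribed signs\<close>

context binomial_lift
begin

text \<open>The logarithmic equations for the moduli of a common zero \<open>y\<close> of
  \<open>G\<close> are solved on an independent subset \<open>R\<close>; they extend to
  \<open>G\<close> because the constants obey the dependencies of the exponents. Then
  \<open>R\<close> is lifted, the other lifts vanish by valuations, and \<open>I0\<close> is reached
  through combinations of lifts.\<close>

lemma positive_point_near:
  fixes s :: "'n \<Rightarrow> int"
  assumes ne: "\<And>g. g \<in> G \<Longrightarrow> \<alpha> g \<noteq> \<beta> g" and s: "\<And>i. s i \<in> {1, -1}"
    and c_real: "\<And>g. g \<in> G \<Longrightarrow> c g \<in> \<real>"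
    and sign: "\<And>g. g \<in> G \<Longrightarrow> 0 < Re (c g) * mon_value (\<lambda>i. of_int (s i)) (\<alpha> g) * mon_value (\<lambda>i. of_int (s i)) (\<beta> g)"
    and degree_part: "\<And>f d. f \<in> I0 \<Longrightarrow> restrict_mpoly {\<kappa>. total_degree \<kappa> = d} f \<in> I0"
    and \<epsilon>: "\<epsilon> > 0"
  shows "\<exists>z v. \<exists>N>0. (\<forall>i. \<bar>real N * w $ i - of_int (v i)\<bar> < \<epsilon>)
    \<and> (\<forall>i. \<exists>r>0. puiseux_leads (- of_int (v i) / of_nat N) (of_int (s i) * complex_of_real r) (z i))
    \<and> (\<forall>f\<in>I0. subst puiseux_const z f = 0)"
proof -
  obtain R d and r :: "_ \<Rightarrow> _ \<Rightarrow> rat" where R: "R \<subseteq> G"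
    and d: "\<forall>i\<in>R. \<forall>j\<in>R. (\<Sum>l\<in>UNIV. of_int (exponent_diff i l) * d j l) = (if i = j then 1 else (0::rat))"
    and r: "\<forall>i\<in>G. \<forall>l. of_int (exponent_diff i l) = (\<Sum>j\<in>R. r i j * (of_int (exponent_diff j l) :: rat))"
    using dual_basis_exists[OF fin, of "\<lambda>g l. of_int (exponent_diff g l)"] by (elim exE conjE)
  have finR: "finite R" using R fin finite_subset by blast
  \<comment> \<open>Stated for all fields of characteristic 0: the real case gives the moduli of
    \<open>y\<close>, the complex case the surjectivity for Hensel lifting.\<close>
  have dual: "(\<Sum>l\<in>UNIV. of_int (exponent_diff i l) * (\<Sum>j\<in>R. x j * of_rat (d j l))) = (x i :: 'b::field_char_0)"
    if i: "i \<in> R" for i x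
  proof -
    have "(\<Sum>l\<in>UNIV. of_int (exponent_diff i l) * of_rat (d j l)) = (of_rat (if i = j then 1 else 0) :: 'b)"
      if j: "j \<in> R" for j
    proof -
      have "(\<Sum>l\<in>UNIV. of_int (exponent_diff i l) * of_rat (d j l) :: 'b)
          = of_rat (\<Sum>l\<in>UNIV. of_int (exponent_diff i l) * d j l)"
        by (simp add: of_rat_sum of_rat_mult)
      also have "(\<Sum>l\<in>UNIV. of_int (exponent_diff i l) * d j l) = (if i = j then 1 else 0)"
        using d i j by blast
      finally show ?thesis .
    qed
    note pairing = this
    have "(\<Sum>l\<in>UNIV. of_int (exponent_diff i l) * (\<Sum>j\<in>R. x j * of_rat (d j l)))
        = (\<Sum>l\<in>UNIV. \<Sum>j\<in>R. x j * (of_int (exponent_diff i l) * of_rat (d j l)))"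
      by (simp add: sum_distrib_left mult.left_commute)
    also have "\<dots> = (\<Sum>j\<in>R. x j * (\<Sum>l\<in>UNIV. of_int (exponent_diff i l) * of_rat (d j l)))"
      by (subst sum.swap) (simp add: sum_distrib_left)
    also have "\<dots> = (\<Sum>j\<in>R. x j * of_rat (if i = j then 1 else 0))"
      using pairing by (intro sum.cong refl) simp
    also have "\<dots> = x i" using i finR by (simp add: if_distrib cong: if_cong)
    finally show ?thesis .
  qed
  \<comment> \<open>Clearing denominators makes the dependencies integral, so that they act on
    Laurent monomials.\<close>
  have "\<exists>k m. k > 0 \<and> (\<forall>l. int k * exponent_diff g l = (\<Sum>j\<in>R. m j * exponent_diff j l))" if g: "g \<in> G" for g
  proof -
    obtain k :: nat where k: "k > 0" "\<And>j. j \<in> R \<Longrightarrow> of_nat k * r g j \<in> \<int>"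
      using common_denominator[OF finR, of "r g"] by blast
    define m where "m = (\<lambda>j. \<lfloor>of_nat k * r g j\<rfloor>)"
    have m: "of_nat k * r g j = of_int (m j)" if "j \<in> R" for j
      using k(2)[OF that] by (auto simp: m_def elim!: Ints_cases)
    have "int k * exponent_diff g l = (\<Sum>j\<in>R. m j * exponent_diff j l)" for l
    proof -
      have "(of_int (int k * exponent_diff g l) :: rat) = of_nat k * (\<Sum>j\<in>R. r g j * of_int (exponent_diff j l))"
        using r g by simp
      also have "\<dots> = (\<Sum>j\<in>R. (of_nat k * r g j) * of_int (exponent_diff j l))"
        by (simp add: sum_distrib_left mult.assoc)
      also have "\<dots> = of_int (\<Sum>j\<in>R. m j * exponent_diff j l)"
        by (simp add: m)
      finally show ?thesis by (simp only: of_int_eq_iff)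
    qed
    then show ?thesis using k(1) by blast
  qed
  then obtain k m where k: "\<And>g. g \<in> G \<Longrightarrow> k g > (0::nat)"
    and m: "\<And>g l. g \<in> G \<Longrightarrow> int (k g) * exponent_diff g l = (\<Sum>j\<in>R. m g j * exponent_diff j l)"
    by metis
  have rel: "laurent_relation R (\<lambda>l. int (k g) * exponent_diff g l) (\<Prod>j\<in>R. c j powi m g j)" if g: "g \<in> G" for g
    unfolding m[OF g] using R
    by (intro laurent_relation_sum[OF finR] laurent_relation_scale laurent_relation_base c_nz) auto
  \<comment> \<open>The constants satisfy the dependencies of the exponents, as otherwise
    \<open>ideal.span G\<close> would contain a monomial.\<close>
  have c_power: "(\<Prod>j\<in>R. c j powi m g j) = c g ^ k g" if g: "g \<in> G" for g
    by (rule unit_multiple_in_span(1)[OF R g k[OF g] rel[OF g]])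

  \<comment> \<open>The logarithms of the moduli of the coordinates of \<open>y\<close>, read off
    from the dual basis.\<close>
  define \<eta> where "\<eta> = (\<lambda>l. \<Sum>j\<in>R. ln (cmod (c j)) * of_rat (d j l))"
  have \<eta>_R: "(\<Sum>l\<in>UNIV. of_int (exponent_diff j l) * \<eta> l) = ln (cmod (c j))" if "j \<in> R" for j
    unfolding \<eta>_def by (rule dual[OF that])
  have \<eta>: "(\<Sum>l\<in>UNIV. of_int (exponent_diff g l) * \<eta> l) = ln (cmod (c g))" if g: "g \<in> G" for g
  proof -
    have ln_powi: "ln (x powi n) = of_int n * ln x" if "x > 0" for x :: real and n :: int
      using that by (simp add: power_int_def ln_realpow ln_inverse)
    have "real (k g) * (\<Sum>l\<in>UNIV. of_int (exponent_diff g l) * \<eta> l)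
        = (\<Sum>l\<in>UNIV. of_int (int (k g) * exponent_diff g l) * \<eta> l)"
      by (simp add: sum_distrib_left mult.assoc)
    also have "\<dots> = (\<Sum>l\<in>UNIV. \<Sum>j\<in>R. of_int (m g j) * (of_int (exponent_diff j l) * \<eta> l))"
      by (simp add: m[OF g] sum_distrib_right mult.assoc)
    also have "\<dots> = (\<Sum>j\<in>R. of_int (m g j) * (\<Sum>l\<in>UNIV. of_int (exponent_diff j l) * \<eta> l))"
      by (subst sum.swap) (simp add: sum_distrib_left)
    also have "\<dots> = (\<Sum>j\<in>R. ln (cmod (c j) powi m g j))"
      using R c_nz by (intro sum.cong refl) (subst ln_powi; auto simp: \<eta>_R)
    also have "\<dots> = ln (\<Prod>j\<in>R. cmod (c j) powi m g j)"
      using R c_nz finR by (intro ln_prod[symmetric]) auto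
    also have "(\<Prod>j\<in>R. cmod (c j) powi m g j) = cmod (c g) ^ k g"
      by (simp add: c_power[OF g] prod_norm flip: norm_power_int norm_power)
    also have "ln (cmod (c g) ^ k g) = real (k g) * ln (cmod (c g))" by (rule ln_realpow)
    finally show ?thesis using k[OF g] by simp
  qed
  define y where "y = (\<lambda>i. of_int (s i) * complex_of_real (exp (\<eta> i)))"
  have s_nz: "s i \<noteq> 0" for i using s[of i] by auto
  have y_nz: "y i \<noteq> 0" for i using s_nz by (simp add: y_def)
  define sg where "sg = (\<lambda>\<kappa>. mon_value (\<lambda>i. of_int (s i)) \<kappa> :: real)"
  have sg: "sg \<kappa> * sg \<kappa> = 1" for \<kappa>
  proof -
    have "mon_value (\<lambda>i. of_int (s i) * of_int (s i)) \<kappa> = (mon_value (\<lambda>i. 1) \<kappa> :: real)"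
    proof (rule arg_cong[of _ _ "\<lambda>x. mon_value x \<kappa>"], rule ext)
      show "of_int (s i) * of_int (s i) = (1 :: real)" for i using s[of i] by auto
    qed
    then show ?thesis by (simp only: sg_def mon_value_mult) (simp add: mon_value_def)
  qed
  have y_mon: "mon_value y \<kappa> = complex_of_real (sg \<kappa> * exp (\<Sum>l\<in>UNIV. real (Poly_Mapping.lookup \<kappa> l) * \<eta> l))" for \<kappa>
  proof -
    have "mon_value y \<kappa> = mon_value (\<lambda>i. of_real (of_int (s i))) \<kappa> * mon_value (\<lambda>i. of_real (exp (\<eta> i))) \<kappa>"
      unfolding y_def mon_value_mult by simp
    also have "mon_value (\<lambda>i. exp (\<eta> i)) \<kappa> = exp (\<Sum>l\<in>UNIV. real (Poly_Mapping.lookup \<kappa> l) * \<eta> l)"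
      by (simp add: mon_value_def exp_sum exp_of_nat_mult)
    then have "mon_value (\<lambda>i. complex_of_real (exp (\<eta> i))) \<kappa>
        = of_real (exp (\<Sum>l\<in>UNIV. real (Poly_Mapping.lookup \<kappa> l) * \<eta> l))"
      unfolding mon_value_of_real by simp
    finally show ?thesis by (simp add: mon_value_of_real sg_def del: of_real_of_int_eq)
  qed
  \<comment> \<open>\<open>\<eta>\<close> makes the moduli of the two sides agree, and
    \<open>sign\<close> their signs.\<close>
  have root: "mon_value y (\<alpha> g) = c g * mon_value y (\<beta> g)" if g: "g \<in> G" for g
  proof -
    define x where "x = Re (c g)"
    have cx: "c g = of_real x" using c_real[OF g] by (simp add: x_def of_real_Re)
    have x_nz: "x \<noteq> 0" using c_nz[OF g] cx by auto
    have pos: "0 < x * sg (\<alpha> g) * sg (\<beta> g)" using sign[OF g] by (simp add: x_def sg_def)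
    have "\<bar>sg \<kappa>\<bar> = 1" for \<kappa>
      using sg[of \<kappa>] by (metis abs_1 abs_mult abs_mult_self_eq abs_ge_zero mult_1 power2_eq_square real_sqrt_abs2 real_sqrt_one)
    then have abs_x: "x * sg (\<alpha> g) * sg (\<beta> g) = \<bar>x\<bar>"
      using abs_of_pos[OF pos] by (simp add: abs_mult)
    have "(\<Sum>l\<in>UNIV. real (Poly_Mapping.lookup (\<alpha> g) l) * \<eta> l)
        = ln \<bar>x\<bar> + (\<Sum>l\<in>UNIV. real (Poly_Mapping.lookup (\<beta> g) l) * \<eta> l)"
      using \<eta>[OF g] cx by (simp add: exponent_diff_def left_diff_distrib sum_subtractf)
    then have "sg (\<alpha> g) * exp (\<Sum>l\<in>UNIV. real (Poly_Mapping.lookup (\<alpha> g) l) * \<eta> l)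
        = sg (\<alpha> g) * \<bar>x\<bar> * exp (\<Sum>l\<in>UNIV. real (Poly_Mapping.lookup (\<beta> g) l) * \<eta> l)"
      using x_nz by (simp add: exp_add)
    also have "sg (\<alpha> g) * \<bar>x\<bar> = x * sg (\<beta> g) * (sg (\<alpha> g) * sg (\<alpha> g))"
      unfolding abs_x[symmetric] by (simp only: mult_ac)
    also have "\<dots> = x * sg (\<beta> g)" by (simp add: sg)
    finally show ?thesis unfolding y_mon cx of_real_mult[symmetric] of_real_eq_iff by (simp add: mult.assoc)
  qed

  define Q where "Q = (\<lambda>g u \<delta> p q. u * F g = (\<Sum>j\<in>R. p j * F j) + (\<Sum>h\<in>G. q h * F h)
      \<and> (\<forall>\<gamma>\<in>Poly_Mapping.keys u. \<forall>\<phi> :: ('n \<Rightarrow>\<^sub>0 nat) \<Rightarrow> real. (\<forall>\<kappa> \<kappa>'. \<phi> (\<kappa> + \<kappa>') = \<phi> \<kappa> + \<phi> \<kappa>')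
          \<longrightarrow> \<phi> (\<alpha> g) = \<phi> (\<beta> g) \<longrightarrow> \<phi> \<gamma> = \<phi> \<delta>)
      \<and> (\<forall>h\<in>G. \<forall>\<gamma>\<in>Poly_Mapping.keys (q h). weight w (\<gamma> + \<alpha> h) < weight w (\<delta> + \<alpha> g))
      \<and> subst (\<lambda>x. x) y u \<noteq> 0)"
  have "\<exists>u \<delta> p q. Q g u \<delta> p q" if g: "g \<in> G" for g
    unfolding Q_def using lifted_relation[OF R g k[OF g] rel[OF g]] y_nz root[OF g] by blast
  then obtain u \<delta> p q where "\<And>g. g \<in> G \<Longrightarrow> Q g (u g) (\<delta> g) (p g) (q g)" by metis
  note u = this[unfolded Q_def]

  \<comment> \<open>All exponents whose weights have to be compared. The relations are fixed first,
    so \<open>E\<close> is finite and \<open>w\<close> can be replaced by an integral vector that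
    respects these comparisons.\<close>
  define E where "E = \<alpha> ` G \<union> \<beta> ` G \<union> (\<lambda>g. \<delta> g + \<alpha> g) ` G \<union> (\<Union>g\<in>G. Poly_Mapping.keys (F g - g))
    \<union> (\<Union>g\<in>G. \<Union>h\<in>G. (\<lambda>\<gamma>. \<gamma> + \<alpha> h) ` Poly_Mapping.keys (q g h))"
  have "finite E" unfolding E_def using fin by (intro finite_UnI finite_imageI finite_UN_I) auto
  then obtain N and V :: "real ^ 'n" where N: "N > 0" and V: "\<And>i. V $ i \<in> \<int>" "\<And>i. \<bar>real N * w $ i - V $ i\<bar> < \<epsilon>"
    and V_eq: "\<And>\<kappa> \<kappa>'. \<kappa> \<in> E \<Longrightarrow> \<kappa>' \<in> E \<Longrightarrow> weight w \<kappa> = weight w \<kappa>' \<Longrightarrow> weight V \<kappa> = weight V \<kappa>'"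
    and V_less: "\<And>\<kappa> \<kappa>'. \<kappa> \<in> E \<Longrightarrow> \<kappa>' \<in> E \<Longrightarrow> weight w \<kappa> < weight w \<kappa>' \<Longrightarrow> weight V \<kappa> < weight V \<kappa>'"
    using order_preserving_approximation[OF _ \<epsilon>, of E w] by blast
  define v where "v = (\<lambda>i. \<lfloor>V $ i\<rfloor>)"
  have v: "V $ i = of_int (v i)" for i using V(1)[of i] by (auto simp: v_def elim!: Ints_cases)
  have V_int: "weight V \<kappa> = of_int (int_weight v \<kappa>)" for \<kappa>
    by (simp add: weight_def int_weight_def v)
  have iv_eq: "int_weight v (\<alpha> g) = int_weight v (\<beta> g)" if "g \<in> G" for g
    using V_eq[of "\<alpha> g" "\<beta> g"] that weight_eq by (auto simp: E_def V_int)
  have "\<exists>z. (\<forall>i. puiseux_leads (- of_int (v i) / of_nat N) (y i) (z i))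
    \<and> (\<forall>g\<in>R. subst puiseux_const z (F g) = 0)"
  proof (rule puiseux_solution[OF R N])
    show "int_weight v \<kappa> < int_weight v (\<alpha> g)" if "g \<in> R" "\<kappa> \<in> Poly_Mapping.keys (F g - g)" for g \<kappa>
    proof -
      have "g \<in> G" using that R by blast
      then have "\<kappa> \<in> E" "\<alpha> g \<in> E" "weight w \<kappa> < weight w (\<alpha> g)"
        using that rest[of g \<kappa>] by (auto simp: E_def)
      from V_less[OF this] show ?thesis by (simp add: V_int)
    qed
    show "\<exists>\<epsilon>. \<forall>g\<in>R. (\<Sum>i\<in>UNIV. of_int (exponent_diff g i) * \<epsilon> i) = (\<tau> g :: complex)" for \<tau>
      by (intro exI[of _ "\<lambda>i. \<Sum>j\<in>R. \<tau> j * of_rat (d j i)"] ballI) (rule dual)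
  qed (use R ne iv_eq y_nz root in auto)
  then obtain z where z: "\<And>i. puiseux_leads (- of_int (v i) / of_nat N) (y i) (z i)"
    and z_R: "\<And>g. g \<in> R \<Longrightarrow> subst puiseux_const z (F g) = 0" by blast
  have z_F: "subst puiseux_const z (F g) = 0" if g: "g \<in> G" for g
  proof (rule all_lifts_vanish[OF N z, where R = R and u = u and p = p and q = q and \<delta> = \<delta>])
    show "int_weight v \<gamma> = int_weight v (\<delta> g)" if g: "g \<in> G" and \<gamma>: "\<gamma> \<in> Poly_Mapping.keys (u g)" for g \<gamma>
    proof -
      have "weight V \<gamma> = weight V (\<delta> g)"
        using bspec[OF conjunct1[OF conjunct2[OF u[OF g]]] \<gamma>, THEN spec, of "weight V"] iv_eq[OF g]
        by (simp add: weight_add V_int)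
      then show ?thesis by (simp add: V_int)
    qed
    show "int_weight v (\<gamma> + \<alpha> h) < int_weight v (\<delta> g + \<alpha> g)"
      if "g \<in> G" "h \<in> G" "\<gamma> \<in> Poly_Mapping.keys (q g h)" for g h \<gamma>
    proof -
      have "\<gamma> + \<alpha> h \<in> E" "\<delta> g + \<alpha> g \<in> E" using that unfolding E_def by blast+
      moreover have "weight w (\<gamma> + \<alpha> h) < weight w (\<delta> g + \<alpha> g)" using u that by blast
      ultimately show ?thesis using V_less by (simp add: V_int)
    qed
  qed (use z_R u g in auto)
  have z_homogeneous: "subst puiseux_const z f = 0" if f: "f \<in> I0"
    and deg: "\<And>\<kappa>. \<kappa> \<in> Poly_Mapping.keys f \<Longrightarrow> total_degree \<kappa> = d" for f d
  proof -
    \<comment> \<open>Any strict upper bound of the weights would do; inserting 0 covers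
      \<open>f = 0\<close>.\<close>
    define a where "a = 1 + Max (insert 0 (weight w ` Poly_Mapping.keys f))"
    have a: "weight w \<kappa> < a" if "\<kappa> \<in> Poly_Mapping.keys f" for \<kappa>
    proof -
      have "weight w \<kappa> \<le> Max (insert 0 (weight w ` Poly_Mapping.keys f))"
        by (rule Max_ge) (use that in auto)
      then show ?thesis unfolding a_def by linarith
    qed
    obtain q where "f = (\<Sum>g\<in>G. q g * F g)"
      using standard_representation[OF f, of d a] deg a by blast
    then show ?thesis
      by (simp add: puiseux_const.subst_sum puiseux_const.subst_mult z_F)
  qed
  have "subst puiseux_const z f = 0" if f: "f \<in> I0" for f
  proof -
    let ?D = "total_degree ` Poly_Mapping.keys f"
    \<comment> \<open>\<open>standard_representation\<close> works in one degree at a time, hence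
      the splitting.\<close>
    have "f = (\<Sum>d\<in>?D. restrict_mpoly {\<kappa>. total_degree \<kappa> = d} f)"
    proof (rule poly_mapping_eqI)
      fix \<kappa>
      have "(\<Sum>d\<in>?D. if total_degree \<kappa> = d then coeff f \<kappa> else 0)
          = (if total_degree \<kappa> \<in> ?D then coeff f \<kappa> else 0)" by simp
      also have "\<dots> = coeff f \<kappa>" by (auto simp: in_keys_iff)
      finally show "coeff f \<kappa> = coeff (\<Sum>d\<in>?D. restrict_mpoly {\<kappa>. total_degree \<kappa> = d} f) \<kappa>"
        by (simp add: lookup_sum coeff_restrict_mpoly)
    qed
    moreover have "subst puiseux_const z (\<Sum>d\<in>?D. restrict_mpoly {\<kappa>. total_degree \<kappa> = d} f) = 0"
      unfolding puiseux_const.subst_sum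
    proof (rule sum.neutral, rule ballI)
      show "subst puiseux_const z (restrict_mpoly {\<kappa>. total_degree \<kappa> = d} f) = 0" for d
        by (rule z_homogeneous[OF degree_part[OF f], of d]) (simp add: keys_restrict_mpoly)
    qed
    ultimately show ?thesis by simp
  qed
  moreover have "\<exists>r>0. puiseux_leads (- of_int (v i) / of_nat N) (of_int (s i) * complex_of_real r) (z i)" for i
    using z[of i] by (intro exI[of _ "exp (\<eta> i)"]) (simp add: y_def)
  moreover have "\<bar>real N * w $ i - of_int (v i)\<bar> < \<epsilon>" for i using V(2)[of i] by (simp add: v)
  ultimately show ?thesis using N by (intro exI[of _ z] exI[of _ v] exI[of _ N]) simp
qed

end

section \<open>Reality and signs of the binomial generators\<close>

text \<open>Conjugation fixes the generators. Comparing a lift with its conjugate will show that the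
  constants of the binomials are real.\<close>

lemma cnj_in_real_span:
  fixes B :: "('n, complex) mpoly set"
  assumes real: "\<And>b \<alpha>. b \<in> B \<Longrightarrow> coeff b \<alpha> \<in> \<real>" and f: "f \<in> ideal.span B"
  shows "Poly_Mapping.map cnj f \<in> ideal.span B"
  using f
proof (induction rule: ideal.span_induct_alt)
  case base
  then show ?case by (simp add: map_zero_mpoly ideal.span_zero)
next
  case (step h b f)
  interpret cnj: coeff_hom cnj by unfold_locales simp_all
  have "Poly_Mapping.map cnj b = b"
    by (rule poly_mapping_eqI) (use real[OF step(1)] in \<open>simp add: coeff_map Reals_cnj_iff\<close>)
  then have "Poly_Mapping.map cnj (h * b + f) = Poly_Mapping.map cnj h * b + Poly_Mapping.map cnj f"
    by (simp add: map_add_mpoly cnj.map_mult)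
  then show ?case using step by (simp add: ideal.span_add ideal.span_scale ideal.span_base)
qed

text \<open>The lifts come from \<open>lift_component\<close>. If a binomial were not bihomogeneous
  or its constant not real, the leading part of some element of \<open>constant_part I\<close> would
  be a nonzero multiple of a monomial.\<close>

lemma binomial_lift_exists:
  fixes I :: "('n::finite, puiseux) mpoly set"
  assumes hom: "homogeneous_ideal I" and real: "generated_by_real_polys I"
    and no_mon: "\<And>\<kappa>. mon \<kappa> 1 \<notin> initial_ideal w I"
    and fin: "finite G" and span: "initial_ideal w I = ideal.span G"
    and G_eq: "\<And>g. g \<in> G \<Longrightarrow> g = mon (\<alpha> g) 1 - mon (\<beta> g) (c g)"
    and ne: "\<And>g. g \<in> G \<Longrightarrow> \<alpha> g \<noteq> \<beta> g" and nz: "\<And>g. g \<in> G \<Longrightarrow> c g \<noteq> 0"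
  shows "(\<exists>F. binomial_lift (constant_part I) w G \<alpha> \<beta> c F) \<and> (\<forall>g\<in>G. c g \<in> \<real>)"
proof -
  obtain B where B: "\<And>b \<alpha>. b \<in> B \<Longrightarrow> coeff b \<alpha> \<in> \<real>" "constant_part I = ideal.span B"
    using real_generators[OF real] by metis
  have ideal: "ideal.subspace (constant_part I)"
    unfolding B(2) by (rule ideal.subspace_span)
  have co: "coeff g \<kappa> = (if \<kappa> = \<alpha> g then 1 else if \<kappa> = \<beta> g then - c g else 0)" if g: "g \<in> G" for g \<kappa>
    using ne[OF g] arg_cong[OF G_eq[OF g], of "\<lambda>x. coeff x \<kappa>"]
    by (simp add: lookup_minus lookup_single when_def)
  have "\<exists>f\<in>constant_part I. (\<forall>\<kappa>\<in>Poly_Mapping.keys f. total_degree \<kappa> = total_degree (\<alpha> g) \<and> weight w \<kappa> \<le> weight w (\<alpha> g))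
    \<and> (\<forall>\<kappa>. weight w \<kappa> = weight w (\<alpha> g) \<and> total_degree \<kappa> = total_degree (\<alpha> g) \<longrightarrow> coeff f \<kappa> = coeff g \<kappa>)"
    if "g \<in> G" for g
    using ideal.span_base[OF that] by (intro lift_component[OF hom real]) (simp add: span)
  then obtain F where F: "\<And>g. g \<in> G \<Longrightarrow> F g \<in> constant_part I"
    and F_keys: "\<And>g \<kappa>. g \<in> G \<Longrightarrow> \<kappa> \<in> Poly_Mapping.keys (F g) \<Longrightarrow>
      total_degree \<kappa> = total_degree (\<alpha> g) \<and> weight w \<kappa> \<le> weight w (\<alpha> g)"
    and F_top: "\<And>g \<kappa>. g \<in> G \<Longrightarrow> weight w \<kappa> = weight w (\<alpha> g) \<Longrightarrow> total_degree \<kappa> = total_degree (\<alpha> g) \<Longrightarrow>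
      coeff (F g) \<kappa> = coeff g \<kappa>"
    by metis
  have top: "restrict_mpoly {\<kappa>. weight w \<kappa> = a} f \<in> ideal.span G"
    if "f \<in> constant_part I" "\<And>\<kappa>. \<kappa> \<in> Poly_Mapping.keys f \<Longrightarrow> weight w \<kappa> \<le> a" for f a
    using top_part_in_initial_ideal[OF that] span by simp
  \<comment> \<open>If \<open>\<beta> g\<close> had another weight or degree, the top part of the
    lift would keep only the first term of \<open>g\<close>.\<close>
  have hom_g: "weight w (\<beta> g) = weight w (\<alpha> g) \<and> total_degree (\<beta> g) = total_degree (\<alpha> g)" if g: "g \<in> G" for g
  proof (rule ccontr)
    assume no: "\<not> ?thesis"
    let ?X = "{\<kappa>. weight w \<kappa> = weight w (\<alpha> g)}"
    have "restrict_mpoly ?X (F g) = mon (\<alpha> g) 1"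
    proof (rule poly_mapping_eqI)
      fix \<kappa>
      show "coeff (restrict_mpoly ?X (F g)) \<kappa> = coeff (mon (\<alpha> g) 1) \<kappa>"
      proof (cases "weight w \<kappa> = weight w (\<alpha> g) \<and> total_degree \<kappa> = total_degree (\<alpha> g)")
        case True
        then show ?thesis using F_top[OF g, of \<kappa>] no ne[OF g]
          by (auto simp: coeff_restrict_mpoly co[OF g] lookup_single when_def)
      next
        case False
        then have "coeff (restrict_mpoly ?X (F g)) \<kappa> = 0"
          using F_keys[OF g, of \<kappa>] by (auto simp: coeff_restrict_mpoly in_keys_iff)
        moreover have "\<kappa> \<noteq> \<alpha> g" using False by auto
        ultimately show ?thesis by (simp add: lookup_single_not_eq)
      qed
    qed
    then have "mon (\<alpha> g) 1 \<in> initial_ideal w I"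
      using top[OF F[OF g], of "weight w (\<alpha> g)"] F_keys[OF g] span by simp
    then show False using no_mon by blast
  qed
  have rest: "total_degree \<kappa> = total_degree (\<alpha> g) \<and> weight w \<kappa> < weight w (\<alpha> g)"
    if g: "g \<in> G" and \<kappa>: "\<kappa> \<in> Poly_Mapping.keys (F g - g)" for g \<kappa>
  proof -
    have neq: "coeff (F g) \<kappa> \<noteq> coeff g \<kappa>" using \<kappa> by (simp add: in_keys_iff lookup_minus)
    then have "\<not> (weight w \<kappa> = weight w (\<alpha> g) \<and> total_degree \<kappa> = total_degree (\<alpha> g))"
      using F_top[OF g] by blast
    moreover from this have "coeff g \<kappa> = 0" using hom_g[OF g] by (auto simp: co[OF g])
    then have "\<kappa> \<in> Poly_Mapping.keys (F g)" using neq by (simp add: in_keys_iff)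
    ultimately show ?thesis using F_keys[OF g, of \<kappa>] by force
  qed
  have "c g \<in> \<real>" if g: "g \<in> G" for g
  proof (rule ccontr)
    assume "c g \<notin> \<real>"
    then have c: "cnj (c g) - c g \<noteq> 0" by (simp add: Reals_cnj_iff)
    let ?X = "{\<kappa>. weight w \<kappa> = weight w (\<alpha> g)}"
    \<comment> \<open>The difference cancels the coefficient 1 at \<open>\<alpha> g\<close> and
      leaves a nonzero multiple of the monomial \<open>\<beta> g\<close> on top.\<close>
    define f where "f = F g - Poly_Mapping.map cnj (F g)"
    have "f \<in> constant_part I"
      unfolding f_def using F[OF g] cnj_in_real_span[OF B(1)] by (simp add: B(2) ideal.span_diff)
    moreover have f_keys: "total_degree \<kappa> = total_degree (\<alpha> g) \<and> weight w \<kappa> \<le> weight w (\<alpha> g)"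
      if "\<kappa> \<in> Poly_Mapping.keys f" for \<kappa>
    proof -
      have "\<kappa> \<in> Poly_Mapping.keys (F g)"
        using that by (auto simp: f_def in_keys_iff lookup_minus coeff_map)
      then show ?thesis by (rule F_keys[OF g])
    qed
    ultimately have "restrict_mpoly ?X f \<in> ideal.span G" using top by blast
    moreover have "restrict_mpoly ?X f = mon (\<beta> g) (cnj (c g) - c g)"
    proof (rule poly_mapping_eqI)
      fix \<kappa>
      show "coeff (restrict_mpoly ?X f) \<kappa> = coeff (mon (\<beta> g) (cnj (c g) - c g)) \<kappa>"
      proof (cases "weight w \<kappa> = weight w (\<alpha> g) \<and> total_degree \<kappa> = total_degree (\<alpha> g)")
        case True
        then show ?thesis using F_top[OF g, of \<kappa>] ne[OF g]
          by (simp add: coeff_restrict_mpoly f_def lookup_minus coeff_map co[OF g] lookup_single when_def)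
      next
        case False
        then have "coeff (restrict_mpoly ?X f) \<kappa> = 0"
          using f_keys[of \<kappa>] by (auto simp: coeff_restrict_mpoly in_keys_iff)
        moreover have "\<kappa> \<noteq> \<beta> g" using False hom_g[OF g] by auto
        ultimately show ?thesis by (simp add: lookup_single_not_eq)
      qed
    qed
    ultimately have "mon 0 (inverse (cnj (c g) - c g)) * mon (\<beta> g) (cnj (c g) - c g) \<in> initial_ideal w I"
      unfolding span by (intro ideal.span_scale) simp
    then show False using no_mon c by (simp add: mult_single)
  qed
  moreover have "binomial_lift (constant_part I) w G \<alpha> \<beta> c F"
    by unfold_locales (use ideal fin G_eq nz hom_g F rest top no_mon span in auto)
  ultimately show ?thesis by blast
qed

lemma mon_value_sign:
  assumes "\<And>i. s i \<in> {1, -1 :: int}"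
  shows "mon_value (\<lambda>i. real_of_int (s i)) \<kappa> \<in> {1, -1}"
proof -
  have "(\<Prod>i\<in>A. real_of_int (s i) ^ k i) \<in> {1, -1}" for A k
  proof (induction A rule: infinite_finite_induct)
    case (insert i A)
    have "real_of_int (s i) ^ k i \<in> {1, -1}"
      using assms[of i] by (cases "even (k i)") auto
    then show ?case using insert by auto
  qed auto
  then show ?thesis unfolding mon_value_def .
qed

text \<open>At the sign vector \<open>s\<close> the terms of \<open>g\<close> have the values
  \<open>sg \<alpha>\<close> and \<open>- x * sg \<beta>\<close>. If the product were not positive,
  these would have the same sign, and the image of \<open>g\<close> would have coefficients of that
  sign only.\<close>

lemma opposite_signs:
  fixes s :: "'n::finite \<Rightarrow> int"
  assumes s: "\<And>i. s i \<in> {1, -1}" and p: "bij p"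
    and g: "g = mon \<alpha> 1 - mon \<beta> c" "\<alpha> \<noteq> \<beta>" "c \<noteq> 0" "c \<in> \<real>"
    and nonneg: "signed_perm p s g \<notin> nonneg_polys" and nonpos: "signed_perm p s g \<notin> nonpos_polys"
  shows "0 < Re c * mon_value (\<lambda>i. of_int (s i)) \<alpha> * mon_value (\<lambda>i. of_int (s i)) \<beta>"
proof (rule ccontr)
  assume not_pos: "\<not> ?thesis"
  define sg where "sg = (\<lambda>\<kappa>. mon_value (\<lambda>i. real_of_int (s i)) \<kappa>)"
  have sg: "sg \<kappa> = 1 \<or> sg \<kappa> = -1" for \<kappa> using mon_value_sign[of s \<kappa>, OF s] by (auto simp: sg_def)
  have sg': "mon_value (\<lambda>i. of_int (s i)) \<kappa> = complex_of_real (sg \<kappa>)" for \<kappa>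
    using mon_value_of_real[where r = "\<lambda>i. real_of_int (s i)" and \<alpha> = \<kappa>] by (simp add: sg_def)
  obtain x where x: "c = complex_of_real x" using g(4) by (auto elim: Reals_cases)
  have co: "coeff g \<kappa> * mon_value (\<lambda>i. of_int (s i)) \<kappa> = complex_of_real
      (if \<kappa> = \<alpha> then sg \<alpha> else if \<kappa> = \<beta> then - x * sg \<beta> else 0)" for \<kappa>
    using g(2) by (simp add: g(1) lookup_minus lookup_single when_def sg' x)
  have lt: "x * sg \<alpha> * sg \<beta> < 0"
    using not_pos sg[of \<alpha>] sg[of \<beta>] g(3) by (auto simp: x sg_def)
  show False
  proof (cases "sg \<alpha> = 1")
    case True
    then have "coeff g \<kappa> * mon_value (\<lambda>i. of_int (s i)) \<kappa> \<in> \<real>\<^sub>\<ge>\<^sub>0" for \<kappa>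
      unfolding co nonneg_Reals_of_real_iff using lt by auto
    then show False
      using nonneg coeffs_signed_perm_iff[OF p, of "\<real>\<^sub>\<ge>\<^sub>0" s g] by (simp add: nonneg_polys_def)
  next
    case False
    then have "sg \<alpha> = -1" using sg by blast
    then have "coeff g \<kappa> * mon_value (\<lambda>i. of_int (s i)) \<kappa> \<in> \<real>\<^sub>\<le>\<^sub>0" for \<kappa>
      unfolding co nonpos_Reals_of_real_iff using lt by auto
    then show False
      using nonpos coeffs_signed_perm_iff[OF p, of "\<real>\<^sub>\<le>\<^sub>0" s g] by (simp add: nonpos_polys_def)
  qed
qed

text \<open>Removing the signs and permuting coordinates takes a zero with sign pattern
  \<open>s\<close> near \<open>w\<close> to a positive point near \<open>perm_vec p w\<close>.
  Vanishing on the constant generators suffices for membership in \<open>V(I)\<close>.\<close>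

lemma in_Trop_pos_if_lifts:
  fixes I :: "('n::finite, puiseux) mpoly set"
  assumes real: "generated_by_real_polys I" and inv: "signed_perm p s ` I = I"
    and p: "bij p" and s: "\<And>i. s i \<in> {1, -1}"
    and near: "\<And>\<epsilon>. \<epsilon> > 0 \<Longrightarrow> \<exists>z v. \<exists>N>0. (\<forall>i. \<bar>real N * w $ i - of_int (v i)\<bar> < \<epsilon>)
      \<and> (\<forall>i. \<exists>r>0. puiseux_leads (- of_int (v i) / of_nat N) (of_int (s i) * complex_of_real r) (z i))
      \<and> (\<forall>f\<in>constant_part I. subst puiseux_const z f = 0)"
  shows "perm_vec p w \<in> Trop_pos I"
  unfolding Trop_pos_def closure_approachable
proof (intro allI impI)
  fix e :: real assume "e > 0"
  \<comment> \<open>Keeps the sum of the coordinate errors at most \<open>e / 2\<close>.\<close>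
  define \<epsilon> where "\<epsilon> = e / (2 * CARD('n))"
  have "\<epsilon> > 0" using \<open>e > 0\<close> by (simp add: \<epsilon>_def)
  from near[OF this] obtain z v N where N: "N > 0"
    and v: "\<And>i. \<bar>real N * w $ i - of_int (v i)\<bar> < \<epsilon>"
    and z: "\<And>i. \<exists>r>0. puiseux_leads (- of_int (v i) / of_nat N) (of_int (s i) * complex_of_real r) (z i)"
    and zero: "\<And>f. f \<in> constant_part I \<Longrightarrow> subst puiseux_const z f = 0" by blast
  have s2: "of_int (s i) * (of_int (s i) * x) = x" for i and x :: "'b::comm_ring_1"
    using s[of i] by auto
  define x :: "puiseux ^ 'n" where "x = (\<chi> j. of_int (s (inv_into UNIV p j)) * z (inv_into UNIV p j))"
  have x_p: "x $ p i = of_int (s i) * z i" for i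
    using p by (simp add: x_def bij_is_inj)
  have val: "x $ p i \<in> R_pos \<and> puiseux_val (x $ p i) = - of_int (v i) / of_nat N" for i
  proof -
    obtain r where r: "r > 0"
      "puiseux_leads (- of_int (v i) / of_nat N) (of_int (s i) * complex_of_real r) (z i)"
      using z by blast
    have "puiseux_leads (0 + - of_int (v i) / of_nat N) (of_int (s i) * (of_int (s i) * complex_of_real r))
        (puiseux_const (of_int (s i)) * z i)"
      by (intro puiseux_leads_mult puiseux_leads_const r(2))
    moreover have "puiseux_const (of_int (s i)) = of_int (s i)"
      using s[of i] by (auto simp: puiseux_const.hom_one puiseux_const.hom_uminus)
    ultimately have "puiseux_leads (- of_int (v i) / of_nat N) (complex_of_real r) (x $ p i)"
      by (simp add: s2 x_p)
    from puiseux_leadsD[OF this] r(1) show ?thesis by (simp add: R_pos_def)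
  qed
  have surj: "j = p (inv_into UNIV p j)" for j using p by (simp add: bij_is_surj surj_f_inv_f)
  have "x \<in> variety I"
    unfolding variety_signed_perm[OF inv]
  proof
    fix f assume f: "f \<in> I"
    obtain B where B: "I = ideal.span (Poly_Mapping.map puiseux_const ` B)" "constant_part I = ideal.span B"
      using real_generators[OF real] by metis
    have "subst (\<lambda>c. c) z f = 0"
    proof (rule id_hom.subst_span_eq_0)
      show "f \<in> ideal.span (Poly_Mapping.map puiseux_const ` B)" using f B(1) by simp
      show "subst (\<lambda>c. c) z b = 0" if "b \<in> Poly_Mapping.map puiseux_const ` B" for b
        using that zero ideal.span_base[of _ B] by (auto simp: subst_map_const B(2))
    qed
    then show "subst (\<lambda>c. c) (\<lambda>i. of_int (s i) * x $ p i) f = 0" by (simp add: x_p s2)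
  qed
  moreover have "x $ j \<in> R_pos" for j using val surj[of j] by metis
  ultimately have x_in: "x \<in> variety I \<inter> {z. \<forall>i. z $ i \<in> R_pos}" by blast
  define y :: "real ^ 'n" where "y = (\<chi> i. - real_of_rat (puiseux_val (x $ i)))"
  have "\<bar>y $ j - perm_vec p w $ j\<bar> \<le> \<epsilon>" for j
  proof -
    define i where "i = inv_into UNIV p j"
    have j: "j = p i" unfolding i_def by (rule surj)
    have "y $ j - perm_vec p w $ j = of_int (v i) / real N - w $ i"
      using val[of i] by (simp add: y_def j perm_vec_nth[OF p] of_rat_divide of_rat_minus)
    also have "\<dots> = - (real N * w $ i - of_int (v i)) / real N" using N by (simp add: field_simps)
    finally have "\<bar>y $ j - perm_vec p w $ j\<bar> = \<bar>real N * w $ i - of_int (v i)\<bar> / real N"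
      by (simp add: abs_minus_commute)
    also have "\<dots> \<le> \<bar>real N * w $ i - of_int (v i)\<bar> / 1" using N by (intro divide_left_mono) auto
    finally show ?thesis using v[of i] by simp
  qed
  then have "(\<Sum>j\<in>UNIV. \<bar>(y - perm_vec p w) $ j\<bar>) \<le> (\<Sum>j\<in>(UNIV :: 'n set). \<epsilon>)"
    by (intro sum_mono) simp
  also have "\<dots> = e / 2" by (simp add: \<epsilon>_def)
  also have "\<dots> < e" using \<open>e > 0\<close> by simp
  finally have "dist y (perm_vec p w) < e"
    using norm_le_l1_cart[of "y - perm_vec p w"] by (simp add: dist_norm)
  then show "\<exists>y\<in>(\<lambda>z. \<chi> i. - real_of_rat (puiseux_val (z $ i))) ` (variety I \<inter> {z. \<forall>i. z $ i \<in> R_pos}).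
      dist y (perm_vec p w) < e"
    using x_in unfolding y_def by blast
qed

theorem proposition5p7:
  fixes I :: "('n::finite, puiseux) mpoly set"
    and S :: "('s, 'm) monoid_scheme"
    and p :: "'s \<Rightarrow> 'n \<Rightarrow> 'n"
    and u :: "'s \<Rightarrow> 'n \<Rightarrow> int"
    and w :: "real ^ 'n"
    and leq :: "('n \<Rightarrow>\<^sub>0 nat) \<Rightarrow> ('n \<Rightarrow>\<^sub>0 nat) \<Rightarrow> bool"
    and G :: "('n, complex) mpoly set"
  assumes "homogeneous_ideal I"
    and "generated_by_real_polys I"
    and "acts_by_signed_perms S p u"
    and "\<forall>\<sigma>\<in>carrier S. signed_perm (p \<sigma>) (u \<sigma>) ` I = I"
    and "maximal_groebner_cone w I"
    and "binomial_ideal (initial_ideal w I)"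
    and "monomial_order leq"
    and "reduced_groebner_basis leq G (initial_ideal w I)"
    and "\<sigma> \<in> carrier S"
  shows "perm_vec (p \<sigma>) ` groebner_cone w I \<subseteq> Trop_pos I \<longleftrightarrow>
    signed_perm (p \<sigma>) (u \<sigma>) ` G \<inter> nonneg_polys = {} \<and>
    signed_perm (p \<sigma>) (u \<sigma>) ` G \<inter> nonpos_polys = {}"
proof -
  note hom = assms(1) and real = assms(2)
  have p: "bij (p \<sigma>)" and u: "\<And>i. u \<sigma> i \<in> {1, -1}"
    using assms(3,9) by (auto simp: acts_by_signed_perms_def)
  have inv: "signed_perm (p \<sigma>) (u \<sigma>) ` I = I" using assms(4,9) by blast
  interpret monomial_ordering leq by unfold_locales (rule assms(7))
  define J where "J = initial_ideal w I"
  have ideal: "ideal.subspace J" unfolding J_def initial_ideal_def by (rule ideal.subspace_span)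
  have gb: "reduced_groebner_basis leq G J" using assms(8) by (simp add: J_def)
  have w_in: "w \<in> groebner_cone w I"
    unfolding groebner_cone_def by (rule subsetD[OF closure_subset]) simp
  \<comment> \<open>\<open>w\<close> lies in its own cone, which is contained in
    \<open>Trop I\<close>.\<close>
  have no_mon: "mon \<kappa> 1 \<notin> J" for \<kappa>
    using assms(5) w_in by (auto simp: maximal_groebner_cone_def Trop_def J_def)
  show ?thesis
  proof
    assume "perm_vec (p \<sigma>) ` groebner_cone w I \<subseteq> Trop_pos I"
    then have pos: "perm_vec (p \<sigma>) w \<in> Trop_pos I" using w_in by blast
    have "signed_perm (p \<sigma>) (u \<sigma>) g \<notin> nonneg_polys \<and> signed_perm (p \<sigma>) (u \<sigma>) g \<notin> nonpos_polys"
      if g: "g \<in> G" for g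
    proof
      have g_in: "g \<in> initial_ideal w I" "g \<noteq> 0"
        using gb_subset[OF ideal gb g] gb_monic(1)[OF ideal gb g] by (simp_all add: J_def)
      show "signed_perm (p \<sigma>) (u \<sigma>) g \<notin> nonneg_polys"
      proof
        assume "signed_perm (p \<sigma>) (u \<sigma>) g \<in> nonneg_polys"
        then have "coeff g \<alpha> * mon_value (\<lambda>i. of_int (u \<sigma> i)) \<alpha> \<in> \<real>\<^sub>\<ge>\<^sub>0" for \<alpha>
          using coeffs_signed_perm_iff[OF p, of "\<real>\<^sub>\<ge>\<^sub>0" "u \<sigma>" g] by (simp add: nonneg_polys_def)
        then show False by (rule initial_ideal_not_sign_coherent[OF hom real inv p u pos g_in])
      qed
      show "signed_perm (p \<sigma>) (u \<sigma>) g \<notin> nonpos_polys"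
      proof
        assume "signed_perm (p \<sigma>) (u \<sigma>) g \<in> nonpos_polys"
        then have "coeff g \<alpha> * mon_value (\<lambda>i. of_int (u \<sigma> i)) \<alpha> \<in> \<real>\<^sub>\<le>\<^sub>0" for \<alpha>
          using coeffs_signed_perm_iff[OF p, of "\<real>\<^sub>\<le>\<^sub>0" "u \<sigma>" g] by (simp add: nonpos_polys_def)
        \<comment> \<open>The nonpositive case is the nonnegative one for
          \<open>- g\<close>.\<close>
        then have "coeff (- g) \<alpha> * mon_value (\<lambda>i. of_int (u \<sigma> i)) \<alpha> \<in> \<real>\<^sub>\<ge>\<^sub>0" for \<alpha>
          by (simp add: complex_nonpos_Reals_iff complex_nonneg_Reals_iff)
        moreover have "- g \<in> initial_ideal w I" "- g \<noteq> 0"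
          using g_in ideal.subspace_neg[OF ideal] by (simp_all add: J_def)
        ultimately show False
          using initial_ideal_not_sign_coherent[OF hom real inv p u pos] by blast
      qed
    qed
    then show "signed_perm (p \<sigma>) (u \<sigma>) ` G \<inter> nonneg_polys = {} \<and>
      signed_perm (p \<sigma>) (u \<sigma>) ` G \<inter> nonpos_polys = {}" by blast
  next
    assume signs: "signed_perm (p \<sigma>) (u \<sigma>) ` G \<inter> nonneg_polys = {} \<and>
      signed_perm (p \<sigma>) (u \<sigma>) ` G \<inter> nonpos_polys = {}"
    have fin: "finite G" using gb by (simp add: reduced_groebner_basis_def groebner_basis_def)
    have "\<exists>\<alpha> \<beta> c. \<alpha> \<noteq> \<beta> \<and> c \<noteq> 0 \<and> g = mon \<alpha> 1 - mon \<beta> c" if "g \<in> G" for g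
      using gb_binomial[OF ideal gb assms(6)[folded J_def] no_mon that] by metis
    then obtain \<alpha> \<beta> c where ne: "\<And>g. g \<in> G \<Longrightarrow> \<alpha> g \<noteq> \<beta> g" and nz: "\<And>g. g \<in> G \<Longrightarrow> c g \<noteq> 0"
      and G_eq: "\<And>g. g \<in> G \<Longrightarrow> g = mon (\<alpha> g) 1 - mon (\<beta> g) (c g)" by metis
    \<comment> \<open>The same \<open>G\<close> serves for every \<open>v\<close> with this initial
      ideal; the closure is then reached by continuity.\<close>
    have "perm_vec (p \<sigma>) v \<in> Trop_pos I" if v: "initial_ideal v I = initial_ideal w I" for v
    proof -
      have Jv: "initial_ideal v I = J" using v by (simp add: J_def)
      have "(\<exists>F. binomial_lift (constant_part I) v G \<alpha> \<beta> c F) \<and> (\<forall>g\<in>G. c g \<in> \<real>)"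
      proof (rule binomial_lift_exists[OF hom real])
        show "mon \<kappa> 1 \<notin> initial_ideal v I" for \<kappa> unfolding Jv by (rule no_mon)
        show "initial_ideal v I = ideal.span G" unfolding Jv by (rule gb_span[OF ideal gb])
        show "g = mon (\<alpha> g) 1 - mon (\<beta> g) (c g)" if "g \<in> G" for g by (rule G_eq[OF that])
      qed (simp_all add: fin ne nz)
      then obtain F where lift: "binomial_lift (constant_part I) v G \<alpha> \<beta> c F"
        and c_real: "\<And>g. g \<in> G \<Longrightarrow> c g \<in> \<real>" by blast
      have sign: "0 < Re (c g) * mon_value (\<lambda>i. of_int (u \<sigma> i)) (\<alpha> g) * mon_value (\<lambda>i. of_int (u \<sigma> i)) (\<beta> g)"
        if g: "g \<in> G" for g
      proof (rule opposite_signs[OF _ p G_eq[OF g]])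
        show "signed_perm (p \<sigma>) (u \<sigma>) g \<notin> nonneg_polys" "signed_perm (p \<sigma>) (u \<sigma>) g \<notin> nonpos_polys"
          using signs g by blast+
      qed (fact u ne[OF g] nz[OF g] c_real[OF g])+
      show ?thesis
      proof (rule in_Trop_pos_if_lifts[OF real inv p u])
        fix \<epsilon> :: real assume "\<epsilon> > 0"
        then show "\<exists>z va. \<exists>N>0. (\<forall>i. \<bar>real N * v $ i - of_int (va i)\<bar> < \<epsilon>)
          \<and> (\<forall>i. \<exists>r>0. puiseux_leads (- of_int (va i) / of_nat N)
              (of_int (u \<sigma> i) * complex_of_real r) (z i))
          \<and> (\<forall>f\<in>constant_part I. subst puiseux_const z f = 0)"
          by (intro binomial_lift.positive_point_near[OF lift])
            (erule ne c_real sign constant_part_restrict[OF hom] | rule u | assumption)+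
      qed
    qed
    then have "perm_vec (p \<sigma>) ` {v. initial_ideal v I = initial_ideal w I} \<subseteq> Trop_pos I" by blast
    then show "perm_vec (p \<sigma>) ` groebner_cone w I \<subseteq> Trop_pos I"
      unfolding groebner_cone_def
    proof (rule image_closure_subset[rotated 2])
      show "continuous_on (closure {v. initial_ideal v I = initial_ideal w I}) (perm_vec (p \<sigma>))"
        unfolding perm_vec_def by (intro continuous_intros)
      show "closed (Trop_pos I)" by (simp add: Trop_pos_def)
    qed
  qed
qed

end
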